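(* Let $\beta\in\mathbb{C}$ with $\operatorname{Re}(\beta)>0$. For all $s\in\mathbb{C}$ with $\operatorname{Re}(s)>-1/2$, $$\begin{aligned} &\Gamma\left(s+\tfrac12\right)\left\{\frac{\zeta(-s)}{2\beta^{s+\frac12}}+\sum_{n=1}^{\infty}\frac{\sigma_s(n)}{2}\left[(\beta-in)^{-s-\frac12}+(\beta+in)^{-s-\frac12}+\frac{2}{n^{s+\frac12}}\sin\left(\frac{\pi}{2}\left(s-\frac12\right)\right)\right]\right\}\\ &=(2\pi)^s\left\{-2\pi\sqrt{\pi\beta}\,\zeta(-s)-\sqrt{\frac{\pi}{2}}\,\zeta\left(\tfrac12\right)\zeta\left(\tfrac12-s\right)+\sqrt{\pi}\sum_{n=1}^{\infty}\frac{\sigma_s(n)}{\sqrt{n}}e^{-2\pi\sqrt{2n\beta}}\sin\left(\frac{\pi}{4}-2\pi\sqrt{2n\beta}\right)\right\}. \end{aligned}$$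
   Context: $\sigma_s(n)=\sum_{d\mid n}d^s$; $\zeta$ is the Riemann zeta function. Square roots and complex powers are principal. *)

theory Defs
  imports "HOL-Analysis.Analysis"
begin

(* The analytic continuation to the punctured plane; it is unique because -{1} is connected.
   The value 0 at the pole is an arbitrary convention that makes the description definite. *)
definition riemann_zeta :: "complex \<Rightarrow> complex" where
  "riemann_zeta = (THE f. f holomorphic_on (- {1}) \<and>
     (\<forall>s. Re s > 1 \<longrightarrow> (\<lambda>n. 1 / of_nat (Suc n) powr s) sums f s) \<and> f 1 = 0)"

(* Intended for n > 0 only: every d divides 0, so the sum is over an infinite set there. *)
definition divisor_sigma :: "complex \<Rightarrow> nat \<Rightarrow> complex" where
  "divisor_sigma s n = (\<Sum>d | d dvd n. of_nat d powr s)"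

definition lhs_term :: "complex \<Rightarrow> complex \<Rightarrow> nat \<Rightarrow> complex" where
  "lhs_term \<beta> s n = divisor_sigma s n / 2 *
     ((\<beta> - \<i> * of_nat n) powr (- s - 1/2) + (\<beta> + \<i> * of_nat n) powr (- s - 1/2)
      + 2 / of_nat n powr (s + 1/2) * sin (of_real pi / 2 * (s - 1/2)))"

definition rhs_term :: "complex \<Rightarrow> complex \<Rightarrow> nat \<Rightarrow> complex" where
  "rhs_term \<beta> s n = divisor_sigma s n / of_real (sqrt (of_nat n)) *
     exp (- 2 * of_real pi * csqrt (2 * of_nat n * \<beta>)) *
     sin (of_real pi / 4 - 2 * of_real pi * csqrt (2 * of_nat n * \<beta>))"

end

theory Submission
  imports Defs "HOL-Complex_Analysis.Complex_Analysis" "HOL-Real_Asymp.Real_Asymp"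
begin

text \<open>
  Put \<open>a = s + 1/2\<close>. Splitting \<open>n = d m\<close> turns the left-hand series into the absolutely convergent
  double sum of \<open>d\<^sup>-\<^sup>1\<^sup>/\<^sup>2 B\<^sub>m(\<beta>/d) / 2\<close>, where
  \<open>B\<^sub>m(z) = (z + im)\<^sup>-\<^sup>a + (z - im)\<^sup>-\<^sup>a - 2 cos(\<pi>a/2) m\<^sup>-\<^sup>a\<close>. Poisson summation for
  \<open>t\<^sup>a\<^sup>-\<^sup>1 (exp(-2\<pi>zt) - 1)\<close>, a regularized Lipschitz formula, identifies \<open>\<Sum>\<^sub>m B\<^sub>m(z)\<close> with
  a multiple of \<open>F(z) = \<Sum>\<^sub>k k\<^sup>a\<^sup>-\<^sup>1 exp(-2\<pi>kz) - \<zeta>(1 - a) - \<Gamma>(a) (2\<pi>z)\<^sup>-\<^sup>a\<close>. Solved for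
  \<open>\<zeta>(1 - a)\<close> at \<open>z = 1\<close>, it also continues \<open>\<zeta>\<close> to the left half plane; the functional
  equation is never needed.

  For fixed \<open>k\<close>, Poisson summation of \<open>d\<^sup>-\<^sup>1\<^sup>/\<^sup>2 exp(-2\<pi>k\<beta>/d)\<close> over \<open>d\<close> produces the exponentials on the
  right-hand side. To interchange the sums over \<open>d\<close> and \<open>k\<close>, replace \<open>d\<^sup>-\<^sup>1\<^sup>/\<^sup>2\<close> by \<open>d\<^sup>-\<^sup>b\<close>: for
  large \<open>Re b\<close> everything converges absolutely, and the resulting identity continues to
  \<open>Re b > a\<close> because the difference between sum and integral over \<open>d\<close> is \<open>O(k\<^sup>-\<^sup>b)\<close>. The value
  \<open>b = 1/2\<close> is admissible for \<open>0 < a < 1/2\<close>. This proves the theorem for real \<open>\<beta>\<close> and such \<open>a\<close>;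
  both sides are holomorphic in \<open>s\<close> and in \<open>\<beta>\<close>.
\<close>

section \<open>Series of holomorphic functions\<close>

text \<open>At the exponents that occur, neither double series can be expanded naively: the sum of
  m^(-a) diverges for a < 1, and at b = 1/2 so does the positive double series of d^(-b) k^(a-1)
  exp(-2 pi k \<beta> / d), which rules out a direct exchange of summations. The divergent parts
  have to be named as zeta values: the k-sum is Gamma(a) (2 pi z)^(-a) + zeta(1-a) + O(z) as z tends
  to 0, and the d-sum is close to its integral over x > 0. The terms of the theorem outside the two
  series are these parts at b = 1/2. The power (2 pi \<beta> / d)^(-a), summed against d^(-b), gives
  zeta(b-a) = zeta(-s) on the left. The constant zeta(1-a) meets zeta(b) and gives the product of
  two zeta values. The integral Gamma(b-1) (2 pi \<beta> k)^(1-b), summed against k^(a-1), gives the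
  other zeta(-s), with Gamma(-1/2) = -2 sqrt(pi). The exponent 1/2 arises as a - s. For it the
  Laplace transform of x^(-b) exp(-c/x), in general a Bessel function, is elementary; hence the
  exponentials and sines.\<close>

lemma
  fixes f :: "nat \<Rightarrow> complex \<Rightarrow> complex"
  assumes S: "open S" and hol: "\<And>n. f n holomorphic_on S"
    and bound: "\<And>z. z \<in> S \<Longrightarrow> \<exists>d>0. \<exists>M. summable M \<and>
                  (\<forall>\<^sub>F n in sequentially. \<forall>w \<in> ball z d \<inter> S. norm (f n w) \<le> M n)"
  shows holomorphic_on_suminf: "(\<lambda>z. \<Sum>n. f n z) holomorphic_on S"
    and summable_of_local_bound: "z \<in> S \<Longrightarrow> summable (\<lambda>n. f n z)"
proof -
  show "(\<lambda>z. \<Sum>n. f n z) holomorphic_on S"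
  proof (rule holomorphic_uniform_sequence[OF S])
    show "(\<lambda>z. \<Sum>i<n. f i z) holomorphic_on S" for n
      by (intro holomorphic_intros hol)
    fix z assume z: "z \<in> S"
    obtain d M where d: "d > 0" and M: "summable M"
      and le: "\<forall>\<^sub>F n in sequentially. \<forall>w \<in> ball z d \<inter> S. norm (f n w) \<le> M n"
      using bound[OF z] by blast
    obtain e where e: "e > 0" "cball z e \<subseteq> S"
      using S z open_contains_cball by blast
    define r where "r = min e (d / 2)"
    have r: "r > 0" "cball z r \<subseteq> S" "cball z r \<subseteq> ball z d \<inter> S"
      using d e by (auto simp: r_def)
    \<comment> \<open>The M-test in its eventual form: for the left-hand series of the theorem,
      bounds are available only once n is large compared with \<beta>.\<close>
    have "uniform_limit (cball z r) (\<lambda>n x. \<Sum>i<n. f i x) (\<lambda>x. \<Sum>i. f i x) sequentially"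
      by (rule Weierstrass_m_test_ev[OF _ M]) (use le r(3) in \<open>auto elim!: eventually_mono\<close>)
    thus "\<exists>d>0. cball z d \<subseteq> S \<and>
            uniform_limit (cball z d) (\<lambda>n z. \<Sum>i<n. f i z) (\<lambda>z. \<Sum>n. f n z) sequentially"
      using r by blast
  qed
next
  assume z: "z \<in> S"
  obtain d M where d: "d > 0" and M: "summable M"
    and le: "\<forall>\<^sub>F n in sequentially. \<forall>w \<in> ball z d \<inter> S. norm (f n w) \<le> M n"
    using bound[OF z] by blast
  show "summable (\<lambda>n. f n z)"
    by (rule summable_comparison_test_ev[OF _ M])
       (use le z d in \<open>auto elim!: eventually_mono\<close>)
qed

text \<open>The identity theorem along a real segment, whose midpoint is a limit point of it. Every
  passage from real to complex parameters below has this form.\<close>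

lemma holomorphic_eq_from_real_interval:
  fixes f g :: "complex \<Rightarrow> complex"
  assumes f: "f holomorphic_on S" and g: "g holomorphic_on S"
    and S: "open S" "connected S" and ab: "a < b"
    and sub: "\<And>x. a < x \<Longrightarrow> x < b \<Longrightarrow> of_real x \<in> S"
    and eq: "\<And>x. a < x \<Longrightarrow> x < b \<Longrightarrow> f (of_real x) = g (of_real x)"
    and z: "z \<in> S"
  shows "f z = g z"
proof -
  define m where "m = (a + b) / 2"
  have m: "a < m" "m < b" using ab by (auto simp: m_def)
  have "f z - g z = 0"
  proof (rule analytic_continuation[where f = "\<lambda>z. f z - g z" and S = S and U = "of_real ` {a<..<b}" and \<xi> = "of_real m"])
    show "(\<lambda>z. f z - g z) holomorphic_on S" by (intro holomorphic_intros f g)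
    show "complex_of_real ` {a<..<b} \<subseteq> S" using sub by auto
    show "complex_of_real m \<in> S" using sub m by auto
    have "m islimpt {a<..<b}"
      by (rule interior_limit_point) (use m in \<open>simp add: interior_open\<close>)
    hence "\<exists>f. (\<forall>n. f n \<in> {a<..<b} - {m}) \<and> f \<longlonglongrightarrow> m"
      by (simp add: islimpt_sequential)
    then obtain f where f: "\<And>n. f n \<in> {a<..<b} - {m}" "f \<longlonglongrightarrow> m" by blast
    thus "complex_of_real m islimpt complex_of_real ` {a<..<b}"
      unfolding islimpt_sequential
      by (intro exI[of _ "\<lambda>n. of_real (f n)"]) (auto intro!: tendsto_intros)
  qed (use S eq z in auto)
  thus ?thesis by simp
qed

section \<open>The zeta function in the right half plane\<close>

text \<open>The difference of n^(-s) and the integral of x^(-s) over [n, n+1], with the integral in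
  closed form.\<close>

definition zeta_diff :: "nat \<Rightarrow> complex \<Rightarrow> complex" where
  "zeta_diff n s = of_nat n powr (- s) -
     (of_nat (Suc n) powr (1 - s) - of_nat n powr (1 - s)) / (1 - s)"

text \<open>The Euler-Maclaurin continuation of zeta to Re s > 0: for Re s > 1 the fraction is the
  integral of x^(-s) over x > 1, and the series collects the differences between summands and
  integrals.\<close>

definition zeta_right :: "complex \<Rightarrow> complex" where
  "zeta_right s = 1 / (s - 1) + (\<Sum>n. zeta_diff (Suc n) s)"

lemma norm_powr_nat: "n > 0 \<Longrightarrow> norm (of_nat n powr s :: complex) = of_nat n powr Re s"
  using norm_powr_real_powr[of "of_nat n" s] by simp

lemma norm_powr_of_real: "x > 0 \<Longrightarrow> norm (of_real x powr s :: complex) = x powr Re s"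
  using norm_powr_real_powr[of "of_real x" s] by simp

text \<open>First-order Taylor expansion at n of the antiderivative x^(1-s) / (1-s), evaluated at
  n+1. The error is controlled by the second derivative -s x^(-s-1), whose modulus does not increase
  with x because Re s > -1.\<close>

lemma norm_zeta_diff_le:
  assumes n: "n > 0" and s: "s \<noteq> 1" and s0: "Re s > -1"
  shows "norm (zeta_diff n s) \<le> norm s * of_nat n powr (- Re s - 1)"
proof -
  define S where "S = closed_segment (complex_of_nat n) (of_nat (Suc n))"
  define f where "f i z = (if i = 0 then z powr (1 - s) / (1 - s) else
      if i = Suc 0 then z powr (- s) else - s * z powr (- s - 1))" for i :: nat and z :: complex
  have S: "\<exists>x::real. z = of_real x \<and> x \<ge> n" if "z \<in> S" for z
  proof -
    from that obtain u where u: "0 \<le> u" "u \<le> 1"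
       "z = (1 - u) *\<^sub>R complex_of_nat n + u *\<^sub>R of_nat (Suc n)"
      by (auto simp: S_def in_segment)
    hence "z = of_real (n + u)"
      by (simp add: scaleR_conv_of_real algebra_simps)
    with u show ?thesis by (intro exI[of _ "n + u"]) auto
  qed
  have "norm (f 0 (of_nat (Suc n)) - (\<Sum>i\<le>1. f i (of_nat n) * (of_nat (Suc n) - of_nat n) ^ i / fact i))
          \<le> (norm s * of_nat n powr (- Re s - 1)) * norm (of_nat (Suc n) - complex_of_nat n) ^ (Suc 1) / fact 1"
  proof (rule complex_Taylor[where S = S])
    show "convex S" by (simp add: S_def)
    fix z i assume zi: "z \<in> S" "i \<le> (1::nat)"
    obtain x where x: "z = of_real x" "x \<ge> n" using S zi by blast
    have z: "z \<notin> \<real>\<^sub>\<le>\<^sub>0" using x n by (auto simp: complex_nonpos_Reals_iff)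
    have "i = 0 \<or> i = 1" using zi by auto
    thus "(f i has_field_derivative f (Suc i) z) (at z within S)"
    proof
      assume i: "i = 0"
      have "((\<lambda>z. z powr (1 - s) / (1 - s)) has_field_derivative z powr (- s)) (at z within S)"
        using s z by (auto intro!: derivative_eq_intros)
      thus ?thesis by (simp add: f_def[abs_def] i)
    next
      assume i: "i = 1"
      have "((\<lambda>z. z powr (- s)) has_field_derivative - s * z powr (- s - 1)) (at z within S)"
        using s z by (auto intro!: derivative_eq_intros simp: field_simps)
      thus ?thesis by (simp add: f_def[abs_def] i)
    qed
  next
    fix z assume "z \<in> S"
    then obtain x where x: "z = of_real x" "x \<ge> n" using S by blast
    have "norm (z powr (- s - 1)) = x powr (- Re s - 1)"
      using x n norm_powr_of_real[of x "-s-1"] by simp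
    also have "\<dots> \<le> n powr (- Re s - 1)"
      using x n s0 by (intro powr_mono2') auto
    finally show "norm (f (Suc 1) z) \<le> norm s * of_nat n powr (- Re s - 1)"
      by (simp add: f_def norm_mult mult_left_mono)
  qed (auto simp: S_def)
  moreover have "f 0 (of_nat (Suc n)) - (\<Sum>i\<le>1. f i (of_nat n) * (of_nat (Suc n) - of_nat n) ^ i / fact i)
     = - zeta_diff n s"
    by (simp add: f_def zeta_diff_def diff_divide_distrib algebra_simps)
  ultimately show ?thesis by simp
qed

lemma zeta_diff_local_bound:
  assumes "Re z > 0"
  shows "\<exists>d>0. \<exists>M. summable M \<and>
      (\<forall>\<^sub>F n in sequentially. \<forall>w \<in> ball z d \<inter> ({s. Re s > 0} - {1}). norm (zeta_diff (Suc n) w) \<le> M n)"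
proof (intro exI conjI)
  let ?d = "Re z / 2"
  show "?d > 0" using assms by simp
  have "summable (\<lambda>n. real n powr (- ?d - 1))"
    using assms by (subst summable_real_powr_iff) simp
  hence "summable (\<lambda>n. real (Suc n) powr (- ?d - 1))" by (subst summable_Suc_iff)
  thus "summable (\<lambda>n. (norm z + ?d) * real (Suc n) powr (- ?d - 1))" by (rule summable_mult)
  show "\<forall>\<^sub>F n in sequentially. \<forall>w \<in> ball z ?d \<inter> ({s. Re s > 0} - {1}).
          norm (zeta_diff (Suc n) w) \<le> (norm z + ?d) * real (Suc n) powr (- ?d - 1)"
  proof (intro always_eventually allI ballI)
    fix n w assume w: "w \<in> ball z ?d \<inter> ({s. Re s > 0} - {1})"
    hence dw: "norm (z - w) < ?d" by (simp add: dist_norm)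
    have "\<bar>Re z - Re w\<bar> \<le> norm (z - w)" using abs_Re_le_cmod[of "z - w"] by simp
    hence Rw: "Re w > ?d" using dw by linarith
    have nw: "norm w \<le> norm z + ?d"
      using norm_triangle_ineq2[of w z] dw by (simp add: norm_minus_commute)
    have "norm (zeta_diff (Suc n) w) \<le> norm w * of_nat (Suc n) powr (- Re w - 1)"
      using w by (intro norm_zeta_diff_le) auto
    also have "\<dots> \<le> (norm z + ?d) * real (Suc n) powr (- ?d - 1)"
      using nw Rw assms by (intro mult_mono powr_mono) auto
    finally show "norm (zeta_diff (Suc n) w) \<le> (norm z + ?d) * real (Suc n) powr (- ?d - 1)" .
  qed
qed

lemma
  shows holomorphic_zeta_right: "zeta_right holomorphic_on {s. Re s > 0} - {1}"
    and summable_zeta_diff: "Re s > 0 \<Longrightarrow> s \<noteq> 1 \<Longrightarrow> summable (\<lambda>n. zeta_diff (Suc n) s)"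
proof -
  have S: "open ({s. Re s > 0} - {1 :: complex})"
    by (intro open_Diff open_halfspace_Re_gt) auto
  have hol: "zeta_diff (Suc n) holomorphic_on {s. Re s > 0} - {1}" for n
    unfolding zeta_diff_def by (intro holomorphic_intros) auto
  note * = S hol zeta_diff_local_bound
  have "(\<lambda>s. \<Sum>n. zeta_diff (Suc n) s) holomorphic_on {s. Re s > 0} - {1}"
    by (rule holomorphic_on_suminf) (use * in auto)
  thus "zeta_right holomorphic_on {s. Re s > 0} - {1}"
    unfolding zeta_right_def by (intro holomorphic_intros) auto
  show "summable (\<lambda>n. zeta_diff (Suc n) s)" if "Re s > 0" "s \<noteq> 1"
    by (rule summable_of_local_bound[of "{s. Re s > 0} - {1}" "\<lambda>n. zeta_diff (Suc n)"])
       (use * that in auto)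
qed

text \<open>The closed forms of the integrals telescope. For 0 < Re s < 1 this exhibits zeta as the
  finite part of a divergent sum, which is how Poisson summation will meet it.\<close>

lemma zeta_right_limit':
  assumes "Re s > 0" "s \<noteq> 1"
  shows "(\<lambda>N. (\<Sum>n<N. of_nat (Suc n) powr (- s)) - of_nat (Suc N) powr (1 - s) / (1 - s)) \<longlonglongrightarrow> zeta_right s"
proof -
  have eq: "(\<Sum>n<N. of_nat (Suc n) powr (- s)) - of_nat (Suc N) powr (1 - s) / (1 - s) =
        1 / (s - 1) + (\<Sum>n<N. zeta_diff (Suc n) s)" for N
  proof (induction N)
    case 0
    show ?case using assms by (simp add: divide_simps)
  next
    case (Suc N)
    thus ?case using assms(2) by (simp add: zeta_diff_def diff_divide_distrib algebra_simps)
  qed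
  have "(\<lambda>N. 1 / (s - 1) + (\<Sum>n<N. zeta_diff (Suc n) s)) \<longlonglongrightarrow> zeta_right s"
    unfolding zeta_right_def
    by (intro tendsto_intros summable_LIMSEQ summable_zeta_diff assms)
  thus ?thesis unfolding eq .
qed

lemma tendsto_nat_powr_neg:
  assumes "Re s < 0"
  shows "(\<lambda>n. of_nat (Suc n) powr s :: complex) \<longlonglongrightarrow> 0"
proof (rule tendsto_norm_zero_cancel)
  have "(\<lambda>n. real (Suc n) powr Re s) \<longlonglongrightarrow> 0"
    using assms by real_asymp
  thus "(\<lambda>n. norm (of_nat (Suc n) powr s :: complex)) \<longlonglongrightarrow> 0"
    by (subst norm_powr_nat) auto
qed

text \<open>Moving the end point from N+1 to N costs one summand, which tends to 0. The end point N
  is the one that fits integrals over \<open>{0..real N}\<close>.\<close>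

lemma zeta_right_limit:
  assumes "Re s > 0" "s \<noteq> 1"
  shows "(\<lambda>N. (\<Sum>n<N. of_nat (Suc n) powr (- s)) - of_nat N powr (1 - s) / (1 - s)) \<longlonglongrightarrow> zeta_right s"
proof (rule LIMSEQ_imp_Suc)
  have "(\<lambda>N. ((\<Sum>n<N. of_nat (Suc n) powr (- s)) - of_nat (Suc N) powr (1 - s) / (1 - s))
           + of_nat (Suc N) powr (- s)) \<longlonglongrightarrow> zeta_right s + 0"
    using assms by (intro tendsto_add zeta_right_limit' tendsto_nat_powr_neg) auto
  thus "(\<lambda>N. (\<Sum>n<Suc N. of_nat (Suc n) powr (- s)) - of_nat (Suc N) powr (1 - s) / (1 - s)) \<longlonglongrightarrow> zeta_right s"
    by (simp add: algebra_simps)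
qed

lemma zeta_right_sums:
  assumes "Re s > 1"
  shows "(\<lambda>n. of_nat (Suc n) powr (- s)) sums zeta_right s"
proof -
  have "(\<lambda>N. ((\<Sum>n<N. of_nat (Suc n) powr (- s)) - of_nat (Suc N) powr (1 - s) / (1 - s)) +
         of_nat (Suc N) powr (1 - s) / (1 - s)) \<longlonglongrightarrow> zeta_right s + 0 / (1 - s)"
    using assms by (intro tendsto_intros zeta_right_limit' tendsto_nat_powr_neg) auto
  thus ?thesis by (simp add: sums_def)
qed

section \<open>Euler--Maclaurin and Poisson summation\<close>

lemma sawtooth_series:
  assumes r: "0 \<le> r" "r < 1"
  shows "(\<lambda>y. r ^ Suc y / real (Suc y) * sin (2 * pi * real (Suc y) * x)) sums
           (- Im (Ln (1 - of_real r * cis (2 * pi * x))))"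
proof -
  define q where "q = of_real r * cis (2 * pi * x)"
  have "norm (- q) < 1" using r by (simp add: q_def norm_mult)
  from Ln_series'[OF this] have "(\<lambda>n. - (q ^ n / of_nat n)) sums Ln (1 - q)"
    by simp
  \<comment> \<open>The term n = 0 is a division by zero and hence 0, so the shift of the index
    loses nothing.\<close>
  hence "(\<lambda>n. - (q ^ Suc n / of_nat (Suc n))) sums Ln (1 - q)"
    by (subst sums_Suc_iff) simp
  hence "(\<lambda>n. q ^ Suc n / of_nat (Suc n)) sums (- Ln (1 - q))"
    using sums_minus by fastforce
  from sums_Im[OF this]
  have "(\<lambda>n. Im (q ^ Suc n / of_nat (Suc n))) sums (- Im (Ln (1 - q)))" by simp
  moreover have "Im (q ^ Suc n / of_nat (Suc n)) =
      r ^ Suc n / real (Suc n) * sin (2 * pi * real (Suc n) * x)" for n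
  proof -
    have "q ^ Suc n = of_real (r ^ Suc n) * cis (2 * pi * real (Suc n) * x)"
      unfolding q_def power_mult_distrib Complex.DeMoivre by (simp add: algebra_simps)
    hence "q ^ Suc n / of_nat (Suc n) =
       of_real (r ^ Suc n / real (Suc n)) * cis (2 * pi * real (Suc n) * x)"
      by simp
    moreover have "Im (of_real c * cis t) = c * sin t" for c t
      by simp
    ultimately show ?thesis by (simp only:)
  qed
  ultimately show ?thesis unfolding q_def by (simp only:)
qed

lemma Re_one_minus_cis_pos:
  assumes "0 \<le> r" "r < 1"
  shows "Re (1 - of_real r * cis x) > 0"
proof -
  have "r * cos x \<le> r * 1" using assms by (intro mult_left_mono) auto
  thus ?thesis using assms by simp
qed

lemma sawtooth_bound:
  assumes "0 \<le> r" "r < 1"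
  shows "\<bar>Im (Ln (1 - of_real r * cis x))\<bar> \<le> pi / 2"
  using Re_Ln_pos_lt_imp[OF Re_one_minus_cis_pos[OF assms]] by (simp add: less_imp_le)

text \<open>The polar form 1 - exp(2 pi i t) = 2 sin(pi t) exp(i pi (t - 1/2)): the modulus is
  positive and the angle lies between -pi/2 and pi/2, so it is the principal argument. The second
  claim keeps the point off the branch cut, so that \<open>Ln\<close> is continuous there.\<close>

lemma Im_Ln_one_minus_cis:
  assumes x: "0 < t" "t < 1"
  shows "Im (Ln (1 - cis (2 * pi * t))) = pi * (t - 1 / 2)"
    and "Re (1 - cis (2 * pi * t)) > 0"
proof -
  have s: "sin (pi * t) > 0" using x by (intro sin_gt_zero) auto
  have "1 - cis (2 * pi * t) = of_real (2 * sin (pi * t)) * cis (pi * (t - 1 / 2))"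
  proof (rule complex_eqI)
    have "cos (2 * pi * t) = 1 - 2 * (sin (pi * t))\<^sup>2"
      using cos_double_sin[of "pi * t"] by (simp add: mult_ac)
    moreover have "cos (pi * (t - 1/2)) = sin (pi * t)"
      by (simp add: algebra_simps cos_diff)
    ultimately show "Re (1 - cis (2 * pi * t)) = Re (of_real (2 * sin (pi * t)) * cis (pi * (t - 1 / 2)))"
      by (simp add: power2_eq_square)
    have "sin (2 * pi * t) = 2 * sin (pi * t) * cos (pi * t)"
      using sin_double[of "pi * t"] by (simp add: mult_ac)
    moreover have "sin (pi * (t - 1/2)) = - cos (pi * t)"
      by (simp add: algebra_simps sin_diff)
    ultimately show "Im (1 - cis (2 * pi * t)) = Im (of_real (2 * sin (pi * t)) * cis (pi * (t - 1 / 2)))"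
      by simp
  qed
  hence eq: "1 - cis (2 * pi * t) = rcis (2 * sin (pi * t)) (pi * (t - 1 / 2))"
    by (simp add: rcis_def)
  have nz: "1 - cis (2 * pi * t) \<noteq> 0" using eq s by (simp add: rcis_def)
  have m: "pi * t < pi * 1" "pi * t > 0"
    using x by (auto simp: mult_strict_left_mono)
  have "Arg (1 - cis (2 * pi * t)) = pi * (t - 1 / 2)"
    by (rule Arg_unique'[OF _ _ eq]) (use s m pi_gt_zero in \<open>auto simp: algebra_simps simp del: pi_gt_zero\<close>)
  thus "Im (Ln (1 - cis (2 * pi * t))) = pi * (t - 1 / 2)"
    using nz by (simp add: Arg_eq_Im_Ln)
  have "cos (2 * pi * t) = 1 - 2 * (sin (pi * t))\<^sup>2"
    using cos_double_sin[of "pi * t"] by (simp add: mult_ac)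
  thus "Re (1 - cis (2 * pi * t)) > 0" using s by simp
qed

text \<open>Periodicity reduces x to its fractional part. At integers the argument of
  \<open>Ln\<close> would tend to its singularity 0; they will be removed from the integral as a
  null set.\<close>

lemma sawtooth_limit:
  assumes x: "x \<notin> \<int>" and r: "r \<longlonglongrightarrow> 1"
  shows "(\<lambda>n. Im (Ln (1 - of_real (r n) * cis (2 * pi * x)))) \<longlonglongrightarrow> pi * (frac x - 1 / 2)"
proof -
  have fx: "0 < frac x" "frac x < 1"
    using x frac_lt_1[of x] frac_ge_0[of x] by (auto simp: less_le frac_eq_0_iff)
  have "cis (2 * pi * x) = cis (2 * pi * frac x)"
  proof -
    have "2 * pi * x = 2 * pi * frac x + 2 * pi * of_int \<lfloor>x\<rfloor>"
      by (simp add: frac_def algebra_simps)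
    thus ?thesis by (simp add: cis_mult[symmetric] cis_multiple_2pi)
  qed
  moreover have "(\<lambda>n. Im (Ln (1 - of_real (r n) * cis (2 * pi * frac x)))) \<longlonglongrightarrow>
         Im (Ln (1 - of_real 1 * cis (2 * pi * frac x)))"
    using Im_Ln_one_minus_cis(2)[OF fx]
    by (intro tendsto_intros r) (auto simp: complex_nonpos_Reals_iff)
  ultimately show ?thesis using Im_Ln_one_minus_cis(1)[OF fx] by simp
qed

section \<open>Sum minus integral on the half line\<close>

lemma integral_tendsto_integral_Ioi:
  fixes f :: "real \<Rightarrow> 'a::euclidean_space"
  assumes f: "f absolutely_integrable_on {0<..}"
  shows "(\<lambda>N. integral {0..real N} f) \<longlonglongrightarrow> integral {0<..} f"
proof -
  have "(\<lambda>N. integral {0<..} (\<lambda>x. if x \<in> {0<..real N} then f x else 0)) \<longlonglongrightarrow> integral {0<..} f"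
  proof (rule dominated_convergence(2))
    show "(\<lambda>x. norm (f x)) integrable_on {0<..}"
      using f by (simp add: absolutely_integrable_on_def)
    fix N
    have "f absolutely_integrable_on {0<..real N}"
      by (rule set_integrable_subset[OF f]) auto
    hence "f integrable_on {0<..real N}" by (simp add: absolutely_integrable_on_def)
    thus "(\<lambda>x. if x \<in> {0<..real N} then f x else 0) integrable_on {0<..}"
      unfolding integrable_on_def by (subst has_integral_restrict) auto
  next
    fix x :: real assume x: "x \<in> {0<..}"
    obtain N0 :: nat where N0: "real N0 \<ge> x" using real_arch_simple by blast
    have "\<forall>\<^sub>F N in sequentially. f x = (if x \<in> {0<..real N} then f x else 0)"
      using eventually_ge_at_top[of N0]
      by eventually_elim (use x N0 in auto)
    thus "(\<lambda>N. if x \<in> {0<..real N} then f x else 0) \<longlonglongrightarrow> f x"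
      by (rule Lim_transform_eventually[OF tendsto_const])
  qed auto
  moreover have "integral {0<..} (\<lambda>x. if x \<in> {0<..real N} then f x else 0) = integral {0..real N} f" for N
  proof -
    have "integral {0<..} (\<lambda>x. if x \<in> {0<..real N} then f x else 0) = integral {0<..real N} f"
    proof -
      have sub: "{0<..real N} \<subseteq> {0<..}" by auto
      show ?thesis
        by (simp only: integral_def integrable_on_def has_integral_restrict[OF sub])
    qed
    also have "\<dots> = integral {0..real N} f"
      by (rule integral_spike_set) (auto intro: negligible_subset[of "{0}"])
    finally show ?thesis .
  qed
  ultimately show ?thesis by (simp only:)
qed

lemma absolutely_integrable_frac_scaleR:
  fixes g :: "real \<Rightarrow> 'a::euclidean_space"
  assumes "g absolutely_integrable_on {0<..}"
  shows "(\<lambda>x. frac x *\<^sub>R g x) absolutely_integrable_on {0<..}"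
proof (rule absolutely_integrable_bounded_measurable_product[where h = "(*\<^sub>R)" and f = frac, OF _ _ _ _ assms])
  show "bilinear ((*\<^sub>R) :: real \<Rightarrow> 'a \<Rightarrow> 'a)"
    by (simp add: bilinear_conv_bounded_bilinear bounded_bilinear_scaleR)
  have "(frac :: real \<Rightarrow> real) \<in> borel_measurable borel"
    unfolding frac_def[abs_def] by measurable
  hence "(frac :: real \<Rightarrow> real) \<in> borel_measurable lborel" by simp
  thus "(frac :: real \<Rightarrow> real) \<in> borel_measurable (lebesgue_on {0<..})"
    by (intro measurable_restrict_space1 measurable_completion)
  have "norm (frac x) \<le> 1" for x :: real
    using frac_ge_0[of x] frac_lt_1[of x] by simp
  thus "bounded (frac ` {0<..} :: real set)" unfolding bounded_iff by auto
qed auto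

text \<open>Made for functions such as x^(a-1) (exp(-c x) - 1) and x^(-1/2) exp(-c/x), whose sum and
  integral both diverge while their difference converges. The value at 0 and the limit at infinity
  make all boundary terms vanish; \<open>g'\<close> may be singular at 0.\<close>

locale euler_maclaurin =
  fixes g g' :: "real \<Rightarrow> 'a::euclidean_space"
  assumes cont: "continuous_on {0..} g"
    and der: "\<And>x. x > 0 \<Longrightarrow> (g has_vector_derivative g' x) (at x)"
    and g0 [simp]: "g 0 = 0"
    and ginf: "(\<lambda>N. g (real N)) \<longlonglongrightarrow> 0"
    and int: "g' absolutely_integrable_on {0<..}"
begin

lemma g_integrable: "a \<ge> 0 \<Longrightarrow> g integrable_on {a..b}"
  by (intro integrable_continuous_real continuous_on_subset[OF cont]) auto

lemma has_integral_g':
  assumes "a \<ge> 0" "a \<le> b"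
  shows "(g' has_integral (g b - g a)) {a..b}"
  using assms
  by (intro fundamental_theorem_of_calculus_interior der continuous_on_subset[OF cont]) auto

text \<open>On [N, N+1], integrate (x - N) g'(x) by parts: the boundary term is g(N+1), and the rest
  is minus the integral of g. At the right end point \<open>frac\<close> is 0 instead of 1, a single
  point that the integral does not see.\<close>

lemma has_integral_frac_g':
  "((\<lambda>x. frac x *\<^sub>R g' x) has_integral
      ((\<Sum>d<N. g (real (Suc d))) - integral {0..real N} g)) {0..real N}"
proof (induction N)
  case 0
  have "((\<lambda>x. frac x *\<^sub>R g' x) has_integral 0) {0}" by (rule has_integral_refl)
  thus ?case by simp
next
  case (Suc N)
  have "((\<lambda>x. (x - real N) *\<^sub>R g' x + 1 *\<^sub>R g x) has_integral
         ((real (Suc N) - real N) *\<^sub>R g (real (Suc N)) - (real N - real N) *\<^sub>R g (real N)))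
         {real N..real (Suc N)}"
  proof (rule fundamental_theorem_of_calculus_interior)
    show "continuous_on {real N..real (Suc N)} (\<lambda>x. (x - real N) *\<^sub>R g x)"
      by (intro continuous_intros continuous_on_subset[OF cont]) auto
    fix x assume "x \<in> {real N<..<real (Suc N)}"
    hence "x > 0" by auto
    thus "((\<lambda>x. (x - real N) *\<^sub>R g x) has_vector_derivative (x - real N) *\<^sub>R g' x + 1 *\<^sub>R g x) (at x)"
      by (intro has_vector_derivative_scaleR der) (auto intro!: derivative_eq_intros)
  qed auto
  hence "((\<lambda>x. (x - real N) *\<^sub>R g' x + g x) has_integral g (real (Suc N))) {real N..real (Suc N)}"
    by simp
  from has_integral_diff[OF this integrable_integral[OF g_integrable]]
  have "((\<lambda>x. (x - real N) *\<^sub>R g' x) has_integral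
          (g (real (Suc N)) - integral {real N..real (Suc N)} g)) {real N..real (Suc N)}"
    by simp
  hence "((\<lambda>x. frac x *\<^sub>R g' x) has_integral
          (g (real (Suc N)) - integral {real N..real (Suc N)} g)) {real N..real (Suc N)}"
  proof (rule has_integral_spike_finite[of "{real (Suc N)}", rotated 2])
    fix x assume "x \<in> {real N..real (Suc N)} - {real (Suc N)}"
    hence "\<lfloor>x\<rfloor> = int N" by (intro floor_unique) auto
    thus "frac x *\<^sub>R g' x = (x - real N) *\<^sub>R g' x" by (simp add: frac_def)
  qed auto
  from has_integral_combine[OF _ _ Suc.IH this]
  have "((\<lambda>x. frac x *\<^sub>R g' x) has_integral
      ((\<Sum>d<N. g (real (Suc d))) - integral {0..real N} g) +
        (g (real (Suc N)) - integral {real N..real (Suc N)} g)) {0..real (Suc N)}"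
    by simp
  moreover have "integral {0..real N} g + integral {real N..real (Suc N)} g = integral {0..real (Suc N)} g"
    by (rule Henstock_Kurzweil_Integration.integral_combine) (use g_integrable in auto)
  ultimately show ?case by (simp add: algebra_simps)
qed

lemma sum_minus_integral_limit:
  "(\<lambda>N. (\<Sum>d<N. g (real (Suc d))) - integral {0..real N} g)
      \<longlonglongrightarrow> integral {0<..} (\<lambda>x. frac x *\<^sub>R g' x)"
  using integral_tendsto_integral_Ioi[OF absolutely_integrable_frac_scaleR[OF int]]
  by (simp add: integral_unique[OF has_integral_frac_g'])

text \<open>With the limit just proved, sum minus integral is at most the total variation of g. For
  x^(-b) exp(-c/x) this becomes the decay in k on which the continuation in the exponent
  rests.\<close>

lemma norm_integral_frac_le:
  "norm (integral {0<..} (\<lambda>x. frac x *\<^sub>R g' x)) \<le> integral {0<..} (\<lambda>x. norm (g' x))"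
proof (rule integral_norm_bound_integral)
  show "(\<lambda>x. frac x *\<^sub>R g' x) integrable_on {0<..}"
    using absolutely_integrable_frac_scaleR[OF int] by (simp add: absolutely_integrable_on_def)
  show "(\<lambda>x. norm (g' x)) integrable_on {0<..}"
    using int by (simp add: absolutely_integrable_on_def)
  fix x :: real
  have "frac x * norm (g' x) \<le> 1 * norm (g' x)"
    by (intro mult_right_mono) (auto simp: frac_lt_1 less_imp_le)
  thus "norm (frac x *\<^sub>R g' x) \<le> norm (g' x)" by simp
qed

text \<open>The fundamental theorem with both end values 0. It disposes of the mean 1/2 of
  \<open>frac\<close>, and applied to exp(-B x) g(x) it is integration by parts for Laplace
  transforms.\<close>

lemma integral_g'_eq_0: "integral {0<..} g' = 0"
proof (rule LIMSEQ_unique)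
  show "(\<lambda>N. integral {0..real N} g') \<longlonglongrightarrow> integral {0<..} g'"
    by (rule integral_tendsto_integral_Ioi[OF int])
  have "integral {0..real N} g' = g (real N)" for N
    using integral_unique[OF has_integral_g'[of 0 "real N"]] by simp
  thus "(\<lambda>N. integral {0..real N} g') \<longlonglongrightarrow> 0" using ginf by simp
qed

end

lemma absolutely_integrable_continuous_bounded_mult:
  fixes f :: "real \<Rightarrow> 'b::{euclidean_space,real_normed_algebra}" and g :: "real \<Rightarrow> 'b"
  assumes g: "g absolutely_integrable_on {0<..}" and f: "continuous_on {0<..} f"
    and b: "\<And>x. x > 0 \<Longrightarrow> norm (f x) \<le> C"
  shows "(\<lambda>x. f x * g x) absolutely_integrable_on {0<..}"
proof (rule absolutely_integrable_bounded_measurable_product[where h = "(*)" and f = f, OF _ _ _ _ g])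
  show "bilinear ((*) :: 'b \<Rightarrow> 'b \<Rightarrow> 'b)"
    by (simp add: bilinear_conv_bounded_bilinear bounded_bilinear_mult)
  show "f \<in> borel_measurable (lebesgue_on {0<..})"
    by (intro continuous_imp_measurable_on_sets_lebesgue f) auto
  show "bounded (f ` {0<..})" using b unfolding bounded_iff by auto
qed auto

text \<open>The Fourier series of the sawtooth is Abel-regularized: \<^term>\<open>- Im (Ln (1 - of_real r * cis x))\<close>
  is bounded by \<^term>\<open>pi / 2\<close> uniformly in \<^term>\<open>r < (1::real)\<close>, so dominated convergence gives the
  limit \<open>r \<rightarrow> 1\<close>. Only \<^term>\<open>g'\<close>, not \<^term>\<open>g\<close>, has to be absolutely integrable.\<close>

lemma poisson_summation:
  fixes g g' :: "real \<Rightarrow> real"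
  assumes "euler_maclaurin g g'"
  defines "I \<equiv> (\<lambda>y. integral {0<..} (\<lambda>x. sin (2 * pi * real (Suc y) * x) * g' x))"
  assumes summ: "summable (\<lambda>y. \<bar>I y\<bar> / real (Suc y))"
  shows "(\<lambda>N. (\<Sum>d<N. g (real (Suc d))) - integral {0..real N} g)
           \<longlonglongrightarrow> (\<Sum>y. - I y / (pi * real (Suc y)))"
proof -
  interpret euler_maclaurin g g' by fact
  have fracint: "(\<lambda>x. frac x * g' x) integrable_on {0<..}"
    using absolutely_integrable_frac_scaleR[OF int] by (simp add: absolutely_integrable_on_def)
  have g'int: "g' integrable_on {0<..}" and ng'int: "(\<lambda>x. \<bar>g' x\<bar>) integrable_on {0<..}"
    using int by (auto simp: absolutely_integrable_on_def)
  have sinint: "(\<lambda>x. sin (2 * pi * real (Suc y) * x) * g' x) absolutely_integrable_on {0<..}" for y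
    by (rule absolutely_integrable_continuous_bounded_mult[OF int, where C = 1])
       (auto intro!: continuous_intros)
  define L where "L = (\<lambda>r x. - Im (Ln (1 - of_real r * cis (2 * pi * x))))"
  have L_series: "(\<lambda>y. r ^ Suc y / real (Suc y) * sin (2 * pi * real (Suc y) * x)) sums L r x"
    if "0 \<le> r" "r < 1" for r x
    unfolding L_def by (rule sawtooth_series[OF that])
  define R where "R = (\<lambda>n. 1 - 1 / real (n + 2))"
  have R: "0 \<le> R n" "R n < 1" for n by (auto simp: R_def)
  have R1: "R \<longlonglongrightarrow> 1" unfolding R_def by real_asymp
  have absum: "summable (\<lambda>y. r ^ Suc y / real (Suc y))" if "0 \<le> r" "r < 1" for r :: real
  proof (rule summable_comparison_test')
    show "summable (\<lambda>y. r ^ Suc y)" using that by (simp add: summable_Suc_iff)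
    fix n :: nat
    show "norm (r ^ Suc n / real (Suc n)) \<le> r ^ Suc n"
      using that by (simp add: field_simps del: power_Suc)
  qed
  \<comment> \<open>For r < 1 the coefficients r^(y+1) / (y+1) have a finite sum \<open>K\<close>,
    so \<open>K\<close> times |g'| dominates the partial sums and the series may be integrated term
    by term.\<close>
  have LI: "(\<lambda>x. L r x * g' x) integrable_on {0<..}"
           "(\<lambda>N. \<Sum>y<N. r ^ Suc y / real (Suc y) * I y) \<longlonglongrightarrow> integral {0<..} (\<lambda>x. L r x * g' x)"
    if r: "0 \<le> r" "r < 1" for r
  proof -
    define K where "K = (\<Sum>y. r ^ Suc y / real (Suc y))"
    define f where "f = (\<lambda>N x. (\<Sum>y<N. r ^ Suc y / real (Suc y) * sin (2 * pi * real (Suc y) * x)) * g' x)"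
    have f_eq: "f N x = (\<Sum>y<N. r ^ Suc y / real (Suc y) * (sin (2 * pi * real (Suc y) * x) * g' x))" for N x
      unfolding f_def by (simp only: sum_distrib_right mult.assoc)
    have fi: "(f N has_integral (\<Sum>y<N. r ^ Suc y / real (Suc y) * I y)) {0<..}" for N
      unfolding f_eq[abs_def] I_def
      by (intro has_integral_sum has_integral_mult_right integrable_integral)
         (use sinint in \<open>auto simp: absolutely_integrable_on_def\<close>)
    have 1: "f N integrable_on {0<..}" for N using fi by blast
    have 2: "(\<lambda>x. K * \<bar>g' x\<bar>) integrable_on {0<..}"
      using ng'int by (rule integrable_on_mult_right)
    have 3: "norm (f N x) \<le> K * \<bar>g' x\<bar>" for N x
    proof -
      have "\<bar>\<Sum>y<N. r ^ Suc y / real (Suc y) * sin (2 * pi * real (Suc y) * x)\<bar> \<le>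
            (\<Sum>y<N. r ^ Suc y / real (Suc y))"
      proof (rule order_trans[OF sum_abs sum_mono])
        fix y
        have "\<bar>r ^ Suc y / real (Suc y)\<bar> * \<bar>sin (2 * pi * real (Suc y) * x)\<bar> \<le> \<bar>r ^ Suc y / real (Suc y)\<bar> * 1"
          by (intro mult_left_mono) auto
        thus "\<bar>r ^ Suc y / real (Suc y) * sin (2 * pi * real (Suc y) * x)\<bar> \<le> r ^ Suc y / real (Suc y)"
          using r by (simp add: abs_mult)
      qed
      also have "\<dots> \<le> K"
        unfolding K_def by (intro sum_le_suminf absum r) (use r in auto)
      finally show ?thesis unfolding f_def by (simp add: abs_mult mult_right_mono)
    qed
    have 4: "(\<lambda>N. f N x) \<longlonglongrightarrow> L r x * g' x" for x
      unfolding f_def using L_series[OF r, of x] unfolding sums_def by (intro tendsto_intros)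
    from dominated_convergence[OF 1 2 3 4]
    show "(\<lambda>x. L r x * g' x) integrable_on {0<..}"
         "(\<lambda>N. \<Sum>y<N. r ^ Suc y / real (Suc y) * I y) \<longlonglongrightarrow> integral {0<..} (\<lambda>x. L r x * g' x)"
      by (auto simp: integral_unique[OF fi])
  qed
  \<comment> \<open>The limit r to 1 under the integral. At integers \<open>L\<close> is 0 for every
    r while the sawtooth has the value pi/2, so both integrands are set to 0 there.\<close>
  have A: "(\<lambda>n. integral {0<..} (\<lambda>x. L (R n) x * g' x)) \<longlonglongrightarrow>
             integral {0<..} (\<lambda>x. pi * (1 / 2 - frac x) * g' x)"
  proof -
    let ?h = "\<lambda>n x. if x \<in> \<int> then 0 else L (R n) x * g' x"
    let ?k = "\<lambda>x. if x \<in> \<int> then 0 else pi * (1 / 2 - frac x) * g' x"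
    have neg: "negligible (\<int> :: real set)"
      using countable_imp_null_set_lborel[of "\<int> :: real set"]
      by (simp add: negligible_iff_null_sets null_sets_completionI Ints_def)
    have "(\<lambda>n. integral {0<..} (?h n)) \<longlonglongrightarrow> integral {0<..} ?k"
    proof (rule dominated_convergence(2))
      show "?h n integrable_on {0<..}" for n
        by (rule integrable_spike[OF LI(1)[OF R] neg]) auto
      show "(\<lambda>x. pi / 2 * \<bar>g' x\<bar>) integrable_on {0<..}"
        using ng'int by (rule integrable_on_mult_right)
      show "norm (?h n x) \<le> pi / 2 * \<bar>g' x\<bar>" for n x
      proof -
        have "\<bar>Im (Ln (1 - of_real (R n) * cis (2 * pi * x)))\<bar> * \<bar>g' x\<bar> \<le> pi / 2 * \<bar>g' x\<bar>"
          by (intro mult_right_mono sawtooth_bound R) auto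
        thus ?thesis by (auto simp: L_def abs_mult)
      qed
      show "(\<lambda>n. ?h n x) \<longlonglongrightarrow> ?k x" for x
      proof (cases "x \<in> \<int>")
        case False
        have "(\<lambda>n. - Im (Ln (1 - of_real (R n) * cis (2 * pi * x))) * g' x)
                \<longlonglongrightarrow> - (pi * (frac x - 1 / 2)) * g' x"
          by (intro tendsto_intros sawtooth_limit False R1)
        thus ?thesis using False by (simp add: L_def algebra_simps)
      qed auto
    qed
    also have "(\<lambda>n. integral {0<..} (?h n)) = (\<lambda>n. integral {0<..} (\<lambda>x. L (R n) x * g' x))"
      by (intro ext integral_spike[OF neg]) auto
    also have "integral {0<..} ?k = integral {0<..} (\<lambda>x. pi * (1 / 2 - frac x) * g' x)"
      by (intro integral_spike[OF neg]) auto
    finally show ?thesis .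
  qed
  have summI: "summable (\<lambda>y. I y / real (Suc y))"
    by (rule summable_rabs_cancel) (use summ in \<open>simp add: abs_divide\<close>)
  \<comment> \<open>The same limit on the side of the series, by Tannery's theorem; this is where
    the summability hypothesis enters.\<close>
  have B: "(\<lambda>n. \<Sum>y. R n ^ Suc y / real (Suc y) * I y) \<longlonglongrightarrow> (\<Sum>y. I y / real (Suc y))"
  proof -
    have "(\<lambda>n. \<Sum>y. (\<lambda>y n. R n ^ Suc y / real (Suc y) * I y) y n) \<longlonglongrightarrow> (\<Sum>y. 1 ^ Suc y / real (Suc y) * I y)"
    proof (rule tannerys_theorem[THEN conjunct2, THEN conjunct2])
      show "(\<lambda>n. R n ^ Suc y / real (Suc y) * I y) \<longlonglongrightarrow> 1 ^ Suc y / real (Suc y) * I y" for y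
        by (intro tendsto_intros R1) auto
      show "\<forall>\<^sub>F (y, n) in at_top \<times>\<^sub>F sequentially. norm (R n ^ Suc y / real (Suc y) * I y) \<le> \<bar>I y\<bar> / real (Suc y)"
      proof (intro always_eventually allI, clarify)
        fix y n
        have "R n ^ Suc y \<le> 1" using R[of n] by (intro power_le_one) auto
        thus "norm (R n ^ Suc y / real (Suc y) * I y) \<le> \<bar>I y\<bar> / real (Suc y)"
          using R[of n] by (simp add: abs_mult divide_right_mono mult_left_le_one_le del: power_Suc)
      qed
    qed (use summ in auto)
    thus ?thesis by simp
  qed
  have "(\<Sum>y. R n ^ Suc y / real (Suc y) * I y) = integral {0<..} (\<lambda>x. L (R n) x * g' x)" for n
    using LI(2)[OF R] by (simp add: sums_def[symmetric] sums_iff)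
  with A B have "integral {0<..} (\<lambda>x. pi * (1 / 2 - frac x) * g' x) = (\<Sum>y. I y / real (Suc y))"
    by (auto intro: LIMSEQ_unique)
  \<comment> \<open>The constant part pi/2 of the sawtooth integrates to 0 against g'.\<close>
  moreover have "integral {0<..} (\<lambda>x. pi * (1 / 2 - frac x) * g' x) =
      - pi * integral {0<..} (\<lambda>x. frac x * g' x)"
  proof -
    have "((\<lambda>x. pi / 2 * g' x - pi * (frac x * g' x)) has_integral
            (pi / 2 * integral {0<..} g' - pi * integral {0<..} (\<lambda>x. frac x * g' x))) {0<..}"
      by (intro has_integral_diff has_integral_mult_right integrable_integral g'int fracint)
    thus ?thesis by (intro integral_unique) (simp add: integral_g'_eq_0 algebra_simps)
  qed
  ultimately have "integral {0<..} (\<lambda>x. frac x * g' x) = (\<Sum>y. I y / real (Suc y)) * (- 1 / pi)"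
    by (simp add: field_simps)
  also have "\<dots> = (\<Sum>y. I y / real (Suc y) * (- 1 / pi))"
    by (rule suminf_mult2[OF summI])
  also have "\<dots> = (\<Sum>y. - I y / (pi * real (Suc y)))"
    by (simp add: mult_ac)
  finally show ?thesis using sum_minus_integral_limit by simp
qed

section \<open>Euler integrals and Laplace transforms\<close>

lemma absolutely_integrable_Gamma_scaled:
  assumes b: "Re b > 0" and c: "c > (0::real)"
  shows "(\<lambda>t. of_real t powr (b - 1) * of_real (exp (- c * t))) absolutely_integrable_on {0<..}"
    and "integral {0<..} (\<lambda>t. of_real t powr (b - 1) * of_real (exp (- c * t))) = Gamma b * of_real c powr (- b)"
proof -
  define f where "f = (\<lambda>t. complex_of_real t powr (b - 1) / of_real (exp t))"
  have img: "(*) c ` {0<..} = {0<..}"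
  proof safe
    fix x :: real assume "x > 0"
    thus "x \<in> (*) c ` {0<..}" using c by (intro image_eqI[of _ _ "x / c"]) auto
  qed (use c in auto)
  have f_int: "f absolutely_integrable_on {0<..} \<and> integral {0<..} f = Gamma b"
    unfolding f_def using absolutely_integrable_Gamma_integral'[OF b] Gamma_integral_complex'[OF b]
    by (auto simp: integral_unique)
  define F where "F = (\<lambda>x. \<bar>c\<bar> *\<^sub>R f (c * x))"
  from f_int have "F absolutely_integrable_on {0<..} \<and> integral {0<..} F = Gamma b"
    unfolding F_def by (subst has_absolute_integral_change_of_variables_real[of "{0<..}" "(*) c" "\<lambda>_. c"])
       (use c img in \<open>auto intro!: derivative_eq_intros inj_onI\<close>)
  hence Fi: "F absolutely_integrable_on {0<..}" and FI: "integral {0<..} F = Gamma b"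
    by auto
  have 1: "(\<lambda>x. of_real c powr (- b) * F x) absolutely_integrable_on {0<..}"
    by (rule set_integrable_mult_right) (rule Fi)
  have 2: "integral {0<..} (\<lambda>x. of_real c powr (- b) * F x) = of_real c powr (- b) * Gamma b"
    using FI by simp
  have eq: "of_real c powr (- b) * F x =
             of_real x powr (b - 1) * of_real (exp (- c * x))" if "x \<in> {0<..}" for x
  proof -
    have "complex_of_real (c * x) powr (b - 1) = of_real c powr (b - 1) * of_real x powr (b - 1)"
      using that c by (simp add: powr_times_real)
    moreover have "of_real c powr (- b) * of_real c * of_real c powr (b - 1) = (1 :: complex)"
    proof -
      have "of_real c powr (- b) * of_real c powr 1 * of_real c powr (b - 1) = (of_real c powr 0 :: complex)"
        unfolding powr_add[symmetric] by simp
      thus ?thesis using c by simp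
    qed
    ultimately show ?thesis using c
      by (simp add: F_def f_def scaleR_conv_of_real exp_minus field_simps)
  qed
  show "(\<lambda>t. of_real t powr (b - 1) * of_real (exp (- c * t))) absolutely_integrable_on {0<..}"
    by (rule absolutely_integrable_spike[OF 1, of "{}"]) (use eq in auto)
  show "integral {0<..} (\<lambda>t. of_real t powr (b - 1) * of_real (exp (- c * t))) = Gamma b * of_real c powr (- b)"
    using 2 by (subst integral_cong[OF eq[symmetric]]) (auto simp: mult.commute)
qed

lemma absolutely_integrable_Gamma_scaled_real:
  assumes b: "b > 0" and c: "c > (0::real)"
  shows "(\<lambda>t. t powr (b - 1) * exp (- c * t)) absolutely_integrable_on {0<..}"
    and "integral {0<..} (\<lambda>t. t powr (b - 1) * exp (- c * t)) = Gamma b * c powr (- b)"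
proof -
  have *: "Re (of_real b) > 0" using b by simp
  note A = absolutely_integrable_Gamma_scaled[OF * c]
  have eq: "complex_of_real t powr (of_real b - 1) * of_real (exp (- c * t)) =
        of_real (t powr (b - 1) * exp (- c * t))" if "t \<in> {0<..}" for t
    using that powr_of_real[of t "b - 1"] by simp
  have 1: "(\<lambda>t. complex_of_real (t powr (b - 1) * exp (- c * t))) absolutely_integrable_on {0<..}"
    by (rule absolutely_integrable_spike[OF A(1), of "{}"]) (use eq in auto)
  have 2: "integral {0<..} (\<lambda>t. complex_of_real (t powr (b - 1) * exp (- c * t))) = of_real (Gamma b * c powr (- b))"
    using A(2) c powr_of_real[of c "-b"]
    by (subst integral_cong[OF eq[symmetric]]) (auto simp: Gamma_complex_of_real)
  show i: "(\<lambda>t. t powr (b - 1) * exp (- c * t)) absolutely_integrable_on {0<..}"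
    using absolutely_integrable_linear[OF 1 bounded_linear_Re] by (simp add: o_def)
  have "((\<lambda>t. complex_of_real (t powr (b - 1) * exp (- c * t))) has_integral of_real (Gamma b * c powr (- b))) {0<..}"
    using 1 2 by (simp add: has_integral_iff absolutely_integrable_on_def)
  from has_integral_linear[OF this bounded_linear_Re]
  show "integral {0<..} (\<lambda>t. t powr (b - 1) * exp (- c * t)) = Gamma b * c powr (- b)"
    by (intro integral_unique) (simp add: o_def)
qed

text \<open>The substitution \<^term>\<open>x = 1 / t\<close> in Euler's integral.\<close>

lemma absolutely_integrable_Gamma_inverse:
  assumes b: "Re b > 0" and c: "c > (0::real)"
  shows "(\<lambda>x. of_real x powr (- b - 1) * of_real (exp (- c / x))) absolutely_integrable_on {0<..}"
    and "integral {0<..} (\<lambda>x. of_real x powr (- b - 1) * of_real (exp (- c / x))) = Gamma b * of_real c powr (- b)"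
proof -
  define f where "f = (\<lambda>t. complex_of_real t powr (b - 1) * of_real (exp (- c * t)))"
  have img: "inverse ` {0<..} = {0 :: real<..}"
  proof safe
    fix x :: real assume "x > 0"
    thus "x \<in> inverse ` {0<..}" by (intro image_eqI[of _ _ "inverse x"]) auto
  qed auto
  have "f absolutely_integrable_on {0<..} \<and> integral {0<..} f = Gamma b * of_real c powr (- b)"
    unfolding f_def using absolutely_integrable_Gamma_scaled[OF assms] by auto
  hence 12: "(\<lambda>x. \<bar>- (inverse x ^ 2)\<bar> *\<^sub>R f (inverse x)) absolutely_integrable_on {0<..} \<and>
         integral {0<..} (\<lambda>x. \<bar>- (inverse x ^ 2)\<bar> *\<^sub>R f (inverse x)) = Gamma b * of_real c powr (- b)"
    by (subst has_absolute_integral_change_of_variables_real[of "{0<..}" inverse "\<lambda>x. - (inverse x ^ 2)"])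
       (use img in \<open>auto intro!: derivative_eq_intros inj_onI simp: power2_eq_square\<close>)
  have eq: "\<bar>- (inverse x ^ 2)\<bar> *\<^sub>R f (inverse x) = of_real x powr (- b - 1) * of_real (exp (- c / x))"
    if "x \<in> {0<..}" for x
  proof -
    have x: "x > 0" using that by simp
    have "complex_of_real (inverse x) powr (b - 1) = of_real x powr (1 - b)"
      using x by (simp add: powr_def Ln_of_real ln_inverse algebra_simps flip: of_real_inverse)
    moreover have "of_real x powr (- b - 1) * complex_of_real x ^ 2 = of_real x powr (1 - b)"
    proof -
      have "complex_of_real x ^ 2 = of_real x powr 2"
        using x by (simp add: powr_numeral)
      thus ?thesis by (simp only: powr_add[symmetric]) simp
    qed
    ultimately show ?thesis using x
      by (simp add: f_def scaleR_conv_of_real field_simps power2_eq_square)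
  qed
  show "(\<lambda>x. of_real x powr (- b - 1) * of_real (exp (- c / x))) absolutely_integrable_on {0<..}"
    by (rule absolutely_integrable_spike[OF conjunct1[OF 12], of "{}"]) (use eq in auto)
  show "integral {0<..} (\<lambda>x. of_real x powr (- b - 1) * of_real (exp (- c / x))) = Gamma b * of_real c powr (- b)"
    using 12 by (subst integral_cong[OF eq[symmetric]]) auto
qed

lemma absolutely_integrable_Ioi_of_powr_bounds:
  fixes f :: "real \<Rightarrow> 'a::euclidean_space"
  assumes f: "continuous_on {0<..} f" and p: "p > -1" and q: "q < -1"
    and b1: "\<And>t. 0 < t \<Longrightarrow> t \<le> 1 \<Longrightarrow> norm (f t) \<le> C * t powr p"
    and b2: "\<And>t. t \<ge> 1 \<Longrightarrow> norm (f t) \<le> C * t powr q"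
  shows "f absolutely_integrable_on {0<..}"
proof (rule measurable_bounded_by_integrable_imp_absolutely_integrable)
  show "f \<in> borel_measurable (lebesgue_on {0<..})"
    by (intro continuous_imp_measurable_on_sets_lebesgue f) auto
  let ?g = "\<lambda>t. C * (if t \<le> 1 then t powr p else t powr q)"
  have 1: "?g integrable_on {0<..1}"
  proof (rule integrable_eq)
    show "(\<lambda>t. C * t powr p) integrable_on {0<..1}"
      using p by (intro integrable_on_mult_right integrable_on_powr_from_0') auto
  qed auto
  have "(\<lambda>t. t powr q) integrable_on {1..}"
    using has_integral_powr_to_inf[of q 1] q by (auto simp: integrable_on_def)
  hence 2: "?g integrable_on {1..}"
  proof (rule integrable_spike_finite[of "{1}", OF _ _ integrable_on_mult_right, rotated 2])
    fix t :: real assume "t \<in> {1..} - {1}"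
    thus "?g t = C * t powr q" by auto
  qed auto
  have "?g integrable_on ({0<..1} \<union> {1..})"
  proof -
    obtain i j where "(?g has_integral i) {0<..1}" "(?g has_integral j) {1..}"
      using 1 2 unfolding integrable_on_def by blast
    moreover have "negligible ({0<..1} \<inter> {1 :: real..})"
      by (rule negligible_subset[of "{1}"]) auto
    ultimately have "(?g has_integral (i + j)) ({0<..1} \<union> {1..})"
      by (rule has_integral_Un)
    thus ?thesis by blast
  qed
  also have "{0<..1} \<union> {1..} = {0 :: real<..}" by auto
  finally show "?g integrable_on {0<..}" .
  show "norm (f x) \<le> ?g x" if "x \<in> {0<..}" for x
    using b1[of x] b2[of x] that by auto
qed auto

text \<open>A Fourier integral evaluated as the boundary value of a Laplace transform. Integral and
  closed form are holomorphic for Re B > 0 and agree on the positive axis. The integral is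
  continuous up to the imaginary axis because h is absolutely integrable; the closed form is
  continuous at the given point by assumption.\<close>

lemma laplace_continuation:
  fixes h :: "real \<Rightarrow> real" and R :: "complex \<Rightarrow> complex"
  assumes h: "h absolutely_integrable_on {0<..}" and hc: "continuous_on {0<..} h"
    and R: "R holomorphic_on {B. Re B > 0}"
    and eq: "\<And>B. B > 0 \<Longrightarrow> integral {0<..} (\<lambda>x. exp (- B * x) * h x) = Re (R (of_real B))"
    and eq_Im: "\<And>B. B > 0 \<Longrightarrow> Im (R (of_real B)) = 0"
    and B: "Re B = 0" and cont: "isCont R B"
  shows "((\<lambda>x. exp (- B * of_real x) * of_real (h x)) has_integral R B) {0<..}"
proof -
  define L where "L = (\<lambda>B. integral {0<..} (\<lambda>x. exp (- B * of_real x) * complex_of_real (h x)))"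
  define H where "H = {B :: complex. Re B \<ge> 0}"
  \<comment> \<open>Compact intervals that exhaust the half line and avoid 0, where h may be
    singular. On \<open>K n\<close> the integrand is continuous, so the truncated transform
    \<open>f n\<close> is entire.\<close>
  define K where "K = (\<lambda>n. {1 / real (Suc n)..real (Suc n)})"
  define f where "f = (\<lambda>n B. integral (K n) (\<lambda>x. exp (- B * of_real x) * complex_of_real (h x)))"
  have bl: "bounded_linear complex_of_real" by (rule bounded_linear_of_real)
  have Kpos: "K n \<subseteq> {0<..}" for n
  proof
    fix x assume "x \<in> K n"
    hence "1 / real (Suc n) \<le> x" by (simp add: K_def)
    moreover have "0 < 1 / real (Suc n)" by simp
    ultimately have "0 < x" by (rule less_le_trans[rotated])
    thus "x \<in> {0<..}" by simp
  qed
  have hKc: "continuous_on (K n) h" for n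
    using hc Kpos by (rule continuous_on_subset)
  have f_hol: "f n holomorphic_on UNIV" for n
    unfolding f_def K_def box_real(2)[symmetric]
  proof (rule leibniz_rule_holomorphic)
    let ?I = "cbox (1 / real (Suc n)) (real (Suc n))"
    have I: "?I = K n" by (simp add: K_def)
    show "((\<lambda>B. exp (- B * of_real t) * complex_of_real (h t)) has_field_derivative
            - of_real t * exp (- B * of_real t) * of_real (h t)) (at B within UNIV)" for B t
      by (auto intro!: derivative_eq_intros)
    show "(\<lambda>t. exp (- B * of_real t) * complex_of_real (h t)) integrable_on ?I" for B
      by (intro integrable_continuous continuous_intros hKc[of n, folded I])
    show "continuous_on (UNIV \<times> ?I) (\<lambda>(B, t). - of_real t * exp (- B * of_real t) * complex_of_real (h t))"
      unfolding case_prod_unfold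
      by (intro continuous_intros continuous_on_compose2[OF hKc[of n, folded I]]) auto
  qed auto
  have ai: "(\<lambda>x. exp (- B * of_real x) * complex_of_real (h x)) absolutely_integrable_on {0<..}"
    if "B \<in> H" for B
  proof (rule absolutely_integrable_continuous_bounded_mult[where C = 1])
    show "(\<lambda>x. complex_of_real (h x)) absolutely_integrable_on {0<..}"
      using absolutely_integrable_linear[OF h bl]
      by (simp add: o_def)
    show "norm (exp (- B * of_real x)) \<le> 1" if "x > 0" for x
      using \<open>B \<in> H\<close> that by (simp add: H_def)
  qed (auto intro!: continuous_intros)
  \<comment> \<open>The mass of |h| outside \<open>K n\<close>. Since |exp(-B x)| <= 1 for Re B >=
    0, it bounds the truncation error uniformly on the closed half plane.\<close>
  define \<epsilon> where "\<epsilon> = (\<lambda>n. integral {0<..} (\<lambda>x. if x \<in> K n then 0 else \<bar>h x\<bar>))"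
  have hint: "(\<lambda>x. \<bar>h x\<bar>) integrable_on {0<..}"
    using h by (simp add: absolutely_integrable_on_def)
  have diff_int: "(\<lambda>x. if x \<in> K n then 0 else F x) integrable_on {0<..}"
    if "F integrable_on {0<..}" "F integrable_on K n" for n and F :: "real \<Rightarrow> 'b::euclidean_space"
  proof -
    have "(\<lambda>x. if x \<in> K n then F x else 0) integrable_on {0<..}"
      using that(2) Kpos[of n] unfolding integrable_on_def by (subst has_integral_restrict) auto
    from integrable_diff[OF that(1) this] show ?thesis
      by (rule integrable_eq) auto
  qed
  have hintK: "(\<lambda>x. \<bar>h x\<bar>) integrable_on K n" for n
    using hKc[of n] unfolding K_def by (intro integrable_continuous_real continuous_intros)
  have \<epsilon>_lim: "\<epsilon> \<longlonglongrightarrow> 0"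
  proof -
    have "\<epsilon> \<longlonglongrightarrow> integral {0<..} (\<lambda>x :: real. 0 :: real)" unfolding \<epsilon>_def
    proof (rule dominated_convergence(2))
      show "(\<lambda>x. if x \<in> K n then 0 else \<bar>h x\<bar>) integrable_on {0<..}" for n
        by (intro diff_int hint hintK)
      show "(\<lambda>x. \<bar>h x\<bar>) integrable_on {0<..}" by (fact hint)
      fix x :: real assume x: "x \<in> {0<..}"
      have "(\<lambda>n. 1 / real (Suc n)) \<longlonglongrightarrow> 0" by real_asymp
      hence "\<forall>\<^sub>F n in sequentially. 1 / real (Suc n) < x" using x by (intro order_tendstoD) auto
      moreover have "filterlim (\<lambda>n. real (Suc n)) at_top sequentially" by real_asymp
      hence "\<forall>\<^sub>F n in sequentially. x \<le> real (Suc n)" by (simp add: filterlim_at_top)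
      ultimately have "\<forall>\<^sub>F n in sequentially. 0 = (if x \<in> K n then 0 else \<bar>h x\<bar>)"
        by eventually_elim (auto simp: K_def)
      thus "(\<lambda>n. if x \<in> K n then 0 else \<bar>h x\<bar>) \<longlonglongrightarrow> 0"
        by (rule Lim_transform_eventually[OF tendsto_const])
    qed auto
    thus ?thesis by simp
  qed
  have close: "norm (f n B - L B) \<le> \<epsilon> n" if B: "B \<in> H" for n B
  proof -
    let ?F = "\<lambda>x. exp (- B * of_real x) * complex_of_real (h x)"
    have i1: "?F integrable_on {0<..}" using ai[OF B] by (simp add: absolutely_integrable_on_def)
    have i2: "?F integrable_on K n"
      using hKc[of n] unfolding K_def by (intro integrable_continuous_real continuous_intros)
    have "((\<lambda>x. if x \<in> K n then ?F x else 0) has_integral f n B) {0<..}"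
      unfolding f_def using integrable_integral[OF i2] Kpos[of n] by (subst has_integral_restrict) auto
    from has_integral_diff[OF integrable_integral[OF i1] this]
    have "((\<lambda>x. if x \<in> K n then 0 else ?F x) has_integral (L B - f n B)) {0<..}"
      unfolding L_def by (rule has_integral_eq[rotated]) auto
    hence eq: "L B - f n B = integral {0<..} (\<lambda>x. if x \<in> K n then 0 else ?F x)"
      by (simp add: integral_unique)
    have "norm (L B - f n B) \<le> \<epsilon> n"
      unfolding eq \<epsilon>_def
    proof (rule integral_norm_bound_integral)
      show "norm (if x \<in> K n then 0 else ?F x) \<le> (if x \<in> K n then 0 else \<bar>h x\<bar>)" if "x \<in> {0<..}" for x
        using B that by (auto simp: norm_mult H_def intro!: mult_left_le_one_le)
    qed (intro diff_int i1 i2 hint hintK)+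
    thus ?thesis by (simp add: norm_minus_commute)
  qed
  have unif: "uniform_limit H f L sequentially"
  proof (rule uniform_limitI)
    fix e :: real assume "e > 0"
    hence "\<forall>\<^sub>F n in sequentially. \<epsilon> n < e" using \<epsilon>_lim by (intro order_tendstoD) auto
    thus "\<forall>\<^sub>F n in sequentially. \<forall>x\<in>H. dist (f n x) (L x) < e"
    proof eventually_elim
      case (elim n)
      show ?case
      proof
        fix B assume "B \<in> H"
        from close[OF this, of n] elim show "dist (f n B) (L B) < e" unfolding dist_norm by linarith
      qed
    qed
  qed
  have L_hol: "L holomorphic_on {B. Re B > 0}"
  proof (rule holomorphic_uniform_sequence)
    show "open {B. Re B > 0}" by (rule open_halfspace_Re_gt)
    show "f n holomorphic_on {B. Re B > 0}" for n
      using f_hol by (rule holomorphic_on_subset) auto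
    fix z :: complex assume "z \<in> {B. Re B > 0}"
    then obtain d where d: "d > 0" "cball z d \<subseteq> {B. Re B > 0}"
      using open_contains_cball open_halfspace_Re_gt[of 0] by blast
    moreover have "cball z d \<subseteq> H" using d by (auto simp: H_def)
    hence "uniform_limit (cball z d) f L sequentially"
      using unif uniform_limit_on_subset by blast
    ultimately show "\<exists>d>0. cball z d \<subseteq> {B. Re B > 0} \<and> uniform_limit (cball z d) f L sequentially"
      by blast
  qed
  have L_cont: "continuous_on H L"
    by (rule uniform_limit_theorem[OF _ unif])
       (auto intro!: always_eventually holomorphic_on_imp_continuous_on holomorphic_on_subset[OF f_hol])
  have LR: "L B = R B" if "Re B > 0" for B
  proof (rule holomorphic_eq_from_real_interval[OF L_hol R open_halfspace_Re_gt, where a = 0 and b = 1 and z = B])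
    show "connected {B. 0 < Re B}" by (intro convex_connected convex_halfspace_Re_gt)
    fix x :: real assume x: "0 < x" "x < 1"
    have "L (of_real x) = integral {0<..} (\<lambda>t. of_real (exp (- x * t) * h t))"
      unfolding L_def by (simp flip: exp_of_real)
    also have "\<dots> = of_real (Re (R (of_real x)))"
    proof (rule integral_unique)
      have "(\<lambda>t. exp (- x * t) * h t) absolutely_integrable_on {0<..}"
        by (rule absolutely_integrable_continuous_bounded_mult[OF h, where C = 1])
           (use x in \<open>auto intro!: continuous_intros\<close>)
      hence "((\<lambda>t. exp (- x * t) * h t) has_integral Re (R (of_real x))) {0<..}"
        using eq[of x] x by (simp add: has_integral_iff absolutely_integrable_on_def)
      from has_integral_linear[OF this bl]
      show "((\<lambda>t. complex_of_real (exp (- x * t) * h t)) has_integral of_real (Re (R (of_real x)))) {0<..}"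
        by (simp add: o_def)
    qed
    also have "\<dots> = R (of_real x)" using eq_Im[of x] x by (simp add: complex_eq_iff)
    finally show "L (of_real x) = R (of_real x)" .
  qed (use that in auto)
  \<comment> \<open>A horizontal approach to B from inside the half plane, where the two sides are
    already equal.\<close>
  define b where "b = (\<lambda>n. B + of_real (1 / real (Suc n)))"
  have "(\<lambda>n. complex_of_real (1 / real (Suc n))) \<longlonglongrightarrow> of_real 0"
    by (intro tendsto_of_real) real_asymp
  from tendsto_add[OF tendsto_const[of B] this] have b_lim: "b \<longlonglongrightarrow> B"
    unfolding b_def by (simp only: of_real_0 add_0_right)
  have bH: "b n \<in> H" "Re (b n) > 0" for n using B by (auto simp: b_def H_def)
  have "B \<in> H" using B by (simp add: H_def)
  with L_cont b_lim bH have "(\<lambda>n. L (b n)) \<longlonglongrightarrow> L B"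
    unfolding continuous_on_sequentially by (auto simp: o_def)
  moreover have "(\<lambda>n. R (b n)) \<longlonglongrightarrow> R B"
    using cont b_lim by (rule isCont_tendsto_compose)
  ultimately have "L B = R B" using LR bH by (auto intro: LIMSEQ_unique)
  thus ?thesis using ai[OF \<open>B \<in> H\<close>]
    by (simp add: L_def has_integral_iff absolutely_integrable_on_def)
qed

section \<open>The regularized Lipschitz formula\<close>

lemma summable_powr_exp_sqrt:
  assumes "c > (0::real)"
  shows "summable (\<lambda>n. real (Suc n) powr p * exp (- c * sqrt (real (Suc n))))"
proof (rule summable_comparison_test_bigo)
  have "summable (\<lambda>n. real (Suc n) powr (-2))"
    using summable_Suc_iff[of "\<lambda>n. real n powr (-2)"] by (simp add: summable_real_powr_iff)
  thus "summable (\<lambda>n. norm (real (Suc n) powr (-2)))" by simp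
  show "(\<lambda>n. real (Suc n) powr p * exp (- c * sqrt (real (Suc n)))) \<in> O(\<lambda>n. real (Suc n) powr (-2))"
    using assms by real_asymp
qed

lemma summable_powr_exp:
  assumes "c > (0::real)"
  shows "summable (\<lambda>n. real (Suc n) powr p * exp (- c * real (Suc n)))"
proof (rule summable_comparison_test[OF _ summable_powr_exp_sqrt[OF assms, of p]], intro exI allI impI)
  fix n :: nat
  have "sqrt (real (Suc n)) \<le> real (Suc n)"
    by (rule real_le_lsqrt) (auto simp: power2_eq_square)
  hence "c * sqrt (real (Suc n)) \<le> c * real (Suc n)"
    using assms by (intro mult_left_mono) auto
  thus "norm (real (Suc n) powr p * exp (- c * real (Suc n))) \<le>
          real (Suc n) powr p * exp (- c * sqrt (real (Suc n)))"
    by (simp add: mult_left_mono)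
qed

definition lipschitz_term :: "complex \<Rightarrow> complex \<Rightarrow> nat \<Rightarrow> complex" where
  "lipschitz_term a z n = (z + \<i> * of_nat n) powr (- a) + (z - \<i> * of_nat n) powr (- a)
     - 2 * cos (of_real pi / 2 * a) * of_nat n powr (- a)"

lemma powr_i_times_nat:
  assumes "n > 0"
  shows "(\<i> * of_nat n) powr w = of_nat n powr w * exp (\<i> * of_real pi / 2 * w)"
    and "(- (\<i> * of_nat n)) powr w = of_nat n powr w * exp (- (\<i> * of_real pi / 2 * w))"
proof -
  have "Ln (of_real (real n) * \<i>) = of_real (ln (real n)) + \<i> * of_real pi / 2"
    using assms by (subst Ln_times_of_real) auto
  thus "(\<i> * of_nat n) powr w = of_nat n powr w * exp (\<i> * of_real pi / 2 * w)"
    using assms Ln_of_real[of "real n"] by (simp add: powr_def mult.commute exp_add[symmetric] algebra_simps)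
  have "Ln (of_real (real n) * (- \<i>)) = of_real (ln (real n)) + (- \<i> * of_real pi / 2)"
    using assms by (subst Ln_times_of_real) auto
  hence *: "Ln (- (\<i> * of_nat n)) = of_real (ln (real n)) - \<i> * of_real pi / 2"
    by (simp add: algebra_simps)
  have "(- (\<i> * of_nat n)) powr w = exp (w * Ln (- (\<i> * of_nat n)))"
    using assms by (simp add: powr_def)
  thus "(- (\<i> * of_nat n)) powr w = of_nat n powr w * exp (- (\<i> * of_real pi / 2 * w))"
    unfolding * using assms Ln_of_real[of "real n"]
    by (simp add: powr_def exp_add[symmetric] algebra_simps)
qed

text \<open>The powers of i and -i with exponent -a add up to 2 cos(pi a / 2), so the cosine term is
  the value of the two other terms at z = 0. As a difference over a segment of length |z|, each
  bracket gains one power of n.\<close>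

lemma lipschitz_term_altdef:
  assumes "n > 0"
  shows "lipschitz_term a z n = ((z + \<i> * of_nat n) powr (- a) - (\<i> * of_nat n) powr (- a)) +
                        ((z - \<i> * of_nat n) powr (- a) - (- (\<i> * of_nat n)) powr (- a))"
proof -
  have "2 * cos (of_real pi / 2 * a) = exp (\<i> * of_real pi / 2 * (- a)) + exp (- (\<i> * of_real pi / 2 * (- a)))"
    by (simp add: cos_exp_eq algebra_simps)
  hence "2 * cos (of_real pi / 2 * a) * of_nat n powr (- a) =
      (\<i> * of_nat n) powr (- a) + (- (\<i> * of_nat n)) powr (- a)"
    unfolding powr_i_times_nat[OF assms] by (simp add: algebra_simps)
  thus ?thesis by (simp add: lipschitz_term_def)
qed

text \<open>The mean value inequality on the segment from w to z + w. All its points except possibly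
  w have positive real part, so it avoids the branch cut. The distance \<rho> from 0 is left as a
  parameter because it is n for real z but only n/2 for complex z; the exponential bounds the
  contribution of the argument to the power.\<close>

lemma norm_powr_diff_le:
  assumes w: "w \<noteq> 0" "Re w \<ge> 0" and z: "Re z > 0" and \<rho>: "\<rho> > 0"
    and le: "\<And>u. u \<in> {0..1} \<Longrightarrow> \<rho> \<le> norm (of_real u * z + w)" and a: "Re a > -1"
  shows "norm ((z + w) powr (- a) - w powr (- a)) \<le>
           norm a * exp (pi * \<bar>Im a\<bar>) * \<rho> powr (- Re a - 1) * norm z"
proof -
  have seg: "\<exists>u\<in>{0..1}. v = of_real u * z + w" if "v \<in> closed_segment w (z + w)" for v
  proof -
    from that obtain u where "0 \<le> u" "u \<le> 1" "v = (1 - u) *\<^sub>R w + u *\<^sub>R (z + w)"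
      by (auto simp: in_segment)
    thus ?thesis by (intro bexI[of _ u]) (auto simp: scaleR_conv_of_real algebra_simps)
  qed
  have "norm ((z + w) powr (- a) - w powr (- a)) \<le>
           (norm a * exp (pi * \<bar>Im a\<bar>) * \<rho> powr (- Re a - 1)) * norm ((z + w) - w)"
  proof (rule field_differentiable_bound[where S = "closed_segment w (z + w)"])
    fix v assume "v \<in> closed_segment w (z + w)"
    then obtain u where u: "u \<in> {0..1}" "v = of_real u * z + w" using seg by blast
    have nv: "norm v \<ge> \<rho>" using le u by auto
    have "Re v > 0 \<or> v = w"
      using u w z by (cases "u = 0") (auto intro!: add_pos_nonneg mult_pos_pos)
    hence v: "v \<notin> \<real>\<^sub>\<le>\<^sub>0"
      using w nv \<rho> by (auto simp: complex_nonpos_Reals_iff complex_eq_iff)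
    show "((\<lambda>v. v powr (- a)) has_field_derivative (- a * v powr (- a - 1))) (at v within closed_segment w (z + w))"
      using v by (auto intro!: derivative_eq_intros)
    have "norm (v powr (- a - 1)) = norm v powr (- Re a - 1) * exp (Im a * Arg v)"
      by (simp add: norm_powr_complex)
    also have "\<dots> \<le> \<rho> powr (- Re a - 1) * exp (pi * \<bar>Im a\<bar>)"
    proof (intro mult_mono)
      show "norm v powr (- Re a - 1) \<le> \<rho> powr (- Re a - 1)"
        using nv \<rho> a by (intro powr_mono2') auto
      have "Im a * Arg v \<le> \<bar>Im a\<bar> * \<bar>Arg v\<bar>" by (metis abs_ge_self abs_mult)
      also have "\<dots> \<le> \<bar>Im a\<bar> * pi"
        using mpi_less_Arg[of v] Arg_le_pi[of v] by (intro mult_left_mono) auto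
      finally show "exp (Im a * Arg v) \<le> exp (pi * \<bar>Im a\<bar>)" by (simp add: mult.commute)
    qed auto
    finally show "norm (- a * v powr (- a - 1)) \<le> norm a * exp (pi * \<bar>Im a\<bar>) * \<rho> powr (- Re a - 1)"
      by (simp add: norm_mult mult_ac mult_left_mono)
  qed auto
  thus ?thesis by simp
qed

lemma norm_lipschitz_term_le:
  assumes n: "n > 0" and z: "Re z > 0" and \<rho>: "\<rho> > 0"
    and le: "\<And>u. u \<in> {0..1} \<Longrightarrow> \<rho> \<le> norm (of_real u * z + \<i> * of_nat n)"
            "\<And>u. u \<in> {0..1} \<Longrightarrow> \<rho> \<le> norm (of_real u * z - \<i> * of_nat n)"
    and a: "Re a > -1"
  shows "norm (lipschitz_term a z n) \<le> 2 * norm a * exp (pi * \<bar>Im a\<bar>) * \<rho> powr (- Re a - 1) * norm z"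
proof -
  have "norm ((z + \<i> * of_nat n) powr (- a) - (\<i> * of_nat n) powr (- a)) \<le>
           norm a * exp (pi * \<bar>Im a\<bar>) * \<rho> powr (- Re a - 1) * norm z"
    by (intro norm_powr_diff_le assms) (use n in auto)
  moreover have "norm ((z + (- (\<i> * of_nat n))) powr (- a) - (- (\<i> * of_nat n)) powr (- a)) \<le>
           norm a * exp (pi * \<bar>Im a\<bar>) * \<rho> powr (- Re a - 1) * norm z"
    by (intro norm_powr_diff_le assms) (use n le in auto)
  ultimately show ?thesis
    unfolding lipschitz_term_altdef[OF n] by (intro norm_triangle_le) simp
qed

text \<open>For real z all points of the segments have imaginary part n or -n, so \<rho> = n is
  admissible whatever the relation between n and z, and the bound is linear in z.\<close>

lemma norm_lipschitz_term_real_le: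
  assumes n: "n > 0" and z: "z > (0::real)" and a: "Re a > -1"
  shows "norm (lipschitz_term a (of_real z) n) \<le> 2 * norm a * exp (pi * \<bar>Im a\<bar>) * real n powr (- Re a - 1) * z"
proof -
  have *: "real n \<le> norm v" if "\<bar>Im v\<bar> = real n" for v
    using abs_Im_le_cmod[of v] that by simp
  have "norm (lipschitz_term a (of_real z) n) \<le>
          2 * norm a * exp (pi * \<bar>Im a\<bar>) * real n powr (- Re a - 1) * norm (complex_of_real z)"
    by (rule norm_lipschitz_term_le) (use n z a in \<open>auto intro!: *\<close>)
  thus ?thesis using z by simp
qed

definition lipschitz_sum :: "complex \<Rightarrow> real \<Rightarrow> complex" where
  "lipschitz_sum a z = (\<Sum>k. of_nat (Suc k) powr (a - 1) * of_real (exp (- 2 * pi * z * real (Suc k))))"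

lemma summable_lipschitz_sum:
  assumes "z > 0"
  shows "summable (\<lambda>k. norm (of_nat (Suc k) powr (a - 1) * complex_of_real (exp (- 2 * pi * z * real (Suc k)))))"
  using summable_powr_exp[of "2 * pi * z" "Re (a - 1)"] assms
  by (simp add: norm_mult norm_powr_nat del: of_nat_Suc)

text \<open>The F(z) of the overview: the exponential series minus the leading terms of its
  expansion as z tends to 0. The zeta value is written with \<open>zeta_right\<close> because the
  description behind \<open>riemann_zeta\<close> is shown to have a referent only later, with the
  help of this function.\<close>

definition lipschitz_rem :: "complex \<Rightarrow> real \<Rightarrow> complex" where
  "lipschitz_rem a z = lipschitz_sum a z - zeta_right (1 - a) - Gamma a * of_real (2 * pi * z) powr (- a)"

lemma summable_nat_powr_real: "p < -1 \<Longrightarrow> summable (\<lambda>n. real (Suc n) powr p)"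
  using summable_Suc_iff[of "\<lambda>n. real n powr p"] by (simp add: summable_real_powr_iff)

lemma summable_lipschitz_term:
  assumes "z > (0::real)" "Re a > 0"
  shows "summable (\<lambda>n. norm (lipschitz_term a (of_real z) (Suc n)))"
proof (rule summable_comparison_test')
  show "summable (\<lambda>n. 2 * norm a * exp (pi * \<bar>Im a\<bar>) * real (Suc n) powr (- Re a - 1) * z)"
    by (intro summable_mult summable_mult2 summable_nat_powr_real) (use assms in auto)
  show "norm (norm (lipschitz_term a (of_real z) (Suc n))) \<le> 2 * norm a * exp (pi * \<bar>Im a\<bar>) * real (Suc n) powr (- Re a - 1) * z" for n
    using norm_lipschitz_term_real_le[of "Suc n" z a] assms by simp
qed

text \<open>The vanishing of the integral of the derivative, applied to exp(-B x) g(x).\<close>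

lemma (in euler_maclaurin) laplace_derivative:
  assumes B: "B > 0" and i: "(\<lambda>x. exp (- B * x) *\<^sub>R g x) absolutely_integrable_on {0<..}"
    and i': "(\<lambda>x. exp (- B * x) *\<^sub>R g' x) absolutely_integrable_on {0<..}"
  shows "integral {0<..} (\<lambda>x. exp (- B * x) *\<^sub>R g' x) = B *\<^sub>R integral {0<..} (\<lambda>x. exp (- B * x) *\<^sub>R g x)"
proof -
  interpret G: euler_maclaurin "\<lambda>x. exp (- B * x) *\<^sub>R g x"
    "\<lambda>x. exp (- B * x) *\<^sub>R g' x + (- B * exp (- B * x)) *\<^sub>R g x"
  proof
    show "continuous_on {0..} (\<lambda>x. exp (- B * x) *\<^sub>R g x)"
      by (intro continuous_intros cont)
    show "((\<lambda>x. exp (- B * x) *\<^sub>R g x) has_vector_derivative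
            exp (- B * x) *\<^sub>R g' x + (- B * exp (- B * x)) *\<^sub>R g x) (at x)" if "x > 0" for x
      by (intro has_vector_derivative_scaleR der that) (auto intro!: derivative_eq_intros)
    have "(\<lambda>N. exp (- B * real N)) \<longlonglongrightarrow> 0" using B by real_asymp
    from tendsto_scaleR[OF this ginf] show "(\<lambda>N. exp (- B * real N) *\<^sub>R g (real N)) \<longlonglongrightarrow> 0" by simp
    have "(\<lambda>x. (- B) *\<^sub>R (exp (- B * x) *\<^sub>R g x)) absolutely_integrable_on {0<..}"
      by (rule absolutely_integrable_scaleR_left) (rule i)
    from set_integral_add(1)[OF i' this]
    show "(\<lambda>x. exp (- B * x) *\<^sub>R g' x + (- B * exp (- B * x)) *\<^sub>R g x) absolutely_integrable_on {0<..}"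
      by simp
  qed simp
  have "((\<lambda>x. exp (- B * x) *\<^sub>R g' x + (- B) *\<^sub>R (exp (- B * x) *\<^sub>R g x)) has_integral
          integral {0<..} (\<lambda>x. exp (- B * x) *\<^sub>R g' x) + (- B) *\<^sub>R integral {0<..} (\<lambda>x. exp (- B * x) *\<^sub>R g x)) {0<..}"
    using i i' unfolding absolutely_integrable_on_def
    by (intro has_integral_add has_integral_cmul integrable_integral) auto
  with G.integral_g'_eq_0 show ?thesis
    by (simp add: integral_unique)
qed

lemma cnj_powr_real:
  assumes "Re v \<ge> 0"
  shows "cnj v powr of_real x = cnj (v powr of_real x)"
proof (cases "v = 0")
  case False
  have "v \<notin> \<real>\<^sub>\<le>\<^sub>0"
    using assms False by (auto simp: complex_nonpos_Reals_iff complex_eq_iff)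
  thus ?thesis using False by (simp add: powr_def cnj_Ln exp_cnj)
qed auto

lemma lipschitz_term_real:
  assumes n: "n > 0" and z: "z > (0::real)"
  shows "lipschitz_term (of_real a) (of_real z) n =
    of_real (2 * Re ((of_real z + \<i> * of_nat n) powr (- of_real a) - (\<i> * of_nat n) powr (- of_real a)))"
proof -
  have *: "cnj v powr (- of_real a) = cnj (v powr (- of_real a))" if "Re v \<ge> 0" for v
    using cnj_powr_real[OF that, of "-a"] by simp
  have 1: "(of_real z - \<i> * of_nat n) powr (- of_real a) = cnj ((of_real z + \<i> * of_nat n) powr (- of_real a))"
    using *[of "of_real z + \<i> * of_nat n"] z by simp
  have 2: "(- (\<i> * of_nat n)) powr (- of_real a) = cnj ((\<i> * of_nat n) powr (- of_real a))"
    using *[of "\<i> * of_nat n"] by simp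
  show ?thesis
    unfolding lipschitz_term_altdef[OF n] 1 2 by (simp add: complex_eq_iff)
qed

lemma one_minus_exp_neg_bounds:
  assumes "x \<ge> (0::real)"
  shows "0 \<le> 1 - exp (- x)" "1 - exp (- x) \<le> x" "1 - exp (- x) \<le> 1"
  using exp_ge_add_one_self[of "-x"] assms by auto

lemma x_exp_neg_le_1: "x * exp (- x) \<le> (1::real)"
proof -
  have "x * exp (- x) \<le> exp x * exp (- x)"
  proof (intro mult_right_mono)
    show "x \<le> exp x" using exp_ge_add_one_self[of x] by linarith
  qed auto
  thus ?thesis by (simp add: exp_minus)
qed

text \<open>Subtracting 1 from the exponential makes the function vanish at 0 like t^a, which
  carries the classical formula for a > 1 into 0 < a < 1. The subtracted power produces zeta(1-a) on
  the side of the sum and the cosine term on the side of the frequencies.\<close>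

lemma lipschitz_regularized:
  fixes a z :: real
  assumes a: "0 < a" "a < 1" and z: "z > 0"
  shows "of_real (2 * pi) powr (of_real a) * lipschitz_rem (of_real a) z =
           Gamma (of_real a) * (\<Sum>n. lipschitz_term (of_real a) (of_real z) (Suc n))"
proof -
  define c where "c = 2 * pi * z"
  have c: "c > 0" using z by (simp add: c_def)
  define g where "g = (\<lambda>t::real. t powr (a - 1) * (exp (- c * t) - 1))"
  define g' where "g' = (\<lambda>t::real. (a - 1) * t powr (a - 2) * (exp (- c * t) - 1)
                            - c * (t powr (a - 1) * exp (- c * t)))"
  have gbound: "\<bar>g t\<bar> \<le> c * t powr a" if "t > 0" for t
  proof -
    have "\<bar>g t\<bar> = t powr (a - 1) * (1 - exp (- (c * t)))"
      using one_minus_exp_neg_bounds[of "c * t"] that c by (simp add: g_def abs_mult)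
    also have "\<dots> \<le> t powr (a - 1) * (c * t)"
      using one_minus_exp_neg_bounds[of "c * t"] that c by (intro mult_left_mono) auto
    also have "\<dots> = c * t powr a" using that powr_add[of t "a - 1" 1] by simp
    finally show ?thesis .
  qed
  have gder: "(g has_real_derivative g' t) (at t)" if "t > 0" for t
  proof -
    have "((\<lambda>t. t powr (a - 1)) has_real_derivative (a - 1) * t powr (a - 1 - 1)) (at t)"
      using that by (rule has_real_derivative_powr)
    moreover have "((\<lambda>t. exp (- c * t) - 1) has_real_derivative - c * exp (- c * t)) (at t)"
      by (auto intro!: derivative_eq_intros)
    ultimately have "(g has_real_derivative (a - 1) * t powr (a - 1 - 1) * (exp (- c * t) - 1) +
        (- c * exp (- c * t)) * t powr (a - 1)) (at t)"
      unfolding g_def by (rule DERIV_mult)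
    thus ?thesis by (simp add: g'_def mult_ac)
  qed
  have g'cont: "continuous_on {0<..} g'"
    unfolding g'_def by (auto intro!: continuous_intros)
  have em: "euler_maclaurin g g'"
  proof
    show "continuous_on {0..} g"
      unfolding continuous_on_eq_continuous_within
    proof
      fix x :: real assume x: "x \<in> {0..}"
      show "continuous (at x within {0..}) g"
      proof (cases "x = 0")
        case False
        hence "isCont g x" using gder[of x] x by (auto intro: DERIV_isCont)
        thus ?thesis by (rule continuous_at_imp_continuous_at_within)
      next
        case True
        have "((\<lambda>t. c * t powr a) \<longlongrightarrow> c * 0) (at 0 within {0..})"
        proof (rule tendsto_mult_left)
          have "((\<lambda>t::real. t powr a) \<longlongrightarrow> 0) (at_right 0)" using a by real_asymp
          thus "((\<lambda>t::real. t powr a) \<longlongrightarrow> 0) (at 0 within {0..})"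
            by (simp add: at_within_Ici_at_right)
        qed
        hence "((\<lambda>t. c * t powr a) \<longlongrightarrow> 0) (at 0 within {0..})" by simp
        hence "(g \<longlongrightarrow> 0) (at 0 within {0..})"
          by (rule Lim_null_comparison[rotated])
             (use gbound in \<open>auto simp: eventually_at_filter intro!: always_eventually\<close>)
        thus ?thesis using True by (simp add: continuous_within g_def)
      qed
    qed
    show "(g has_vector_derivative g' x) (at x)" if "x > 0" for x
      using gder[OF that] by (simp add: has_real_derivative_iff_has_vector_derivative)
    show "(\<lambda>N. g (real N)) \<longlonglongrightarrow> 0"
      unfolding g_def using a c by real_asymp
    \<comment> \<open>The first bound is integrable at 0 because a > 0, the second at infinity
      because a < 1. They come from 1 - exp(-x) <= x and from x exp(-x) <= 1; 2c + 2 serves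
      both.\<close>
    have bnd: "norm (g' t) \<le> (2 * c + 2) * t powr (a - 1) \<and> norm (g' t) \<le> (2 * c + 2) * t powr (a - 2)"
      if t: "0 < t" for t
    proof -
      have 1: "\<bar>(a - 1) * t powr (a - 2) * (exp (- c * t) - 1)\<bar> \<le> t powr (a - 2) * (1 - exp (- (c * t)))"
      proof -
        have "(1 - a) * (t powr (a - 2) * (1 - exp (- (c * t)))) \<le> 1 * (t powr (a - 2) * (1 - exp (- (c * t))))"
          using a one_minus_exp_neg_bounds[of "c * t"] t c by (intro mult_right_mono mult_nonneg_nonneg) auto
        thus ?thesis using a one_minus_exp_neg_bounds[of "c * t"] t c by (simp add: abs_mult)
      qed
      have tp: "t powr (a - 2) * t = t powr (a - 1)" using t powr_add[of t "a - 2" 1] by simp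
      have 2: "\<bar>g' t\<bar> \<le> t powr (a - 2) * (1 - exp (- (c * t))) + c * (t powr (a - 1) * exp (- (c * t)))"
        unfolding g'_def using 1 c by (intro order_trans[OF abs_triangle_ineq4] add_mono) (auto simp: abs_mult)
      have "t powr (a - 2) * (1 - exp (- (c * t))) \<le> t powr (a - 2) * (c * t)"
        using one_minus_exp_neg_bounds[of "c * t"] t c by (intro mult_left_mono) auto
      also have "\<dots> = c * t powr (a - 1)" using tp by (simp add: mult_ac)
      finally have 3: "t powr (a - 2) * (1 - exp (- (c * t))) \<le> c * t powr (a - 1)" .
      have 4: "c * (t powr (a - 1) * exp (- (c * t))) \<le> c * (t powr (a - 1) * 1)"
        using c t by (intro mult_left_mono) auto
      have 5: "t powr (a - 2) * (1 - exp (- (c * t))) \<le> t powr (a - 2) * 1"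
        using c t by (intro mult_left_mono) auto
      have "c * (t powr (a - 1) * exp (- (c * t))) = t powr (a - 2) * ((c * t) * exp (- (c * t)))"
        unfolding tp[symmetric] by (simp add: mult_ac)
      also have "\<dots> \<le> t powr (a - 2) * 1"
        using x_exp_neg_le_1[of "c * t"] by (intro mult_left_mono) auto
      finally have 6: "c * (t powr (a - 1) * exp (- (c * t))) \<le> t powr (a - 2) * 1" .
      have "\<bar>g' t\<bar> \<le> 2 * c * t powr (a - 1)" "\<bar>g' t\<bar> \<le> 2 * t powr (a - 2)"
        using 2 3 4 5 6 by linarith+
      moreover have "2 * t powr (a - 2) \<le> (2 * c + 2) * t powr (a - 2)"
         "2 * c * t powr (a - 1) \<le> (2 * c + 2) * t powr (a - 1)"
        using c by (auto intro!: mult_right_mono)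
      ultimately show ?thesis by (simp del: mult_le_cancel_right)
    qed
    show "g' absolutely_integrable_on {0<..}"
      by (rule absolutely_integrable_Ioi_of_powr_bounds[OF g'cont, where p = "a - 1" and q = "a - 2" and C = "2 * c + 2"])
         (use a bnd in auto)
  qed (simp add: g_def)
  interpret euler_maclaurin g g' by (fact em)

  \<comment> \<open>The Laplace transform of \<open>g'\<close>: the factor B comes from the
    derivative, the two powers from Euler's integral. It extends continuously to the imaginary axis
    except at 0, and only the points 2 pi i n with n > 0 are used.\<close>
  define R where "R = (\<lambda>B :: complex. B * Gamma (of_real a) * ((B + of_real c) powr (- of_real a) - B powr (- of_real a)))"
  have gauss: "(\<lambda>t. t powr (a - 1) * exp (- B * t)) absolutely_integrable_on {0<..}"
              "integral {0<..} (\<lambda>t. t powr (a - 1) * exp (- B * t)) = Gamma a * B powr (- a)" if "B > 0" for B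
    using absolutely_integrable_Gamma_scaled_real[OF a(1) that] by auto
  have lap: "integral {0<..} (\<lambda>x. exp (- B * x) * g' x) = B * (Gamma a * (B + c) powr (- a) - Gamma a * B powr (- a))"
    if B: "B > 0" for B
  proof -
    have eq: "exp (- B * x) * g x = x powr (a - 1) * exp (- (B + c) * x) - x powr (a - 1) * exp (- B * x)" for x
      by (simp add: g_def algebra_simps exp_add[symmetric] flip: exp_add)
    have "B + c > 0" using B c by simp
    note G = gauss[OF B] gauss[OF this]
    have i: "(\<lambda>x. exp (- B * x) * g x) absolutely_integrable_on {0<..}"
      unfolding eq by (intro set_integral_diff(1) G)
    have "integral {0<..} (\<lambda>x. exp (- B * x) * g x) = Gamma a * (B + c) powr (- a) - Gamma a * B powr (- a)"
      unfolding eq G(2,4)[symmetric]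
      by (rule integral_diff) (use G in \<open>auto simp: absolutely_integrable_on_def\<close>)
    moreover have "(\<lambda>x. exp (- B * x) * g' x) absolutely_integrable_on {0<..}"
      by (rule absolutely_integrable_continuous_bounded_mult[OF int, where C = 1])
         (use B in \<open>auto intro!: continuous_intros\<close>)
    ultimately show ?thesis using laplace_derivative[OF B] i by simp
  qed
  have R_real: "R (of_real B) = of_real (B * (Gamma a * (B + c) powr (- a) - Gamma a * B powr (- a)))"
    if "B > 0" for B
    using that c powr_of_real[of B "-a"] powr_of_real[of "B + c" "-a"]
    by (simp add: R_def Gamma_complex_of_real algebra_simps)
  have four: "((\<lambda>x. exp (- B * of_real x) * of_real (g' x)) has_integral R B) {0<..}"
    if "Re B = 0" "B \<noteq> 0" for B
  proof (rule laplace_continuation[OF int g'cont])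
    have nz: "B + of_real c \<notin> \<real>\<^sub>\<le>\<^sub>0" "B \<notin> \<real>\<^sub>\<le>\<^sub>0" if "Re B \<ge> 0" "B \<noteq> 0" for B
      using that c by (auto simp: complex_nonpos_Reals_iff complex_eq_iff)
    show "R holomorphic_on {B. Re B > 0}"
      unfolding R_def by (intro holomorphic_intros) (use c in \<open>auto simp: complex_nonpos_Reals_iff\<close>)
    show "isCont R B" unfolding R_def using that by (intro continuous_intros nz) auto
  qed (use lap R_real that in auto)
  define I where "I = (\<lambda>y. integral {0<..} (\<lambda>x. sin (2 * pi * real (Suc y) * x) * g' x))"
  have I_eq: "- I y = Im (R (2 * of_real pi * \<i> * of_nat (Suc y)))" for y
  proof -
    have "((\<lambda>x. exp (- (2 * of_real pi * \<i> * of_nat (Suc y)) * of_real x) * of_real (g' x)) has_integral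
             R (2 * of_real pi * \<i> * of_nat (Suc y))) {0<..}"
      by (rule four) (auto simp del: of_nat_Suc)
    from has_integral_linear[OF this bounded_linear_Im]
    have "((\<lambda>x. - (sin (2 * pi * real (Suc y) * x) * g' x)) has_integral
             Im (R (2 * of_real pi * \<i> * of_nat (Suc y)))) {0<..}"
      by (simp add: o_def Im_exp del: of_nat_Suc)
    from has_integral_neg[OF this] show ?thesis
      by (simp add: I_def integral_unique del: of_nat_Suc)
  qed
  \<comment> \<open>At B = 2 pi i n the prefactor B supplies n, which cancels against the
    denominator, and i, which turns the imaginary part into a real part. Twice the real part of
    \<open>W\<close> is the sum of the two conjugate brackets of the Lipschitz term.\<close>
  have IB: "- I y / (pi * real (Suc y)) =
      Gamma a * (2 * pi) powr (- a) * Re (lipschitz_term (of_real a) (of_real z) (Suc y))" for y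
  proof -
    define n where "n = real (Suc y)"
    have n: "n > 0" by (simp add: n_def)
    define W where "W = (of_real z + \<i> * of_real n) powr (- of_real a) - (\<i> * of_real n) powr (- of_real a)"
    have e1: "2 * of_real pi * \<i> * of_real n + of_real c = of_real (2 * pi) * (of_real z + \<i> * of_real n)"
      by (simp add: c_def algebra_simps)
    have e2: "2 * of_real pi * \<i> * of_real n = of_real (2 * pi) * (\<i> * of_real n)" by simp
    have p: "(of_real (2 * pi) * v) powr (- of_real a) = of_real ((2 * pi) powr (- a)) * v powr (- of_real a)" for v :: complex
      using powr_of_real[of "2 * pi" "-a"] by (subst powr_times_real_left) auto
    have "R (2 * of_real pi * \<i> * of_real n) =
        2 * of_real pi * \<i> * of_real n * Gamma (of_real a) * (of_real ((2 * pi) powr (- a)) * W)"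
      unfolding R_def e1 unfolding e2 p W_def by (simp add: algebra_simps)
    also have "\<dots> = of_real (2 * pi * n * Gamma a * (2 * pi) powr (- a)) * (\<i> * W)"
      by (simp add: Gamma_complex_of_real)
    also have "Im \<dots> = 2 * pi * n * Gamma a * (2 * pi) powr (- a) * Re W"
      by simp
    finally have "- I y = 2 * pi * n * Gamma a * (2 * pi) powr (- a) * Re W"
      using I_eq[of y] by (simp add: n_def)
    moreover have "Re (lipschitz_term (of_real a) (of_real z) (Suc y)) = 2 * Re W"
      using lipschitz_term_real[of "Suc y" z a] z by (simp add: W_def n_def)
    ultimately show ?thesis using n by (simp add: n_def[symmetric] field_simps del: of_nat_Suc)
  qed
  have sB: "summable (\<lambda>n. norm (lipschitz_term (of_real a) (of_real z) (Suc n)))"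
    by (rule summable_lipschitz_term) (use a z in auto)
  have summ: "summable (\<lambda>y. \<bar>I y\<bar> / real (Suc y))"
  proof (rule summable_comparison_test')
    show "summable (\<lambda>n. pi * (Gamma a * (2 * pi) powr (- a)) * norm (lipschitz_term (of_real a) (of_real z) (Suc n)))"
      by (intro summable_mult sB)
    fix y :: nat
    have "\<bar>I y\<bar> / real (Suc y) = pi * \<bar>- I y / (pi * real (Suc y))\<bar>"
      by (simp add: abs_mult)
    also have "\<dots> = pi * (Gamma a * (2 * pi) powr (- a) * \<bar>Re (lipschitz_term (of_real a) (of_real z) (Suc y))\<bar>)"
      unfolding IB using a Gamma_real_pos[of a] by (simp add: abs_mult)
    also have "\<dots> \<le> pi * (Gamma a * (2 * pi) powr (- a) * norm (lipschitz_term (of_real a) (of_real z) (Suc y)))"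
      using a Gamma_real_pos[of a] by (intro mult_left_mono abs_Re_le_cmod) auto
    finally show "norm (\<bar>I y\<bar> / real (Suc y)) \<le> pi * (Gamma a * (2 * pi) powr (- a)) * norm (lipschitz_term (of_real a) (of_real z) (Suc y))"
      by (simp add: mult_ac)
  qed
  have "(\<lambda>N. (\<Sum>d<N. g (real (Suc d))) - integral {0..real N} g) \<longlonglongrightarrow>
          (\<Sum>y. Gamma a * (2 * pi) powr (- a) * Re (lipschitz_term (of_real a) (of_real z) (Suc y)))"
    using poisson_summation[OF em summ[unfolded I_def]] IB unfolding I_def by simp
  from tendsto_of_real[OF this, where 'a = complex]
  have lim1: "(\<lambda>N. of_real ((\<Sum>d<N. g (real (Suc d))) - integral {0..real N} g)) \<longlonglongrightarrow>
          complex_of_real (\<Sum>y. Gamma a * (2 * pi) powr (- a) * Re (lipschitz_term (of_real a) (of_real z) (Suc y)))" .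
  \<comment> \<open>The same sequence evaluated directly: the exponential parts of sum and integral
    converge separately, and what the subtracted power contributes is the finite part that defines
    zeta(1-a).\<close>
  have lim2: "(\<lambda>N. of_real ((\<Sum>d<N. g (real (Suc d))) - integral {0..real N} g)) \<longlonglongrightarrow> lipschitz_rem (of_real a) z"
  proof -
    have "integral {0..real N} g = integral {0..real N} (\<lambda>t. t powr (a - 1) * exp (- c * t)) - real N powr a / a" for N
    proof -
      have "(\<lambda>t. t powr (a - 1) * exp (- c * t)) integrable_on {0<..real N}"
        by (rule set_lebesgue_integral_eq_integral(1), rule set_integrable_subset[OF gauss(1)[OF c]]) auto
      hence 1: "(\<lambda>t. t powr (a - 1) * exp (- c * t)) integrable_on {0..real N}"
        by (rule integrable_spike_set) (auto intro: negligible_subset[of "{0}"])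
      have 2: "((\<lambda>t. t powr (a - 1)) has_integral (real N powr a / a)) {0..real N}"
        using has_integral_powr_from_0[of "a - 1" "real N"] a by simp
      have "((\<lambda>t. t powr (a - 1) * exp (- c * t) - t powr (a - 1)) has_integral
              (integral {0..real N} (\<lambda>t. t powr (a - 1) * exp (- c * t)) - real N powr a / a)) {0..real N}"
        by (intro has_integral_diff integrable_integral 1 2)
      thus ?thesis by (intro integral_unique) (simp add: g_def algebra_simps)
    qed
    hence eq: "of_real ((\<Sum>d<N. g (real (Suc d))) - integral {0..real N} g) =
        (\<Sum>d<N. of_nat (Suc d) powr (of_real a - 1) * complex_of_real (exp (- 2 * pi * z * real (Suc d))))
         - ((\<Sum>d<N. of_nat (Suc d) powr (- (1 - of_real a))) - of_nat N powr (1 - (1 - of_real a)) / (1 - (1 - of_real a)))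
         - of_real (integral {0..real N} (\<lambda>t. t powr (a - 1) * exp (- c * t)))" for N
    proof -
      have p: "of_nat (Suc d) powr (of_real a - 1) = complex_of_real (real (Suc d) powr (a - 1))" for d
        using powr_of_real[of "real (Suc d)" "a - 1"] by simp
      have p2: "of_nat N powr of_real a = complex_of_real (real N powr a)"
        using powr_of_real[of "real N" a] by simp
      have "g (real (Suc d)) = real (Suc d) powr (a - 1) * exp (- 2 * pi * z * real (Suc d)) - real (Suc d) powr (a - 1)" for d
        by (simp add: g_def c_def algebra_simps)
      hence "(\<Sum>d<N. g (real (Suc d))) = (\<Sum>d<N. real (Suc d) powr (a - 1) * exp (- 2 * pi * z * real (Suc d))) - (\<Sum>d<N. real (Suc d) powr (a - 1))"
        by (simp add: sum_subtractf)
      thus ?thesis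
        using \<open>\<And>N. integral {0..real N} g = _\<close>[of N]
        by (simp add: p p2 del: of_nat_Suc)
    qed
    show ?thesis unfolding eq lipschitz_rem_def
    proof (intro tendsto_diff)
      show "(\<lambda>N. \<Sum>d<N. of_nat (Suc d) powr (of_real a - 1) * complex_of_real (exp (- 2 * pi * z * real (Suc d)))) \<longlonglongrightarrow> lipschitz_sum (of_real a) z"
        unfolding lipschitz_sum_def by (intro summable_LIMSEQ summable_norm_cancel[OF summable_lipschitz_sum] z)
      show "(\<lambda>N. (\<Sum>d<N. of_nat (Suc d) powr (- (1 - complex_of_real a))) - of_nat N powr (1 - (1 - of_real a)) / (1 - (1 - of_real a))) \<longlonglongrightarrow> zeta_right (1 - of_real a)"
        by (rule zeta_right_limit) (use a in auto)
      have "(\<lambda>N. complex_of_real (integral {0..real N} (\<lambda>t. t powr (a - 1) * exp (- c * t)))) \<longlonglongrightarrow> of_real (Gamma a * c powr (- a))"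
        unfolding gauss(2)[OF c, symmetric]
        by (intro tendsto_of_real integral_tendsto_integral_Ioi gauss c)
      thus "(\<lambda>N. complex_of_real (integral {0..real N} (\<lambda>t. t powr (a - 1) * exp (- c * t)))) \<longlonglongrightarrow> Gamma (of_real a) * of_real (2 * pi * z) powr (- of_real a)"
        using c powr_of_real[of c "-a"] by (simp add: Gamma_complex_of_real c_def)
    qed
  qed
  have B_real: "lipschitz_term (of_real a) (of_real z) (Suc y) = of_real (Re (lipschitz_term (of_real a) (of_real z) (Suc y)))" for y
    using lipschitz_term_real[of "Suc y" z a] z by simp
  have "lipschitz_rem (of_real a) z = complex_of_real (\<Sum>y. Gamma a * (2 * pi) powr (- a) * Re (lipschitz_term (of_real a) (of_real z) (Suc y)))"
    using lim1 lim2 by (rule LIMSEQ_unique[rotated])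
  also have "\<dots> = of_real (Gamma a * (2 * pi) powr (- a)) * of_real (\<Sum>y. Re (lipschitz_term (of_real a) (of_real z) (Suc y)))"
  proof -
    have "summable (\<lambda>y. Re (lipschitz_term (of_real a) (of_real z) (Suc y)))"
      by (intro summable_Re summable_norm_cancel[OF sB])
    thus ?thesis by (simp add: suminf_mult)
  qed
  also have "of_real (\<Sum>y. Re (lipschitz_term (of_real a) (of_real z) (Suc y))) = (\<Sum>y. lipschitz_term (of_real a) (of_real z) (Suc y))"
  proof -
    have "summable (\<lambda>y. Re (lipschitz_term (of_real a) (of_real z) (Suc y)))"
      by (intro summable_Re summable_norm_cancel[OF sB])
    from sums_of_real[OF summable_sums[OF this], where 'a = complex]
    show ?thesis using B_real by (simp add: sums_iff)
  qed
  finally have F: "lipschitz_rem (of_real a) z = of_real (Gamma a * (2 * pi) powr (- a)) * (\<Sum>y. lipschitz_term (of_real a) (of_real z) (Suc y))" .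
  have "(2 * pi) powr a * (2 * pi) powr (- a) = 1"
    by (simp add: powr_minus)
  hence "complex_of_real ((2 * pi) powr a) * of_real ((2 * pi) powr (- a)) = 1"
    by (metis of_real_1 of_real_mult)
  moreover have "of_real (2 * pi) powr of_real a = complex_of_real ((2 * pi) powr a)"
    by (rule powr_of_real) simp
  ultimately show ?thesis unfolding F
    by (simp add: Gamma_complex_of_real)
qed

section \<open>Continuation of the zeta function\<close>

lemma ball_complex_bounds:
  assumes "w \<in> ball z \<delta>"
  shows "\<bar>Re w - Re z\<bar> \<le> \<delta>" "\<bar>Im w\<bar> \<le> norm z + \<delta>" "norm w \<le> norm z + \<delta>"
proof -
  have d: "norm (w - z) < \<delta>" using assms by (simp add: dist_norm norm_minus_commute)
  show "\<bar>Re w - Re z\<bar> \<le> \<delta>" using abs_Re_le_cmod[of "w - z"] d by simp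
  show "norm w \<le> norm z + \<delta>" using norm_triangle_ineq2[of w z] d by simp
  thus "\<bar>Im w\<bar> \<le> norm z + \<delta>" using abs_Im_le_cmod[of w] by linarith
qed

lemma holomorphic_lipschitz_sum:
  assumes z: "z > 0"
  shows "(\<lambda>a. lipschitz_sum a z) holomorphic_on UNIV"
  unfolding lipschitz_sum_def
proof (rule holomorphic_on_suminf)
  show "(\<lambda>a. of_nat (Suc k) powr (a - 1) * complex_of_real (exp (- 2 * pi * z * real (Suc k)))) holomorphic_on UNIV" for k
    by (intro holomorphic_intros) (auto simp del: of_nat_Suc)
  fix b :: complex
  show "\<exists>d>0. \<exists>M. summable M \<and> (\<forall>\<^sub>F k in sequentially. \<forall>a\<in>ball b d \<inter> UNIV.
      norm (of_nat (Suc k) powr (a - 1) * complex_of_real (exp (- 2 * pi * z * real (Suc k)))) \<le> M k)"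
  proof (intro exI conjI always_eventually allI ballI)
    show "(0::real) < 1" by simp
    show "summable (\<lambda>k. real (Suc k) powr Re b * exp (- (2 * pi * z) * real (Suc k)))"
      by (rule summable_powr_exp) (use z in auto)
    fix k a assume a: "a \<in> ball b 1 \<inter> UNIV"
    have "real (Suc k) powr (Re a - 1) \<le> real (Suc k) powr Re b"
      using ball_complex_bounds(1)[of a b 1] a by (intro powr_mono) auto
    thus "norm (of_nat (Suc k) powr (a - 1) * complex_of_real (exp (- 2 * pi * z * real (Suc k))))
       \<le> real (Suc k) powr Re b * exp (- (2 * pi * z) * real (Suc k))"
      by (simp add: norm_mult norm_powr_nat mult_right_mono del: of_nat_Suc)
  qed
qed auto

lemma holomorphic_sum_lipschitz_term:
  assumes z: "z > 0"
  shows "(\<lambda>a. \<Sum>n. lipschitz_term a (of_real z) (Suc n)) holomorphic_on {a. Re a > 0}"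
proof (rule holomorphic_on_suminf)
  show "open {a. Re a > 0}" by (rule open_halfspace_Re_gt)
  have nz: "complex_of_real z + \<i> * of_nat (Suc n) \<noteq> 0" "complex_of_real z - \<i> * of_nat (Suc n) \<noteq> 0" for n
    using z by (auto simp: complex_eq_iff)
  show "(\<lambda>a. lipschitz_term a (of_real z) (Suc n)) holomorphic_on {a. Re a > 0}" for n
    unfolding lipschitz_term_def by (intro holomorphic_intros nz) (auto simp del: of_nat_Suc)
  fix b :: complex assume "b \<in> {a. Re a > 0}"
  hence b: "Re b > 0" by simp
  define \<delta> where "\<delta> = Re b / 2"
  have \<delta>: "\<delta> > 0" using b by (simp add: \<delta>_def)
  define K where "K = norm b + \<delta>"
  show "\<exists>d>0. \<exists>M. summable M \<and> (\<forall>\<^sub>F n in sequentially. \<forall>a\<in>ball b d \<inter> {a. Re a > 0}.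
          norm (lipschitz_term a (of_real z) (Suc n)) \<le> M n)"
  proof (intro exI conjI always_eventually allI ballI)
    show "\<delta> > 0" by fact
    show "summable (\<lambda>n. 2 * K * exp (pi * K) * real (Suc n) powr (- \<delta> - 1) * z)"
      by (intro summable_mult summable_mult2 summable_nat_powr_real) (use \<delta> in auto)
    fix n a assume a: "a \<in> ball b \<delta> \<inter> {a. Re a > 0}"
    have K: "norm a \<le> K" "\<bar>Im a\<bar> \<le> K"
      using ball_complex_bounds[of a b \<delta>] a by (auto simp: K_def)
    have "\<bar>Re a - Re b\<bar> \<le> \<delta>" using ball_complex_bounds[of a b \<delta>] a by auto
    hence K': "Re a \<ge> \<delta>" unfolding \<delta>_def by linarith
    have "norm (lipschitz_term a (of_real z) (Suc n)) \<le>
            2 * norm a * exp (pi * \<bar>Im a\<bar>) * real (Suc n) powr (- Re a - 1) * z"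
      using a by (intro norm_lipschitz_term_real_le z) auto
    also have "\<dots> \<le> 2 * K * exp (pi * K) * real (Suc n) powr (- \<delta> - 1) * z"
      using K K' z \<delta> by (intro mult_mono powr_mono) (auto simp: K_def)
    finally show "norm (lipschitz_term a (of_real z) (Suc n)) \<le> 2 * K * exp (pi * K) * real (Suc n) powr (- \<delta> - 1) * z" .
  qed
qed

text \<open>The regularized formula at z = 1, solved for zeta(w) with a = 1 - w. The factor (2
  pi)^(w-1) is (2 pi)^(-a), and the summand 1 stands for Gamma(a) (2 pi z)^(-a). Every part makes
  sense for Re a > 0, that is for Re w < 1.\<close>

definition zeta_left :: "complex \<Rightarrow> complex" where
  "zeta_left w = lipschitz_sum (1 - w) 1 - Gamma (1 - w) * of_real (2 * pi) powr (w - 1) *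
     (1 + (\<Sum>n. lipschitz_term (1 - w) (of_real 1) (Suc n)))"

lemma holomorphic_zeta_left: "zeta_left holomorphic_on {w. Re w < 1}"
proof -
  have h: "(\<lambda>w. 1 - w) holomorphic_on {w. Re w < 1}" by (intro holomorphic_intros)
  have 1: "(\<lambda>w. lipschitz_sum (1 - w) 1) holomorphic_on {w. Re w < 1}"
    using holomorphic_on_compose_gen[OF h holomorphic_lipschitz_sum[of 1]] by (simp add: o_def image_subset_iff)
  have 2: "(\<lambda>w. \<Sum>n. lipschitz_term (1 - w) (of_real 1) (Suc n)) holomorphic_on {w. Re w < 1}"
    using holomorphic_on_compose_gen[OF h holomorphic_sum_lipschitz_term[of 1]] by (simp add: o_def image_subset_iff)
  have 3: "1 - w \<notin> \<int>\<^sub>\<le>\<^sub>0" if "Re w < 1" for w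
    using that by (auto elim!: nonpos_Ints_cases simp: complex_eq_iff)
  show ?thesis unfolding zeta_left_def[abs_def]
    by (intro holomorphic_intros 1 2) (use 3 in auto)
qed

text \<open>The regularized formula is known for real exponents between 0 and 1; the identity
  theorem spreads the equality over the strip in which both functions are holomorphic.\<close>

lemma zeta_right_eq_zeta_left:
  assumes "0 < Re w" "Re w < 1"
  shows "zeta_right w = zeta_left w"
proof (rule holomorphic_eq_from_real_interval[where f = zeta_right and g = zeta_left and a = 0 and b = 1 and S = "{w. 0 < Re w} \<inter> {w. Re w < 1}"])
  show "zeta_right holomorphic_on {w. 0 < Re w} \<inter> {w. Re w < 1}"
    by (rule holomorphic_on_subset[OF holomorphic_zeta_right]) auto
  show "zeta_left holomorphic_on {w. 0 < Re w} \<inter> {w. Re w < 1}"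
    by (rule holomorphic_on_subset[OF holomorphic_zeta_left]) auto
  show "open ({w. 0 < Re w} \<inter> {w. Re w < 1})"
    by (intro open_Int open_halfspace_Re_gt open_halfspace_Re_lt)
  show "connected ({w. 0 < Re w} \<inter> {w. Re w < 1})"
    by (intro convex_connected convex_Int convex_halfspace_Re_gt convex_halfspace_Re_lt)
  fix x :: real assume x: "0 < x" "x < 1"
  have *: "1 - complex_of_real x = of_real (1 - x)" by simp
  have L: "of_real (2 * pi) powr (1 - of_real x) * lipschitz_rem (1 - of_real x) 1 =
           Gamma (1 - of_real x) * (\<Sum>n. lipschitz_term (1 - of_real x) (of_real 1) (Suc n))"
    unfolding * by (rule lipschitz_regularized) (use x in auto)
  have "of_real (2 * pi) powr (of_real x - 1) * of_real (2 * pi) powr (1 - complex_of_real x) = 1"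
    by (subst powr_add[symmetric]) simp
  hence "lipschitz_rem (1 - of_real x) 1 = of_real (2 * pi) powr (of_real x - 1) *
            (of_real (2 * pi) powr (1 - of_real x) * lipschitz_rem (1 - of_real x) 1)"
    by (simp only: mult.assoc[symmetric] mult_1_left)
  hence "lipschitz_rem (1 - of_real x) 1 = of_real (2 * pi) powr (of_real x - 1) *
         (Gamma (1 - of_real x) * (\<Sum>n. lipschitz_term (1 - of_real x) (of_real 1) (Suc n)))"
    unfolding L .
  thus "zeta_right (of_real x) = zeta_left (of_real x)"
    by (simp add: lipschitz_rem_def zeta_left_def algebra_simps)
qed (use assms in auto)

text \<open>The definite description has a referent: the two half-plane functions agree on their
  overlap, cover the punctured plane, and the Dirichlet series leaves no choice.\<close>

lemma holomorphic_riemann_zeta: "riemann_zeta holomorphic_on (- {1})"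
  and riemann_zeta_eq_zeta_right: "Re s > 0 \<Longrightarrow> s \<noteq> 1 \<Longrightarrow> riemann_zeta s = zeta_right s"
proof -
  define P where "P = (\<lambda>f. f holomorphic_on (- {1}) \<and>
     (\<forall>s. Re s > 1 \<longrightarrow> (\<lambda>n. 1 / of_nat (Suc n) powr s) sums f s) \<and> f 1 = (0 :: complex))"
  define A where "A = {w. Re w > 0} - {1 :: complex}"
  define B where "B = {w. Re w < 1}"
  \<comment> \<open>The value 0 at s = 1 follows the convention in the definition of
    \<open>riemann_zeta\<close>.\<close>
  define f where "f = (\<lambda>s. if s = 1 then 0 else if s \<in> A then zeta_right s else zeta_left s)"
  have AB: "A \<union> B = - {1}"
  proof (intro set_eqI iffI)
    fix w :: complex assume "w \<in> - {1}"
    thus "w \<in> A \<union> B" by (cases "Re w > 0") (auto simp: A_def B_def)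
  qed (auto simp: A_def B_def)
  have "(\<lambda>s. if s \<in> A then zeta_right s else zeta_left s) holomorphic_on (A \<union> B)"
  proof (rule holomorphic_on_If_Un)
    show "zeta_right holomorphic_on A" using holomorphic_zeta_right by (simp add: A_def)
    show "zeta_left holomorphic_on B" using holomorphic_zeta_left by (simp add: B_def)
    show "open A" unfolding A_def by (intro open_Diff open_halfspace_Re_gt) auto
    show "open B" unfolding B_def by (rule open_halfspace_Re_lt)
  qed (auto simp: A_def B_def zeta_right_eq_zeta_left)
  hence "f holomorphic_on (- {1})"
    unfolding AB by (rule holomorphic_transform) (auto simp: f_def)
  moreover have "(\<lambda>n. 1 / of_nat (Suc n) powr s) sums f s" if "Re s > 1" for s
  proof -
    have "s \<noteq> 1" using that by auto
    thus ?thesis using zeta_right_sums[OF that] that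
      by (simp add: f_def A_def powr_minus inverse_eq_divide)
  qed
  ultimately have Pf: "P f" by (simp add: P_def f_def)
  have unique: "g = f" if "P g" for g
  proof
    fix s
    show "g s = f s"
    proof (cases "s = 1")
      case True
      thus ?thesis using that Pf by (simp add: P_def)
    next
      case False
      show ?thesis
      \<comment> \<open>The interval lies where the series converges and so determines both
        functions.\<close>
      proof (rule holomorphic_eq_from_real_interval[where f = g and g = f and a = 2 and b = 3 and S = "- {1}"])
        show "connected (- {1 :: complex})"
          by (rule connected_punctured_universe) simp
        fix x :: real assume "2 < x"
        hence "(\<lambda>n. 1 / of_nat (Suc n) powr (complex_of_real x)) sums g (of_real x)"
              "(\<lambda>n. 1 / of_nat (Suc n) powr (complex_of_real x)) sums f (of_real x)"
          using that Pf by (auto simp: P_def)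
        thus "g (of_real x) = f (of_real x)" by (rule sums_unique2)
      qed (use that Pf False in \<open>auto simp: P_def\<close>)
    qed
  qed
  have eq: "riemann_zeta = f"
    unfolding riemann_zeta_def P_def[symmetric] by (rule the_equality[where P = P, OF Pf unique])
  show "riemann_zeta holomorphic_on (- {1})"
    using Pf by (auto simp: eq P_def)
  show "Re s > 0 \<Longrightarrow> s \<noteq> 1 \<Longrightarrow> riemann_zeta s = zeta_right s"
    by (simp add: eq f_def A_def)
qed

section \<open>Summation of powers times exponentials of reciprocals\<close>

text \<open>From Gamma(1/2) = sqrt(pi) by u = t^2 on the positive half line, and by reflection on
  the negative one.\<close>

lemma gaussian_integral:
  "((\<lambda>t::real. exp (- t\<^sup>2)) absolutely_integrable_on UNIV) \<and> integral UNIV (\<lambda>t::real. exp (- t\<^sup>2)) = sqrt pi"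
proof -
  define f where "f = (\<lambda>u::real. u powr (1/2 - 1) * exp (- 1 * u))"
  have f: "f absolutely_integrable_on {0<..}" "integral {0<..} f = sqrt pi"
    using absolutely_integrable_Gamma_scaled_real[of "1/2" 1] Gamma_one_half_real
    unfolding f_def by auto
  have img: "(\<lambda>t::real. t\<^sup>2) ` {0<..} = {0<..}"
  proof safe
    fix x :: real assume "x > 0"
    thus "x \<in> (\<lambda>t. t\<^sup>2) ` {0<..}" by (intro image_eqI[of _ _ "sqrt x"]) auto
  qed auto
  have 12: "(\<lambda>t. \<bar>2 * t\<bar> *\<^sub>R f (t\<^sup>2)) absolutely_integrable_on {0<..} \<and>
        integral {0<..} (\<lambda>t. \<bar>2 * t\<bar> *\<^sub>R f (t\<^sup>2)) = sqrt pi"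
    by (subst has_absolute_integral_change_of_variables_real[of "{0<..}" "\<lambda>t. t\<^sup>2" "\<lambda>t. 2 * t"])
       (use f img in \<open>auto intro!: derivative_eq_intros inj_onI simp: power2_eq_iff_nonneg\<close>)
  have eq: "\<bar>2 * t\<bar> *\<^sub>R f (t\<^sup>2) = 2 * exp (- t\<^sup>2)" if "t \<in> {0<..}" for t :: real
  proof -
    have "(t\<^sup>2) powr (1/2 - 1) = 1 / t"
      using that by (simp add: powr_minus powr_half_sqrt inverse_eq_divide)
    thus ?thesis using that by (simp add: f_def)
  qed
  have "((\<lambda>t. \<bar>2 * t\<bar> *\<^sub>R f (t\<^sup>2)) has_integral sqrt pi) {0<..}"
    using 12 by (auto simp: has_integral_iff absolutely_integrable_on_def)
  hence "((\<lambda>t::real. 2 * exp (- t\<^sup>2)) has_integral sqrt pi) {0<..}"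
    by (rule has_integral_eq[rotated]) (use eq in auto)
  from has_integral_mult_right[OF this, of "1/2"]
  have pos: "((\<lambda>t::real. exp (- t\<^sup>2)) has_integral sqrt pi / 2) {0<..}" by simp
  hence "(\<lambda>t::real. exp (- t\<^sup>2)) absolutely_integrable_on uminus ` {..<0} \<and>
      integral (uminus ` {..<0}) (\<lambda>t::real. exp (- t\<^sup>2)) = sqrt pi / 2"
    by (auto simp: has_integral_iff absolutely_integrable_on_iff_nonneg)
  hence "(\<lambda>t::real. \<bar>- 1\<bar> *\<^sub>R exp (- (- t)\<^sup>2)) absolutely_integrable_on {..<0} \<and>
      integral {..<0} (\<lambda>t::real. \<bar>- 1\<bar> *\<^sub>R exp (- (- t)\<^sup>2)) = sqrt pi / 2"
    by (subst has_absolute_integral_change_of_variables_real[where g = uminus and h = "\<lambda>_. -1"])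
       (auto intro!: derivative_eq_intros)
  hence neg: "((\<lambda>t::real. exp (- t\<^sup>2)) has_integral sqrt pi / 2) {..<0}"
    by (auto simp: has_integral_iff absolutely_integrable_on_def)
  have "((\<lambda>t::real. exp (- t\<^sup>2)) has_integral sqrt pi / 2 + sqrt pi / 2) ({0<..} \<union> {..<0})"
    by (rule has_integral_Un[OF pos neg]) (auto intro: negligible_subset[of "{}"])
  hence "((\<lambda>t::real. exp (- t\<^sup>2)) has_integral sqrt pi) ({0<..} \<union> {..<0})" by simp
  hence "((\<lambda>t::real. exp (- t\<^sup>2)) has_integral sqrt pi) UNIV"
    by (subst (asm) has_integral_spike_set_eq[where T = UNIV])
       (auto intro: negligible_subset[of "{0}"])
  thus ?thesis by (auto simp: has_integral_iff absolutely_integrable_on_iff_nonneg)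
qed

lemma absolutely_integrable_Gamma_inverse_real:
  assumes b: "b > 0" and c: "c > (0::real)"
  shows "(\<lambda>x. x powr (- b - 1) * exp (- c / x)) absolutely_integrable_on {0<..}"
    and "integral {0<..} (\<lambda>x. x powr (- b - 1) * exp (- c / x)) = Gamma b * c powr (- b)"
proof -
  have *: "Re (of_real b) > 0" using b by simp
  note A = absolutely_integrable_Gamma_inverse[OF * c]
  have eq: "complex_of_real t powr (- of_real b - 1) * of_real (exp (- c / t)) =
        of_real (t powr (- b - 1) * exp (- c / t))" if "t \<in> {0<..}" for t
    using that powr_of_real[of t "- b - 1"] by simp
  have 1: "(\<lambda>t. complex_of_real (t powr (- b - 1) * exp (- c / t))) absolutely_integrable_on {0<..}"
    by (rule absolutely_integrable_spike[OF A(1), of "{}"]) (use eq in auto)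
  have 2: "integral {0<..} (\<lambda>t. complex_of_real (t powr (- b - 1) * exp (- c / t))) = of_real (Gamma b * c powr (- b))"
    using A(2) c powr_of_real[of c "-b"]
    by (subst integral_cong[OF eq[symmetric]]) (auto simp: Gamma_complex_of_real)
  show i: "(\<lambda>t. t powr (- b - 1) * exp (- c / t)) absolutely_integrable_on {0<..}"
    using absolutely_integrable_linear[OF 1 bounded_linear_Re] by (simp add: o_def)
  have "((\<lambda>t. complex_of_real (t powr (- b - 1) * exp (- c / t))) has_integral of_real (Gamma b * c powr (- b))) {0<..}"
    using 1 2 by (simp add: has_integral_iff absolutely_integrable_on_def)
  from has_integral_linear[OF this bounded_linear_Re]
  show "integral {0<..} (\<lambda>t. t powr (- b - 1) * exp (- c / t)) = Gamma b * c powr (- b)"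
    by (intro integral_unique) (simp add: o_def)
qed

text \<open>The Cauchy--Schloemilch substitution
  \<^term>\<open>u = sqrt (B * x) - sqrt (c / x)\<close>; the reflection \<^term>\<open>\<lambda>x. c / (B * x)\<close>
  shows that the two halves of its Jacobian contribute equally.\<close>

lemma glasser_integral:
  assumes B: "B > (0::real)" and c: "c > 0"
  shows "(\<lambda>x. exp (- B * x) * (x powr (-1/2) * exp (- c / x))) absolutely_integrable_on {0<..}"
    and "integral {0<..} (\<lambda>x. exp (- B * x) * (x powr (-1/2) * exp (- c / x))) =
           sqrt pi / sqrt B * exp (- 2 * (sqrt B * sqrt c))"
proof -
  define b d where "b = sqrt B" and "d = sqrt c"
  have bd: "b > 0" "d > 0" "B = b\<^sup>2" "c = d\<^sup>2" using B c by (auto simp: b_def d_def)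
  define E where "E = (\<lambda>x. exp (- B * x) * exp (- c / x))"
  define f1 f2 where "f1 = (\<lambda>x. x powr (-1/2) * E x)" and "f2 = (\<lambda>x. x powr (-3/2) * E x)"
  define p where "p = (\<lambda>x. b * sqrt x - d / sqrt x)"
  define p' where "p' = (\<lambda>x. b / 2 * x powr (-1/2) + d / 2 * x powr (-3/2))"
  have p: "(p has_real_derivative p' x) (at x)" if "x > 0" for x
  proof -
    have "(p has_real_derivative b * (inverse (sqrt x) / 2) - (- (d * (inverse (sqrt x) / 2)) / (sqrt x * sqrt x))) (at x)"
      unfolding p_def using that by (auto intro!: derivative_eq_intros)
    moreover have "x powr (-1/2) = inverse (sqrt x)" "x powr (-3/2) = inverse (sqrt x) / x"
    proof -
      show "x powr (-1/2) = inverse (sqrt x)" using that by (simp add: powr_minus powr_half_sqrt)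
      have "x powr (-3/2) = x powr (-1/2 - 1)" by simp
      also have "\<dots> = x powr (-1/2) / x powr 1" by (rule powr_diff)
      finally show "x powr (-3/2) = inverse (sqrt x) / x"
        using that \<open>x powr (-1/2) = inverse (sqrt x)\<close> by simp
    qed
    ultimately show ?thesis using that by (simp add: p'_def mult.commute)
  qed
  have p'pos: "p' x > 0" if "x > 0" for x
    using that bd unfolding p'_def by (intro add_pos_pos mult_pos_pos) auto
  have inj: "inj_on p {0<..}"
  proof (rule linorder_inj_onI)
    fix x y :: real assume xy: "x < y" "x \<in> {0<..}" "y \<in> {0<..}"
    have "p x < p y"
    proof (rule DERIV_pos_imp_increasing[OF xy(1)])
      fix t assume "x \<le> t"
      hence "t > 0" using xy by simp
      thus "\<exists>y. (p has_real_derivative y) (at t) \<and> 0 < y" using p p'pos by blast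
    qed
    thus "p x \<noteq> p y" by simp
  qed auto
  have img: "p ` {0<..} = UNIV"
  proof (intro equalityI subset_UNIV subsetI)
    fix y :: real
    \<comment> \<open>With s = sqrt x the equation p(x) = y becomes b s^2 - y s - d = 0; this is its
      positive root.\<close>
    define s where "s = (y + sqrt (y\<^sup>2 + 4 * b * d)) / (2 * b)"
    have D: "y\<^sup>2 + 4 * b * d > y\<^sup>2" using bd by simp
    hence "sqrt (y\<^sup>2 + 4 * b * d) > sqrt (y\<^sup>2)" by (rule real_sqrt_less_mono)
    hence s: "s > 0" using bd unfolding s_def by (intro divide_pos_pos) auto
    have "(2 * b * s - y)\<^sup>2 = y\<^sup>2 + 4 * b * d"
    proof -
      have "2 * b * s - y = sqrt (y\<^sup>2 + 4 * b * d)" using bd by (simp add: s_def)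
      moreover have "0 \<le> y\<^sup>2 + 4 * b * d" using bd by simp
      ultimately show ?thesis by (simp only: real_sqrt_pow2)
    qed
    hence "4 * b * (b * s\<^sup>2 - y * s - d) = 0" by (simp add: power2_eq_square algebra_simps)
    hence "b * s\<^sup>2 - y * s - d = 0" using bd by simp
    hence "b * s - d / s = y" using s by (simp add: field_simps power2_eq_square)
    thus "y \<in> p ` {0<..}" using s by (intro image_eqI[of _ _ "s\<^sup>2"]) (auto simp: p_def)
  qed
  \<comment> \<open>Completing the square; the cross term 2 b d is the source of the factor exp(-2
    sqrt(B c)) in the result.\<close>
  have pE: "exp (- (p x)\<^sup>2) = exp (2 * (b * d)) * E x" if "x > 0" for x
  proof -
    have "(p x)\<^sup>2 = B * x + c / x - 2 * (b * d)"
      using that unfolding p_def bd by (simp add: power2_eq_square field_simps)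
    thus ?thesis by (simp add: E_def flip: exp_add)
  qed
  have sum: "(\<lambda>x. \<bar>p' x\<bar> *\<^sub>R exp (- (p x)\<^sup>2)) absolutely_integrable_on {0<..} \<and>
        integral {0<..} (\<lambda>x. \<bar>p' x\<bar> *\<^sub>R exp (- (p x)\<^sup>2)) = sqrt pi"
    by (subst has_absolute_integral_change_of_variables_real[OF _ _ inj, where h = p'])
       (use p gaussian_integral img in \<open>auto intro: has_field_derivative_at_within\<close>)
  have sum_eq: "\<bar>p' x\<bar> *\<^sub>R exp (- (p x)\<^sup>2) = exp (2 * (b * d)) * (b / 2 * f1 x + d / 2 * f2 x)"
    if "x \<in> {0<..}" for x
    using p'pos[of x] pE[of x] that by (simp add: p'_def f1_def f2_def algebra_simps)
  have Eb: "0 \<le> E x" "E x \<le> exp (- c / x)" if "x > 0" for x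
    using that B by (auto simp: E_def intro!: mult_left_le_one_le)
  \<comment> \<open>The substitution yields integrability only for the combination of
    \<open>f1\<close> and \<open>f2\<close>; \<open>f1\<close> alone is dominated by an Euler
    integrand.\<close>
  have f1i: "f1 absolutely_integrable_on {0<..}"
  proof (rule measurable_bounded_by_integrable_imp_absolutely_integrable)
    show "f1 \<in> borel_measurable (lebesgue_on {0<..})"
      unfolding f1_def E_def
      by (intro continuous_imp_measurable_on_sets_lebesgue continuous_intros) auto
    have "(\<lambda>x. x powr (1/2 - 1) * exp (- B * x)) absolutely_integrable_on {0<..}"
      by (rule absolutely_integrable_Gamma_scaled_real) (use B in auto)
    thus "(\<lambda>x. x powr (1/2 - 1) * exp (- B * x)) integrable_on {0<..}"
      by (simp add: absolutely_integrable_on_def)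
    fix x :: real assume "x \<in> {0<..}"
    thus "norm (f1 x) \<le> x powr (1/2 - 1) * exp (- B * x)"
      using c by (simp add: f1_def E_def mult_left_mono)
  qed auto
  define h where "h = (\<lambda>x. c / (B * x))"
  have himg: "h ` {0<..} = {0<..}"
  proof safe
    fix x :: real assume "x > 0"
    thus "x \<in> h ` {0<..}" using B c by (intro image_eqI[of _ _ "h x"]) (auto simp: h_def)
  qed (use B c in \<open>auto simp: h_def\<close>)
  have f12: "(\<lambda>x. \<bar>- c / (B * x\<^sup>2)\<bar> *\<^sub>R f1 (h x)) absolutely_integrable_on {0<..} \<and>
       integral {0<..} (\<lambda>x. \<bar>- c / (B * x\<^sup>2)\<bar> *\<^sub>R f1 (h x)) = integral {0<..} f1"
    by (subst has_absolute_integral_change_of_variables_real[where g = h and h = "\<lambda>x. - c / (B * x\<^sup>2)"])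
       (use f1i himg B c in \<open>auto simp: h_def power2_eq_square field_simps intro!: derivative_eq_intros inj_onI\<close>)
  have f12_eq: "\<bar>- c / (B * x\<^sup>2)\<bar> *\<^sub>R f1 (h x) = d / b * f2 x" if "x \<in> {0<..}" for x
  proof -
    have x: "x > 0" using that by simp
    have "E (h x) = E x" using x B c by (simp add: E_def h_def mult.commute)
    moreover have "h x powr (-1/2) = b / d * sqrt x"
      using x B c by (simp add: powr_minus powr_half_sqrt h_def b_def d_def real_sqrt_divide real_sqrt_mult)
    moreover have "x powr (-3/2) = sqrt x / x\<^sup>2"
    proof -
      have "x powr (-3/2) = x powr (1/2 - 2)" by simp
      also have "\<dots> = x powr (1/2) / x powr 2" by (rule powr_diff)
      finally show ?thesis using x by (simp add: powr_half_sqrt)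
    qed
    moreover have "c / (B * x\<^sup>2) * (b / d * sqrt x) = d / b * (sqrt x / x\<^sup>2)"
      using bd x by (simp add: power2_eq_square)
    hence "c / (B * x\<^sup>2) * ((b / d * sqrt x) * E x) = d / b * ((sqrt x / x\<^sup>2) * E x)"
      by (simp only: mult.assoc[symmetric])
    moreover have "\<bar>- c / (B * x\<^sup>2)\<bar> = c / (B * x\<^sup>2)" using x B c by simp
    ultimately show ?thesis by (simp only: f1_def f2_def real_scaleR_def)
  qed
  have "((\<lambda>x. \<bar>- c / (B * x\<^sup>2)\<bar> *\<^sub>R f1 (h x)) has_integral integral {0<..} f1) {0<..}"
    using f12 by (auto simp: has_integral_iff absolutely_integrable_on_def)
  hence "((\<lambda>x. d / b * f2 x) has_integral integral {0<..} f1) {0<..}"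
    by (rule has_integral_eq[rotated]) (use f12_eq in auto)
  from has_integral_mult_right[OF this, of "b / 2"]
  have I2: "((\<lambda>x. d / 2 * f2 x) has_integral b / 2 * integral {0<..} f1) {0<..}"
    using bd by simp
  have I1: "((\<lambda>x. b / 2 * f1 x) has_integral b / 2 * integral {0<..} f1) {0<..}"
    using f1i by (intro has_integral_mult_right integrable_integral) (auto simp: absolutely_integrable_on_def)
  have "((\<lambda>x. exp (2 * (b * d)) * (b / 2 * f1 x + d / 2 * f2 x)) has_integral
          exp (2 * (b * d)) * (b / 2 * integral {0<..} f1 + b / 2 * integral {0<..} f1)) {0<..}"
    by (intro has_integral_mult_right has_integral_add I1 I2)
  moreover have "((\<lambda>x. exp (2 * (b * d)) * (b / 2 * f1 x + d / 2 * f2 x)) has_integral sqrt pi) {0<..}"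
  proof (rule has_integral_eq)
    show "((\<lambda>x. \<bar>p' x\<bar> *\<^sub>R exp (- (p x)\<^sup>2)) has_integral sqrt pi) {0<..}"
      using sum by (auto simp: has_integral_iff absolutely_integrable_on_def)
  qed (use sum_eq in auto)
  ultimately have "exp (2 * (b * d)) * (b / 2 * integral {0<..} f1 + b / 2 * integral {0<..} f1) = sqrt pi"
    by (rule has_integral_unique)
  hence "integral {0<..} f1 = sqrt pi / b * exp (- 2 * (b * d))"
    using bd by (simp add: field_simps exp_minus)
  moreover have "f1 = (\<lambda>x. exp (- B * x) * (x powr (-1/2) * exp (- c / x)))"
    by (simp add: f1_def E_def mult_ac)
  ultimately show "(\<lambda>x. exp (- B * x) * (x powr (-1/2) * exp (- c / x))) absolutely_integrable_on {0<..}"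
    "integral {0<..} (\<lambda>x. exp (- B * x) * (x powr (-1/2) * exp (- c / x))) =
           sqrt pi / sqrt B * exp (- 2 * (sqrt B * sqrt c))"
    using f1i by (auto simp: b_def d_def)
qed

text \<open>At x = 0 the power is 0 for every exponent, while the exponential is 1 because of
  division by zero. The product therefore takes the value 0 of the continuous extension for c >
  0.\<close>

definition powr_exp_inv :: "complex \<Rightarrow> real \<Rightarrow> real \<Rightarrow> complex" where
  "powr_exp_inv w c x = of_real x powr w * of_real (exp (- c / x))"

lemma norm_powr_exp_inv: "x > 0 \<Longrightarrow> norm (powr_exp_inv w c x) = x powr Re w * exp (- c / x)"
  by (simp add: powr_exp_inv_def norm_mult norm_powr_of_real)

lemma powr_exp_inv_has_vector_derivative:
  assumes x: "x > 0"
  shows "(powr_exp_inv w c has_vector_derivative (w * powr_exp_inv (w - 1) c x + of_real c * powr_exp_inv (w - 2) c x)) (at x)"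
proof -
  have "((\<lambda>z. z powr w * exp (- of_real c / z)) has_field_derivative
          (w * of_real x powr (w - 1) * exp (- of_real c / of_real x)
            + of_real x powr w * (of_real c / (of_real x)\<^sup>2 * exp (- of_real c / of_real x)))) (at (complex_of_real x))"
    using x by (auto intro!: derivative_eq_intros simp: power2_eq_square)
  from has_vector_derivative_real_field[OF this, of UNIV]
  have "((\<lambda>x. of_real x powr w * exp (- of_real c / of_real x)) has_vector_derivative
          (w * of_real x powr (w - 1) * exp (- of_real c / of_real x)
            + of_real x powr w * (of_real c / (of_real x)\<^sup>2 * exp (- of_real c / of_real x)))) (at x)"
    by simp
  moreover have "complex_of_real x powr (w - 2) = of_real x powr w / (of_real x)\<^sup>2"
    using x by (simp add: powr_diff powr_numeral)
  moreover have "(\<lambda>x. of_real x powr w * exp (- of_real c / of_real x)) = powr_exp_inv w c"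
    by (simp add: powr_exp_inv_def fun_eq_iff flip: exp_of_real)
  ultimately show ?thesis
    by (simp add: powr_exp_inv_def mult_ac flip: exp_of_real)
qed

lemma continuous_on_powr_exp_inv:
  assumes c: "c > 0"
  shows "continuous_on {0..} (powr_exp_inv w c)"
  unfolding continuous_on_eq_continuous_within
proof
  fix x :: real assume x: "x \<in> {0..}"
  show "continuous (at x within {0..}) (powr_exp_inv w c)"
  proof (cases "x = 0")
    case False
    hence "isCont (powr_exp_inv w c) x"
      using powr_exp_inv_has_vector_derivative[of x w c] x has_vector_derivative_continuous by force
    thus ?thesis by (rule continuous_at_imp_continuous_at_within)
  next
    case True
    have "((\<lambda>x. x powr Re w * exp (- c / x)) \<longlongrightarrow> 0) (at_right 0)"
      using c by real_asymp
    hence "((\<lambda>x. x powr Re w * exp (- c / x)) \<longlongrightarrow> 0) (at 0 within {0..})"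
      by (simp add: at_within_Ici_at_right)
    hence "(powr_exp_inv w c \<longlongrightarrow> 0) (at 0 within {0..})"
      by (rule Lim_null_comparison[rotated])
         (auto simp: eventually_at_filter norm_powr_exp_inv intro!: always_eventually)
    thus ?thesis using True by (simp add: continuous_within powr_exp_inv_def)
  qed
qed

lemma absolutely_integrable_powr_exp_inv:
  assumes "Re b > 0" "c > 0"
  shows "powr_exp_inv (- b - 1) c absolutely_integrable_on {0<..}"
        "integral {0<..} (powr_exp_inv (- b - 1) c) = Gamma b * of_real c powr (- b)"
  using absolutely_integrable_Gamma_inverse[OF assms] unfolding powr_exp_inv_def[abs_def] by auto

lemma euler_maclaurin_powr_exp_inv:
  assumes b: "Re b > 0" and c: "c > 0"
  shows "euler_maclaurin (powr_exp_inv (- b) c) (\<lambda>x. - b * powr_exp_inv (- b - 1) c x + of_real c * powr_exp_inv (- b - 2) c x)"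
proof
  show "continuous_on {0..} (powr_exp_inv (- b) c)" by (rule continuous_on_powr_exp_inv[OF c])
  show "(powr_exp_inv (- b) c has_vector_derivative - b * powr_exp_inv (- b - 1) c x + of_real c * powr_exp_inv (- b - 2) c x) (at x)"
    if "x > 0" for x using powr_exp_inv_has_vector_derivative[OF that, of "-b" c] .
  show "powr_exp_inv (- b) c 0 = 0" by (simp add: powr_exp_inv_def)
  have "(\<lambda>N. real N powr (- Re b) * exp (- c / real N)) \<longlonglongrightarrow> 0" using b c by real_asymp
  hence "(\<lambda>N. norm (powr_exp_inv (- b) c (real N))) \<longlonglongrightarrow> 0"
    by (rule Lim_transform_eventually)
       (auto simp: norm_powr_exp_inv intro: eventually_mono[OF eventually_gt_at_top[of 0]])
  thus "(\<lambda>N. powr_exp_inv (- b) c (real N)) \<longlonglongrightarrow> 0" by (rule tendsto_norm_zero_cancel)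
  have "Re (b + 1) > 0" "- (b + 1) - 1 = - b - 2" using b by auto
  with absolutely_integrable_powr_exp_inv(1)[of "b + 1" c] c
  have "powr_exp_inv (- b - 2) c absolutely_integrable_on {0<..}" by metis
  thus "(\<lambda>x. - b * powr_exp_inv (- b - 1) c x + of_real c * powr_exp_inv (- b - 2) c x) absolutely_integrable_on {0<..}"
    using absolutely_integrable_powr_exp_inv(1)[OF assms] by (intro set_integral_add set_integrable_mult_right)
qed

text \<open>The summand d^(-b) exp(-2 pi w / d) with d^(-b) split off. What remains is O(d^(-Re b -
  1)), so its series converges for Re b > 0, while \<open>zeta_right\<close> takes care of
  d^(-b).\<close>

definition sum_rem_term :: "complex \<Rightarrow> real \<Rightarrow> nat \<Rightarrow> complex" where
  "sum_rem_term b w d = of_nat d powr (- b) * of_real (exp (- 2 * pi * w / real d) - 1)"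

text \<open>The regularized value of the sum minus the integral over \<^term>\<open>x > (0::real)\<close> of
  \<open>x\<^sup>-\<^sup>b exp(-2\<pi>w/x)\<close>; cf. \<open>sum_rem_limit\<close>.\<close>

definition sum_rem :: "complex \<Rightarrow> real \<Rightarrow> complex" where
  "sum_rem b w = zeta_right b + (\<Sum>d. sum_rem_term b w (Suc d)) - Gamma (b - 1) * of_real (2 * pi * w) powr (1 - b)"

lemma norm_sum_rem_term_le:
  assumes "w > 0" "d > 0"
  shows "norm (sum_rem_term b w d) \<le> 2 * pi * w * real d powr (- Re b - 1)"
proof -
  have "norm (sum_rem_term b w d) = real d powr (- Re b) * (1 - exp (- (2 * pi * w / real d)))"
    using one_minus_exp_neg_bounds[of "2 * pi * w / real d"] assms
    by (simp add: sum_rem_term_def norm_mult norm_powr_nat flip: of_real_diff)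
  also have "\<dots> \<le> real d powr (- Re b) * (2 * pi * w / real d)"
    using one_minus_exp_neg_bounds[of "2 * pi * w / real d"] assms by (intro mult_left_mono) auto
  also have "\<dots> = 2 * pi * w * real d powr (- Re b - 1)"
    using assms by (simp add: powr_diff)
  finally show ?thesis .
qed

lemma summable_sum_rem_term:
  assumes "w > 0" "Re b > 0"
  shows "summable (\<lambda>d. norm (sum_rem_term b w (Suc d)))"
proof (rule summable_comparison_test')
  show "summable (\<lambda>d. 2 * pi * w * real (Suc d) powr (- Re b - 1))"
    by (intro summable_mult summable_nat_powr_real) (use assms in auto)
  show "norm (norm (sum_rem_term b w (Suc d))) \<le> 2 * pi * w * real (Suc d) powr (- Re b - 1)" for d
    using norm_sum_rem_term_le[of w "Suc d" b] assms by simp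
qed

lemma minus_one_notin_nonpos_Ints:
  assumes "Re b > 0" "b \<noteq> 1"
  shows "b - 1 \<notin> \<int>\<^sub>\<le>\<^sub>0"
proof
  assume "b - 1 \<in> \<int>\<^sub>\<le>\<^sub>0"
  then obtain n where n: "b - 1 = of_int n" "n \<le> 0" by (elim nonpos_Ints_cases) auto
  hence "Re b - 1 = of_int n" by (simp add: complex_eq_iff)
  hence "n = 0" using n assms by linarith
  thus False using n assms by simp
qed

text \<open>For 0 < Re b < 1 neither the sum nor the integral of x^(-b) exp(-c/x) converges. One
  integration by parts raises the exponent of the integral to b + 1, where Euler's integral is
  available, and leaves the boundary term N^(1-b) / (1-b) that the finite part of zeta
  requires.\<close>

lemma sum_rem_limit:
  assumes b: "Re b > 0" "b \<noteq> 1" and w: "w > 0"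
  defines "c \<equiv> 2 * pi * w"
  shows "(\<lambda>N. (\<Sum>d<N. powr_exp_inv (- b) c (real (Suc d))) - integral {0..real N} (powr_exp_inv (- b) c)) \<longlonglongrightarrow> sum_rem b w"
proof -
  have c: "c > 0" using w by (simp add: c_def)
  have int: "integral {0..real N} (powr_exp_inv (- b) c) =
      powr_exp_inv (1 - b) c (real N) / (1 - b) - of_real c / (1 - b) * integral {0..real N} (powr_exp_inv (- b - 1) c)" for N
  proof -
    have "((\<lambda>x. (1 - b) * powr_exp_inv (- b) c x + of_real c * powr_exp_inv (- b - 1) c x) has_integral
             powr_exp_inv (1 - b) c (real N) - powr_exp_inv (1 - b) c 0) {0..real N}"
    proof (rule fundamental_theorem_of_calculus_interior)
      show "continuous_on {0..real N} (powr_exp_inv (1 - b) c)"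
        by (rule continuous_on_subset[OF continuous_on_powr_exp_inv[OF c]]) auto
      show "(powr_exp_inv (1 - b) c has_vector_derivative (1 - b) * powr_exp_inv (- b) c x + of_real c * powr_exp_inv (- b - 1) c x) (at x)"
        if "x \<in> {0<..<real N}" for x
      proof -
        have e: "1 - b - 1 = - b" "1 - b - 2 = - b - 1" by auto
        have x: "x > 0" using that by simp
        show ?thesis using powr_exp_inv_has_vector_derivative[OF x, of "1 - b" c] by (simp only: e)
      qed
    qed auto
    moreover have "powr_exp_inv u c integrable_on {0..real N}" for u
      by (intro integrable_continuous_real continuous_on_subset[OF continuous_on_powr_exp_inv[OF c]]) auto
    hence "((\<lambda>x. (1 - b) * powr_exp_inv (- b) c x + of_real c * powr_exp_inv (- b - 1) c x) has_integral
             (1 - b) * integral {0..real N} (powr_exp_inv (- b) c) + of_real c * integral {0..real N} (powr_exp_inv (- b - 1) c)) {0..real N}"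
      by (intro has_integral_add has_integral_mult_right integrable_integral)
    ultimately have "(1 - b) * integral {0..real N} (powr_exp_inv (- b) c) + of_real c * integral {0..real N} (powr_exp_inv (- b - 1) c)
        = powr_exp_inv (1 - b) c (real N) - powr_exp_inv (1 - b) c 0"
      by (rule has_integral_unique[rotated])
    hence "(1 - b) * integral {0..real N} (powr_exp_inv (- b) c) = powr_exp_inv (1 - b) c (real N) - of_real c * integral {0..real N} (powr_exp_inv (- b - 1) c)"
      by (simp add: powr_exp_inv_def algebra_simps)
    hence "integral {0..real N} (powr_exp_inv (- b) c) = (powr_exp_inv (1 - b) c (real N) - of_real c * integral {0..real N} (powr_exp_inv (- b - 1) c)) / (1 - b)"
      using b by (simp add: eq_divide_eq mult.commute)
    thus ?thesis by (simp add: diff_divide_distrib)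
  qed
  have split: "powr_exp_inv (- b) c (real (Suc d)) = of_nat (Suc d) powr (- b) + sum_rem_term b w (Suc d)" for d
    by (simp add: powr_exp_inv_def sum_rem_term_def c_def algebra_simps)
  have pw: "of_nat N powr (1 - b) - powr_exp_inv (1 - b) c (real N) = of_nat N powr (1 - b) * of_real (1 - exp (- c / real N))" for N
    by (simp add: powr_exp_inv_def algebra_simps)
  have eq: "(\<Sum>d<N. powr_exp_inv (- b) c (real (Suc d))) - integral {0..real N} (powr_exp_inv (- b) c) =
     ((\<Sum>d<N. of_nat (Suc d) powr (- b)) - of_nat N powr (1 - b) / (1 - b)) + (\<Sum>d<N. sum_rem_term b w (Suc d))
      + (of_nat N powr (1 - b) * of_real (1 - exp (- c / real N)) / (1 - b)
      + of_real c / (1 - b) * integral {0..real N} (powr_exp_inv (- b - 1) c))" for N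
    unfolding int split pw[symmetric] by (simp add: sum.distrib diff_divide_distrib)
  \<comment> \<open>The boundary term carries exp(-c/N) where the finite part has 1; the discrepancy
    is O(N^(-Re b)).\<close>
  have lim1: "(\<lambda>N. of_nat N powr (1 - b) * of_real (1 - exp (- c / real N))) \<longlonglongrightarrow> 0"
  proof (rule tendsto_norm_zero_cancel)
    have "(\<lambda>N. real N powr (1 - Re b) * \<bar>1 - exp (- c / real N)\<bar>) \<longlonglongrightarrow> 0"
      using b c by real_asymp
    thus "(\<lambda>N. norm (of_nat N powr (1 - b) * complex_of_real (1 - exp (- c / real N)))) \<longlonglongrightarrow> 0"
    proof (rule Lim_transform_eventually)
      show "\<forall>\<^sub>F N in sequentially. real N powr (1 - Re b) * \<bar>1 - exp (- c / real N)\<bar> =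
        norm (of_nat N powr (1 - b) * complex_of_real (1 - exp (- c / real N)))"
        using eventually_gt_at_top[of 0]
        by eventually_elim (simp only: norm_mult norm_of_real norm_powr_nat minus_complex.sel one_complex.sel)
    qed
  qed
  have G: "Gamma b = (b - 1) * Gamma (b - 1)"
  proof -
    have "b - 1 \<notin> \<int>\<^sub>\<le>\<^sub>0" using b by (rule minus_one_notin_nonpos_Ints)
    hence "b - 1 \<noteq> 0" by auto
    thus ?thesis using Gamma_plus1[of "b - 1"] \<open>b - 1 \<notin> _\<close> by simp
  qed
  have cp: "of_real c * of_real c powr (- b) = (of_real c powr (1 - b) :: complex)"
    using c powr_add[of "complex_of_real c" 1 "-b"] by simp
  have "(\<lambda>N. (\<Sum>d<N. powr_exp_inv (- b) c (real (Suc d))) - integral {0..real N} (powr_exp_inv (- b) c)) \<longlonglongrightarrow>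
     zeta_right b + (\<Sum>d. sum_rem_term b w (Suc d)) + (0 / (1 - b) + of_real c / (1 - b) * (Gamma b * of_real c powr (- b)))"
    unfolding eq absolutely_integrable_powr_exp_inv(2)[OF b(1) c, symmetric]
    by (intro tendsto_add zeta_right_limit b tendsto_mult tendsto_const tendsto_divide lim1 summable_LIMSEQ
          summable_norm_cancel[OF summable_sum_rem_term] w integral_tendsto_integral_Ioi absolutely_integrable_powr_exp_inv(1) c)
       (use b in auto)
  also have "of_real c / (1 - b) * (Gamma b * of_real c powr (- b)) =
       Gamma b / (1 - b) * (of_real c * of_real c powr (- b))" by simp
  also have "Gamma b / (1 - b) = - Gamma (b - 1)"
    unfolding G using b by (simp add: divide_eq_eq algebra_simps)
  finally show ?thesis unfolding cp by (simp add: sum_rem_def c_def)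
qed

text \<open>The bound by the total variation, with the two parts of the derivative integrated
  separately; each is an Euler integral of order c^(-Re b). This is the O(k^(-b)) of the
  overview.\<close>

lemma norm_sum_rem_le:
  assumes b: "Re b > 0" "b \<noteq> 1" and w: "w > 0"
  shows "norm (sum_rem b w) \<le> (norm b * Gamma (Re b) + Gamma (Re b + 1)) * (2 * pi * w) powr (- Re b)"
proof -
  define c where "c = 2 * pi * w"
  have c: "c > 0" using w by (simp add: c_def)
  interpret euler_maclaurin "powr_exp_inv (- b) c" "\<lambda>x. - b * powr_exp_inv (- b - 1) c x + of_real c * powr_exp_inv (- b - 2) c x"
    by (rule euler_maclaurin_powr_exp_inv) (use b c in auto)
  define g' where "g' = (\<lambda>x. - b * powr_exp_inv (- b - 1) c x + of_real c * powr_exp_inv (- b - 2) c x)"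
  have "sum_rem b w = integral {0<..} (\<lambda>x. frac x *\<^sub>R g' x)"
    using LIMSEQ_unique[OF sum_rem_limit[OF b w] sum_minus_integral_limit[unfolded c_def]]
    by (simp add: g'_def c_def)
  also have "norm \<dots> \<le> integral {0<..} (\<lambda>x. norm (g' x))"
    using norm_integral_frac_le by (simp add: g'_def)
  also have "\<dots> \<le> norm b * (Gamma (Re b) * c powr (- Re b)) + c * (Gamma (Re b + 1) * c powr (- (Re b + 1)))"
  proof (rule integral_le[THEN order_trans])
    have i: "((\<lambda>x. norm b * (x powr (- Re b - 1) * exp (- c / x)) + c * (x powr (- (Re b + 1) - 1) * exp (- c / x)))
       has_integral norm b * (Gamma (Re b) * c powr (- Re b)) + c * (Gamma (Re b + 1) * c powr (- (Re b + 1)))) {0<..}"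
      by (intro has_integral_add has_integral_mult_right)
         (use absolutely_integrable_Gamma_inverse_real[of "Re b" c] absolutely_integrable_Gamma_inverse_real[of "Re b + 1" c] b c
          in \<open>auto simp: has_integral_iff absolutely_integrable_on_def\<close>)
    show "(\<lambda>x. norm b * (x powr (- Re b - 1) * exp (- c / x)) + c * (x powr (- (Re b + 1) - 1) * exp (- c / x))) integrable_on {0<..}"
      using i by blast
    show "integral {0<..} (\<lambda>x. norm b * (x powr (- Re b - 1) * exp (- c / x)) + c * (x powr (- (Re b + 1) - 1) * exp (- c / x)))
       \<le> norm b * (Gamma (Re b) * c powr (- Re b)) + c * (Gamma (Re b + 1) * c powr (- (Re b + 1)))"
      using i by (simp add: integral_unique)
    show "(\<lambda>x. norm (g' x)) integrable_on {0<..}"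
      using int by (simp add: g'_def absolutely_integrable_on_def)
    show "norm (g' x) \<le> norm b * (x powr (- Re b - 1) * exp (- c / x)) + c * (x powr (- (Re b + 1) - 1) * exp (- c / x))"
      if "x \<in> {0<..}" for x
    proof -
      have "norm (g' x) \<le> norm (- b * powr_exp_inv (- b - 1) c x) + norm (of_real c * powr_exp_inv (- b - 2) c x)"
        unfolding g'_def by (rule norm_triangle_ineq)
      also have "\<dots> = norm b * (x powr (- Re b - 1) * exp (- c / x)) + c * (x powr (- (Re b + 1) - 1) * exp (- c / x))"
      proof -
        have x: "x > 0" using that by simp
        have e: "Re (- b - 1) = - Re b - 1" "Re (- b - 2) = - (Re b + 1) - 1" by simp_all
        show ?thesis using c by (simp only: norm_mult norm_powr_exp_inv[OF x] e norm_minus_cancel norm_of_real abs_of_pos)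
      qed
      finally show ?thesis .
    qed
  qed
  also have "c * (Gamma (Re b + 1) * c powr (- (Re b + 1))) = Gamma (Re b + 1) * c powr (- Re b)"
    using c powr_add[of c 1 "- (Re b + 1)"] by simp
  finally show ?thesis by (simp add: c_def algebra_simps)
qed

text \<open>Poisson summation is stated for real functions. At b = 1/2 the complex kernel has real
  values, and this lemma passes to its real part.\<close>

lemma euler_maclaurin_Re:
  assumes "euler_maclaurin g g'"
  shows "euler_maclaurin (\<lambda>x. Re (g x)) (\<lambda>x. Re (g' x))"
proof -
  interpret euler_maclaurin g g' by fact
  show ?thesis
  proof
    show "continuous_on {0..} (\<lambda>x. Re (g x))" by (intro continuous_intros cont)
    show "((\<lambda>x. Re (g x)) has_vector_derivative Re (g' x)) (at x)" if "x > 0" for x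
      using bounded_linear.has_vector_derivative[OF bounded_linear_Re der[OF that]] .
    show "(\<lambda>N. Re (g (real N))) \<longlonglongrightarrow> 0" using tendsto_Re[OF ginf] by simp
    show "(\<lambda>x. Re (g' x)) absolutely_integrable_on {0<..}"
      using absolutely_integrable_linear[OF int bounded_linear_Re] by (simp add: o_def)
  qed simp
qed

text \<open>The contribution of frequency y to the Poisson summation of x^(-1/2) exp(-2 pi w / x),
  in closed form.\<close>

definition fourier_term :: "real \<Rightarrow> nat \<Rightarrow> real" where
  "fourier_term w y = sqrt 2 / sqrt (real y) * exp (- 2 * pi * sqrt (2 * w * real y)) *
                  sin (pi / 4 - 2 * pi * sqrt (2 * w * real y))"

lemma abs_fourier_term_le:
  assumes "w > 0" "y > 0"
  shows "\<bar>fourier_term w y\<bar> \<le> sqrt 2 * (real y powr (-1/2) * exp (- (2 * pi * sqrt (2 * w)) * sqrt (real y)))"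
proof -
  have "\<bar>fourier_term w y\<bar> \<le> \<bar>sqrt 2 / sqrt (real y) * exp (- 2 * pi * sqrt (2 * w * real y))\<bar> * 1"
    unfolding fourier_term_def abs_mult[of _ "sin _"] by (intro mult_left_mono) auto
  also have "\<dots> = sqrt 2 / sqrt (real y) * exp (- (2 * pi * sqrt (2 * w)) * sqrt (real y))"
    by (simp add: real_sqrt_mult mult_ac)
  also have "sqrt 2 / sqrt (real y) = sqrt 2 * real y powr (-1/2)"
  proof -
    have "real y powr (-1/2) = inverse (sqrt (real y))" by (simp add: powr_minus powr_half_sqrt)
    thus ?thesis by (simp only: divide_inverse)
  qed
  finally show ?thesis by (simp only: mult.assoc)
qed

lemma summable_fourier_term:
  assumes "w > 0"
  shows "summable (\<lambda>y. \<bar>fourier_term w (Suc y)\<bar>)"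
proof (rule summable_comparison_test')
  show "summable (\<lambda>y. sqrt 2 * (real (Suc y) powr (-1/2) * exp (- (2 * pi * sqrt (2 * w)) * sqrt (real (Suc y)))))"
    by (intro summable_mult summable_powr_exp_sqrt) (use assms in auto)
  show "norm \<bar>fourier_term w (Suc y)\<bar> \<le> sqrt 2 * (real (Suc y) powr (-1/2) * exp (- (2 * pi * sqrt (2 * w)) * sqrt (real (Suc y))))" for y
    using abs_fourier_term_le[OF assms, of "Suc y"] by (simp del: of_nat_Suc)
qed

text \<open>The sequence that tends to \<open>sum_rem (1/2) w\<close> is evaluated a second time by
  Poisson summation. The frequencies are boundary values of sqrt(pi B) exp(-2 sqrt(B c)), which
  \<open>glasser_integral\<close> provides for B > 0.\<close>

lemma sum_rem_half:
  assumes w: "w > 0"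
  shows "sum_rem (1/2) w = of_real (\<Sum>y. fourier_term w (Suc y))"
proof -
  define c where "c = 2 * pi * w"
  have c: "c > 0" using w by (simp add: c_def)
  define gc where "gc = powr_exp_inv (- (1/2)) c"
  define gc' where "gc' = (\<lambda>x. - (1/2) * powr_exp_inv (- (1/2) - 1) c x + of_real c * powr_exp_inv (- (1/2) - 2) c x)"
  have emc: "euler_maclaurin gc gc'"
    unfolding gc_def gc'_def by (rule euler_maclaurin_powr_exp_inv) (use c in auto)
  define g where "g = (\<lambda>x. Re (gc x))"
  define g' where "g' = (\<lambda>x. Re (gc' x))"
  have em: "euler_maclaurin g g'" unfolding g_def g'_def by (rule euler_maclaurin_Re[OF emc])
  interpret euler_maclaurin g g' by (fact em)
  have gcr: "gc x = of_real (x powr (-1/2) * exp (- c / x))" if "x \<ge> 0" for x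
    using that powr_of_real[of x "-1/2"] by (simp add: gc_def powr_exp_inv_def)
  have g_eq: "g x = x powr (-1/2) * exp (- c / x)" if "x \<ge> 0" for x
    using gcr[OF that] by (simp add: g_def)
  have gc_g: "gc x = of_real (g x)" if "x \<ge> 0" for x
    using gcr[OF that] by (simp add: g_def)
  have g'cont: "continuous_on {0<..} g'"
    unfolding g'_def gc'_def
    by (intro continuous_intros continuous_on_subset[OF continuous_on_powr_exp_inv[OF c]]) auto
  define R where "R = (\<lambda>B. of_real (sqrt pi) * csqrt B * exp (- 2 * of_real (sqrt c) * csqrt B))"
  have lap: "integral {0<..} (\<lambda>x. exp (- B * x) * g' x) = sqrt pi * sqrt B * exp (- 2 * (sqrt B * sqrt c))"
    if B: "B > 0" for B
  proof -
    have eq: "exp (- B * x) * g x = exp (- B * x) * (x powr (-1/2) * exp (- c / x))" if "x \<in> {0<..}" for x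
      using that g_eq by simp
    have i: "(\<lambda>x. exp (- B * x) * g x) absolutely_integrable_on {0<..}"
      by (rule absolutely_integrable_spike[OF glasser_integral(1)[OF B c], of "{}"]) (use eq in auto)
    have I: "integral {0<..} (\<lambda>x. exp (- B * x) * g x) = sqrt pi / sqrt B * exp (- 2 * (sqrt B * sqrt c))"
      unfolding glasser_integral(2)[OF B c, symmetric] by (rule integral_cong) (rule eq)
    have i': "(\<lambda>x. exp (- B * x) * g' x) absolutely_integrable_on {0<..}"
      by (rule absolutely_integrable_continuous_bounded_mult[OF int, where C = 1])
         (use B in \<open>auto intro!: continuous_intros\<close>)
    have "integral {0<..} (\<lambda>x. exp (- B * x) * g' x) = B * (sqrt pi / sqrt B * exp (- 2 * (sqrt B * sqrt c)))"
      using laplace_derivative[OF B] i i' I by simp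
    also have "\<dots> = sqrt pi * (B / sqrt B) * exp (- 2 * (sqrt B * sqrt c))" by simp
    also have "B / sqrt B = sqrt B" using B by (simp add: real_div_sqrt)
    finally show ?thesis .
  qed
  have R_real: "R (of_real B) = of_real (sqrt pi * sqrt B * exp (- 2 * (sqrt B * sqrt c)))" if "B > 0" for B
  proof -
    have "csqrt (of_real B) = of_real (sqrt B)" using that by (simp add: csqrt_of_real_nonneg)
    thus ?thesis by (simp add: R_def mult_ac flip: exp_of_real)
  qed
  have four: "((\<lambda>x. exp (- B * of_real x) * of_real (g' x)) has_integral R B) {0<..}"
    if "Re B = 0" "B \<noteq> 0" for B
  proof (rule laplace_continuation[OF int g'cont])
    show "R holomorphic_on {B. Re B > 0}"
      unfolding R_def by (intro holomorphic_intros) (auto simp: complex_nonpos_Reals_iff)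
    have "B \<notin> \<real>\<^sub>\<le>\<^sub>0" using that by (auto simp: complex_nonpos_Reals_iff complex_eq_iff)
    thus "isCont R B" unfolding R_def by (intro continuous_intros continuous_at_csqrt)
  qed (use lap R_real that in auto)
  define I where "I = (\<lambda>y. integral {0<..} (\<lambda>x. sin (2 * pi * real (Suc y) * x) * g' x))"
  have IK: "- I y / (pi * real (Suc y)) = fourier_term w (Suc y)" for y
  proof -
    define n where "n = real (Suc y)"
    have n: "n > 0" by (simp add: n_def)
    define B where "B = 2 * of_real pi * \<i> * of_real n"
    have "((\<lambda>x. exp (- B * of_real x) * of_real (g' x)) has_integral R B) {0<..}"
      by (rule four) (use n in \<open>auto simp: B_def\<close>)
    from has_integral_linear[OF this bounded_linear_Im]
    have "((\<lambda>x. Im (exp (- B * of_real x) * of_real (g' x))) has_integral Im (R B)) {0<..}"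
      by (simp only: o_def)
    moreover have "Im (exp (- B * of_real x) * of_real (g' x)) = - (sin (2 * pi * n * x) * g' x)" for x
      by (simp add: Im_exp B_def)
    ultimately have "((\<lambda>x. - (sin (2 * pi * n * x) * g' x)) has_integral Im (R B)) {0<..}"
      by (simp only:)
    from has_integral_neg[OF this] have Iy: "- I y = Im (R B)"
      by (simp add: I_def integral_unique n_def del: of_nat_Suc)
    define \<theta> where "\<theta> = 2 * pi * sqrt (2 * w * n)"
    \<comment> \<open>On the imaginary axis the root has equal real and imaginary parts, so \<theta>
      serves as decay exponent and as phase at once.\<close>
    have csq: "csqrt B = of_real (sqrt (pi * n)) * (1 + \<i>)"
    proof -
      have "of_real (sqrt (pi * n)) ^ 2 = (of_real (pi * n) :: complex)"
      proof -
        have "(sqrt (pi * n))\<^sup>2 = pi * n" using n by simp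
        thus ?thesis by (simp only: of_real_power[symmetric])
      qed
      hence "(of_real (sqrt (pi * n)) * (1 + \<i>))\<^sup>2 = of_real (pi * n) * (1 + \<i>)\<^sup>2"
        by (simp only: power_mult_distrib)
      also have "\<dots> = B"
      proof -
        have "(1 + \<i>)\<^sup>2 = 2 * \<i>" by (simp add: power2_eq_square algebra_simps)
        thus ?thesis by (simp add: B_def)
      qed
      finally have "B = (of_real (sqrt (pi * n)) * (1 + \<i>))\<^sup>2" ..
      moreover have "csqrt ((of_real (sqrt (pi * n)) * (1 + \<i>))\<^sup>2) = of_real (sqrt (pi * n)) * (1 + \<i>)"
        by (rule csqrt_square) (use n in auto)
      ultimately show ?thesis by simp
    qed
    have th: "2 * (sqrt c * sqrt (pi * n)) = \<theta>"
    proof -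
      have "sqrt c * sqrt (pi * n) = sqrt (pi\<^sup>2 * (2 * w * n))"
        by (simp add: c_def real_sqrt_mult[symmetric] power2_eq_square mult_ac)
      also have "\<dots> = pi * sqrt (2 * w * n)" by (simp add: real_sqrt_mult)
      finally show ?thesis by (simp add: \<theta>_def)
    qed
    have "- 2 * of_real (sqrt c) * csqrt B = - of_real (2 * (sqrt c * sqrt (pi * n))) * (1 + \<i>)"
      unfolding csq by simp
    also have "\<dots> = of_real (- \<theta>) + \<i> * of_real (- \<theta>)" unfolding th by (simp add: algebra_simps)
    finally have e: "- 2 * of_real (sqrt c) * csqrt B = of_real (- \<theta>) + \<i> * of_real (- \<theta>)" .
    have "exp (- 2 * of_real (sqrt c) * csqrt B) = of_real (exp (- \<theta>)) * cis (- \<theta>)"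
      unfolding e by (simp only: exp_add cis_conv_exp exp_of_real)
    hence "R B = of_real (sqrt pi * sqrt (pi * n) * exp (- \<theta>)) * ((1 + \<i>) * cis (- \<theta>))"
      by (simp add: R_def csq)
    hence "Im (R B) = sqrt pi * sqrt (pi * n) * exp (- \<theta>) * (cos \<theta> - sin \<theta>)"
      by simp
    also have "sqrt pi * sqrt (pi * n) = pi * sqrt n" by (simp add: real_sqrt_mult)
    \<comment> \<open>This difference is the imaginary part of (1 + i) exp(-i \<theta>) and the
      origin of the pi/4 in the theorem.\<close>
    also have "cos \<theta> - sin \<theta> = sqrt 2 * sin (pi / 4 - \<theta>)"
      by (simp add: sin_diff sin_45 cos_45 algebra_simps)
    finally have "- I y / (pi * n) = (sqrt n / n) * exp (- \<theta>) * (sqrt 2 * sin (pi / 4 - \<theta>))"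
      unfolding Iy using n by (simp add: field_simps)
    also have "sqrt n / n = 1 / sqrt n" using n by (simp add: field_simps)
    finally show ?thesis
      by (simp add: fourier_term_def \<theta>_def n_def del: of_nat_Suc)
  qed
  have summ: "summable (\<lambda>y. \<bar>I y\<bar> / real (Suc y))"
  proof -
    have "\<bar>I y\<bar> / real (Suc y) = pi * \<bar>fourier_term w (Suc y)\<bar>" for y
    proof -
      have "\<bar>fourier_term w (Suc y)\<bar> = \<bar>- I y / (pi * real (Suc y))\<bar>" by (simp only: IK)
      thus ?thesis by (simp add: abs_mult del: of_nat_Suc)
    qed
    thus ?thesis using summable_mult[OF summable_fourier_term[OF w], of pi] by (simp only:)
  qed
  have "(\<lambda>N. (\<Sum>d<N. g (real (Suc d))) - integral {0..real N} g) \<longlonglongrightarrow> (\<Sum>y. - I y / (pi * real (Suc y)))"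
    unfolding I_def by (rule poisson_summation[OF em summ[unfolded I_def]])
  hence lim: "(\<lambda>N. (\<Sum>d<N. g (real (Suc d))) - integral {0..real N} g) \<longlonglongrightarrow> (\<Sum>y. fourier_term w (Suc y))"
    by (simp only: IK)
  have "(\<Sum>d<N. gc (real (Suc d))) - integral {0..real N} gc =
          of_real ((\<Sum>d<N. g (real (Suc d))) - integral {0..real N} g)" for N
  proof -
    have "(g has_integral integral {0..real N} g) {0..real N}"
      by (intro integrable_integral g_integrable) auto
    from has_integral_linear[OF this bounded_linear_of_real]
    have "((\<lambda>x. complex_of_real (g x)) has_integral of_real (integral {0..real N} g)) {0..real N}"
      by (simp add: o_def)
    hence "(gc has_integral of_real (integral {0..real N} g)) {0..real N}"
      by (rule has_integral_eq[rotated]) (use gc_g in auto)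
    hence "integral {0..real N} gc = of_real (integral {0..real N} g)" by (rule integral_unique)
    moreover have "gc (real (Suc d)) = of_real (g (real (Suc d)))" for d by (rule gc_g) simp
    ultimately show ?thesis by (simp only: of_real_diff of_real_sum)
  qed
  moreover have "(\<lambda>N. (\<Sum>d<N. gc (real (Suc d))) - integral {0..real N} gc) \<longlonglongrightarrow> sum_rem (1/2) w"
    unfolding gc_def c_def by (rule sum_rem_limit) (use w in auto)
  ultimately have "(\<lambda>N. complex_of_real ((\<Sum>d<N. g (real (Suc d))) - integral {0..real N} g)) \<longlonglongrightarrow> sum_rem (1/2) w"
    by (simp only:)
  moreover have "(\<lambda>N. complex_of_real ((\<Sum>d<N. g (real (Suc d))) - integral {0..real N} g)) \<longlonglongrightarrow>
      of_real (\<Sum>y. fourier_term w (Suc y))"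
    by (intro tendsto_of_real lim)
  ultimately show ?thesis by (rule LIMSEQ_unique)
qed

section \<open>Continuation in the exponent\<close>

lemma summable_on_product:
  fixes f :: "nat \<Rightarrow> nat \<Rightarrow> 'a::banach"
  assumes 1: "\<And>d. summable (\<lambda>k. norm (f d k))"
    and 2: "summable (\<lambda>d. \<Sum>k. norm (f d k))"
  shows "(\<lambda>p. norm (f (fst p) (snd p))) summable_on UNIV \<times> UNIV"
proof (rule summable_on_SigmaI)
  show "((\<lambda>k. norm (f (fst (d, k)) (snd (d, k)))) has_sum (\<Sum>k. norm (f d k))) UNIV" for d
    using norm_summable_imp_has_sum[of "\<lambda>k. norm (f d k)"] 1[of d] by (simp add: summable_sums)
  show "(\<lambda>d. \<Sum>k. norm (f d k)) summable_on UNIV"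
    using 2 1 by (intro summable_nonneg_imp_summable_on suminf_nonneg) auto
qed auto

lemma has_sum_product_iterated:
  fixes f :: "nat \<Rightarrow> nat \<Rightarrow> 'a::banach"
  assumes "((\<lambda>(d, k). f d k) has_sum S) (UNIV \<times> UNIV)"
  shows "(\<lambda>d. \<Sum>k. f d k) sums S" and "(\<lambda>k. \<Sum>d. f d k) sums S"
proof -
  have main: "(\<lambda>d. \<Sum>k. h d k) sums S" if h: "((\<lambda>(d, k). h d k) has_sum S) (UNIV \<times> UNIV)"
    for h :: "nat \<Rightarrow> nat \<Rightarrow> 'a"
  proof -
    have sm: "(\<lambda>(d, k). h d k) summable_on UNIV \<times> UNIV" using h by (auto simp: summable_on_def)
    have 1: "h d summable_on UNIV" for d
    proof -
      have "(\<lambda>(d, k). h d k) summable_on (Pair d ` UNIV)"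
        using sm by (rule summable_on_subset_banach) auto
      hence "((\<lambda>(d, k). h d k) \<circ> Pair d) summable_on UNIV"
        by (subst (asm) summable_on_reindex) (auto simp: inj_on_def)
      thus ?thesis by (simp add: o_def)
    qed
    have 2: "(\<lambda>d. infsum (h d) UNIV) summable_on UNIV" by (rule summable_on_Sigma_banach[OF sm])
    have "infsum (\<lambda>d. infsum (h d) UNIV) UNIV = S"
      using infsum_Sigma'_banach[OF sm] infsumI[OF h] by simp
    with 2 have "((\<lambda>d. infsum (h d) UNIV) has_sum S) UNIV"
      by (metis has_sum_infsum)
    moreover have "infsum (h d) UNIV = (\<Sum>k. h d k)" for d
      using has_sum_imp_sums[OF has_sum_infsum[OF 1[of d]]] by (simp add: sums_iff)
    ultimately show ?thesis by (simp add: has_sum_imp_sums)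
  qed
  show "(\<lambda>d. \<Sum>k. f d k) sums S" by (rule main[OF assms])
  have "((\<lambda>(k, d). f d k) has_sum S) (UNIV \<times> UNIV) \<longleftrightarrow> ((\<lambda>(d, k). f d k) has_sum S) (UNIV \<times> UNIV)"
    by (rule has_sum_reindex_bij_witness[where i = prod.swap and j = prod.swap]) auto
  with assms show "(\<lambda>k. \<Sum>d. f d k) sums S"
    using main[of "\<lambda>k d. f d k"] by simp
qed

lemma suminf_swap_nonneg:
  fixes f :: "nat \<Rightarrow> nat \<Rightarrow> real"
  assumes 0: "\<And>d k. f d k \<ge> 0" and 1: "\<And>d. summable (\<lambda>k. f d k)" and 2: "summable (\<lambda>d. \<Sum>k. f d k)"
  shows "(\<lambda>k. \<Sum>d. f d k) sums (\<Sum>d. \<Sum>k. f d k)"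
proof -
  have "(\<lambda>p. norm (f (fst p) (snd p))) summable_on UNIV \<times> UNIV"
    by (rule summable_on_product) (use assms in auto)
  hence "(\<lambda>(d, k). f d k) summable_on UNIV \<times> UNIV"
    using 0 by (simp add: case_prod_unfold)
  then obtain S where S: "((\<lambda>(d, k). f d k) has_sum S) (UNIV \<times> UNIV)" by (auto simp: summable_on_def)
  from has_sum_product_iterated[OF S] show ?thesis by (simp add: sums_iff)
qed

definition lipschitz_rem_const :: "real \<Rightarrow> real" where
  "lipschitz_rem_const a = Gamma a * (2 * pi) powr (- a) * (\<Sum>n. 2 * a * real (Suc n) powr (- a - 1))"

text \<open>The termwise bounds are linear in z, hence so is that of the sum. With z = \<beta> / d
  this gains a factor 1/d, which makes the series over d converge for all Re b > 0. Nonnegativity of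
  the constant is needed to enlarge the bounds later.\<close>

lemma norm_lipschitz_rem_le:
  assumes a: "0 < a" "a < 1" and z: "z > 0"
  shows "norm (lipschitz_rem (of_real a) z) \<le> lipschitz_rem_const a * z" "lipschitz_rem_const a \<ge> 0"
proof -
  have sm: "summable (\<lambda>n. 2 * a * real (Suc n) powr (- a - 1))"
    by (intro summable_mult summable_nat_powr_real) (use a in auto)
  have G: "Gamma a > 0" by (rule Gamma_real_pos[OF a(1)])
  show "lipschitz_rem_const a \<ge> 0"
    unfolding lipschitz_rem_const_def using a G by (intro mult_nonneg_nonneg suminf_nonneg sm) auto
  have le: "norm (lipschitz_term (of_real a) (of_real z) (Suc n)) \<le> 2 * a * real (Suc n) powr (- a - 1) * z" for n
    using norm_lipschitz_term_real_le[of "Suc n" z "of_real a"] a z by (simp del: of_nat_Suc)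
  have "norm (\<Sum>n. lipschitz_term (of_real a) (of_real z) (Suc n)) \<le> (\<Sum>n. 2 * a * real (Suc n) powr (- a - 1) * z)"
    by (rule summable_norm[THEN order_trans]) (use a z in \<open>auto intro!: summable_lipschitz_term suminf_le le summable_mult2 sm simp del: of_nat_Suc\<close>)
  also have "\<dots> = (\<Sum>n. 2 * a * real (Suc n) powr (- a - 1)) * z"
    by (rule suminf_mult2[OF sm, symmetric])
  finally have B: "norm (\<Sum>n. lipschitz_term (of_real a) (of_real z) (Suc n)) \<le> (\<Sum>n. 2 * a * real (Suc n) powr (- a - 1)) * z" .
  have "(2 * pi) powr a * norm (lipschitz_rem (of_real a) z) = norm (of_real (2 * pi) powr of_real a * lipschitz_rem (of_real a) z)"
    using norm_powr_of_real[of "2 * pi" "of_real a"] by (simp add: norm_mult)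
  also have "\<dots> = Gamma a * norm (\<Sum>n. lipschitz_term (of_real a) (of_real z) (Suc n))"
    unfolding lipschitz_regularized[OF a z] using G by (simp add: norm_mult Gamma_complex_of_real)
  also have "\<dots> \<le> Gamma a * ((\<Sum>n. 2 * a * real (Suc n) powr (- a - 1)) * z)"
    using B G by (intro mult_left_mono) auto
  finally have "(2 * pi) powr a * norm (lipschitz_rem (of_real a) z) \<le> Gamma a * ((\<Sum>n. 2 * a * real (Suc n) powr (- a - 1)) * z)" .
  hence "(2 * pi) powr (- a) * ((2 * pi) powr a * norm (lipschitz_rem (of_real a) z)) \<le>
      (2 * pi) powr (- a) * (Gamma a * ((\<Sum>n. 2 * a * real (Suc n) powr (- a - 1)) * z))"
    by (intro mult_left_mono) auto
  moreover have "(2 * pi) powr (- a) * ((2 * pi) powr a * norm (lipschitz_rem (of_real a) z)) = norm (lipschitz_rem (of_real a) z)"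
    by (simp add: powr_minus)
  moreover have "(2 * pi) powr (- a) * (Gamma a * ((\<Sum>n. 2 * a * real (Suc n) powr (- a - 1)) * z)) = lipschitz_rem_const a * z"
    unfolding lipschitz_rem_const_def by (simp only: mult_ac)
  ultimately show "norm (lipschitz_rem (of_real a) z) \<le> lipschitz_rem_const a * z" by linarith
qed

lemma holomorphic_sum_rem:
  assumes w: "w > 0"
  shows "(\<lambda>b. sum_rem b w) holomorphic_on {b. Re b > 0} - {1}"
proof -
  have S: "open ({b. Re b > 0} - {1 :: complex})"
    by (intro open_Diff open_halfspace_Re_gt) auto
  have "(\<lambda>b. \<Sum>d. sum_rem_term b w (Suc d)) holomorphic_on {b. Re b > 0} - {1}"
  proof (rule holomorphic_on_suminf[OF S])
    show "(\<lambda>b. sum_rem_term b w (Suc d)) holomorphic_on {b. Re b > 0} - {1}" for d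
      unfolding sum_rem_term_def by (intro holomorphic_intros) (auto simp del: of_nat_Suc)
    fix z :: complex assume "z \<in> {b. Re b > 0} - {1}"
    hence z: "Re z > 0" by simp
    define \<delta> where "\<delta> = Re z / 2"
    show "\<exists>\<delta>>0. \<exists>M. summable M \<and> (\<forall>\<^sub>F d in sequentially. \<forall>b\<in>ball z \<delta> \<inter> ({b. Re b > 0} - {1}).
             norm (sum_rem_term b w (Suc d)) \<le> M d)"
    proof (intro exI conjI always_eventually allI ballI)
      show "\<delta> > 0" using z by (simp add: \<delta>_def)
      show "summable (\<lambda>d. 2 * pi * w * real (Suc d) powr (- \<delta> - 1))"
        by (intro summable_mult summable_nat_powr_real) (use z in \<open>auto simp: \<delta>_def\<close>)
      fix d b assume b: "b \<in> ball z \<delta> \<inter> ({b. Re b > 0} - {1})"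
      have "\<bar>Re b - Re z\<bar> \<le> \<delta>" using ball_complex_bounds(1)[of b z \<delta>] b by auto
      hence "Re b \<ge> \<delta>" unfolding \<delta>_def by linarith
      hence "real (Suc d) powr (- Re b - 1) \<le> real (Suc d) powr (- \<delta> - 1)"
        by (intro powr_mono) auto
      hence "2 * pi * w * real (Suc d) powr (- Re b - 1) \<le> 2 * pi * w * real (Suc d) powr (- \<delta> - 1)"
        using w by (intro mult_left_mono) auto
      thus "norm (sum_rem_term b w (Suc d)) \<le> 2 * pi * w * real (Suc d) powr (- \<delta> - 1)"
        using norm_sum_rem_term_le[of w "Suc d" b] w by linarith
    qed
  qed
  moreover have "(\<lambda>b. Gamma (b - 1)) holomorphic_on {b. Re b > 0} - {1}"
    by (intro holomorphic_intros) (auto simp: minus_one_notin_nonpos_Ints)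
  ultimately show ?thesis
    unfolding sum_rem_def[abs_def] using w
    by (intro holomorphic_intros holomorphic_zeta_right) (auto simp: minus_one_notin_nonpos_Ints)
qed

text \<open>The condition a < 1/2 places b = 1/2 in the half plane Re b > a, where the exchanged
  double series is still controlled.\<close>

locale exponent_continuation =
  fixes a \<beta> :: real
  assumes a: "0 < a" "a < 1/2" and \<beta>: "\<beta> > 0"
begin

abbreviation "A \<equiv> complex_of_real a"

text \<open>The point 1 is a pole of zeta(b) and of Gamma(b-1), the point 1 + a is the pole of
  zeta(b-a). Removing them leaves the half plane connected.\<close>

definition D :: "complex set" where "D = {b. Re b > a} - {1, 1 + A}"

text \<open>The double series of d^(-b) k^(a-1) exp(-2 pi k \<beta> / d), summed over k first and
  continued in b. The last two terms restore what \<open>lipschitz_rem\<close> has subtracted from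
  the k-sum, already summed over d.\<close>

definition \<Phi> :: "complex \<Rightarrow> complex" where
  "\<Phi> b = (\<Sum>d. of_nat (Suc d) powr (- b) * lipschitz_rem A (\<beta> / real (Suc d))) + zeta_right b * zeta_right (1 - A)
     + Gamma A * of_real (2 * pi * \<beta>) powr (- A) * zeta_right (b - A)"

text \<open>The same double series, summed over d first. The last term restores the integral
  Gamma(b-1) (2 pi \<beta> k)^(1-b) that \<open>sum_rem\<close> has subtracted; against k^(a-1) its
  sum over k is zeta(b-a).\<close>

definition \<Psi> :: "complex \<Rightarrow> complex" where
  "\<Psi> b = (\<Sum>k. of_nat (Suc k) powr (A - 1) * sum_rem b (\<beta> * real (Suc k)))
     + Gamma (b - 1) * of_real (2 * pi * \<beta>) powr (1 - b) * zeta_right (b - A)"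

lemma open_D: "open D"
  unfolding D_def by (intro open_Diff open_halfspace_Re_gt) auto

lemma connected_D: "connected D"
  unfolding D_def
  by (rule connected_open_diff_countable)
     (auto intro!: convex_connected convex_halfspace_Re_gt open_halfspace_Re_gt)

lemma zeta_right_shift_holomorphic: "(\<lambda>b. zeta_right (b - A)) holomorphic_on D"
proof -
  have h: "(\<lambda>b. b - A) holomorphic_on D" by (intro holomorphic_intros)
  have "(\<lambda>b. b - A) ` D \<subseteq> {s. Re s > 0} - {1}" by (auto simp: D_def algebra_simps)
  from holomorphic_on_compose_gen[OF h holomorphic_zeta_right this] show ?thesis by (simp add: o_def)
qed

lemma zeta_right_holomorphic_D: "zeta_right holomorphic_on D"
  by (rule holomorphic_on_subset[OF holomorphic_zeta_right]) (use a in \<open>auto simp: D_def\<close>)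

lemma Gamma_holomorphic_D: "(\<lambda>b. Gamma (b - 1)) holomorphic_on D"
  by (intro holomorphic_intros) (use a in \<open>auto simp: D_def minus_one_notin_nonpos_Ints\<close>)

lemma lipschitz_rem_term_le:
  "norm (of_nat (Suc d) powr (- b) * lipschitz_rem A (\<beta> / real (Suc d))) \<le> lipschitz_rem_const a * \<beta> * real (Suc d) powr (- Re b - 1)"
proof -
  have "norm (of_nat (Suc d) powr (- b) * lipschitz_rem A (\<beta> / real (Suc d))) \<le>
          real (Suc d) powr (- Re b) * (lipschitz_rem_const a * (\<beta> / real (Suc d)))"
    unfolding norm_mult norm_powr_nat[OF zero_less_Suc]
    using norm_lipschitz_rem_le[of a "\<beta> / real (Suc d)"] a \<beta> by (intro mult_mono) (auto simp del: of_nat_Suc)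
  also have "\<dots> = lipschitz_rem_const a * \<beta> * real (Suc d) powr (- Re b - 1)"
    by (simp add: powr_diff del: of_nat_Suc)
  finally show ?thesis .
qed

lemma holomorphic_\<Phi>: "\<Phi> holomorphic_on D"
proof -
  have "(\<lambda>b. \<Sum>d. of_nat (Suc d) powr (- b) * lipschitz_rem A (\<beta> / real (Suc d))) holomorphic_on D"
  proof (rule holomorphic_on_suminf[OF open_D])
    show "(\<lambda>b. of_nat (Suc d) powr (- b) * lipschitz_rem A (\<beta> / real (Suc d))) holomorphic_on D" for d
      by (intro holomorphic_intros) (auto simp del: of_nat_Suc)
    fix z assume "z \<in> D"
    hence z: "Re z > 0" using a by (auto simp: D_def)
    define \<delta> where "\<delta> = Re z / 2"
    show "\<exists>\<delta>>0. \<exists>M. summable M \<and> (\<forall>\<^sub>F d in sequentially. \<forall>b\<in>ball z \<delta> \<inter> D.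
             norm (of_nat (Suc d) powr (- b) * lipschitz_rem A (\<beta> / real (Suc d))) \<le> M d)"
    proof (intro exI conjI always_eventually allI ballI)
      show "\<delta> > 0" using z by (simp add: \<delta>_def)
      show "summable (\<lambda>d. lipschitz_rem_const a * \<beta> * real (Suc d) powr (- \<delta> - 1))"
        by (intro summable_mult summable_nat_powr_real) (use z in \<open>auto simp: \<delta>_def\<close>)
      fix d b assume b: "b \<in> ball z \<delta> \<inter> D"
      have "\<bar>Re b - Re z\<bar> \<le> \<delta>" using ball_complex_bounds(1)[of b z \<delta>] b by auto
      hence "Re b \<ge> \<delta>" unfolding \<delta>_def by linarith
      hence "real (Suc d) powr (- Re b - 1) \<le> real (Suc d) powr (- \<delta> - 1)"
        by (intro powr_mono) auto
      hence "lipschitz_rem_const a * \<beta> * real (Suc d) powr (- Re b - 1) \<le> lipschitz_rem_const a * \<beta> * real (Suc d) powr (- \<delta> - 1)"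
        using \<beta> norm_lipschitz_rem_le(2)[of a 1] a by (intro mult_left_mono) auto
      thus "norm (of_nat (Suc d) powr (- b) * lipschitz_rem A (\<beta> / real (Suc d))) \<le> lipschitz_rem_const a * \<beta> * real (Suc d) powr (- \<delta> - 1)"
        using lipschitz_rem_term_le[of d b] by linarith
    qed
  qed
  thus ?thesis
    unfolding \<Phi>_def[abs_def]
    by (intro holomorphic_intros zeta_right_holomorphic_D zeta_right_shift_holomorphic)
qed

definition sum_rem_const :: "complex \<Rightarrow> real" where
  "sum_rem_const b = (norm b * Gamma (Re b) + Gamma (Re b + 1)) * (2 * pi * \<beta>) powr (- Re b)"

lemma sum_rem_summand_le:
  assumes "b \<in> D"
  shows "norm (of_nat (Suc k) powr (A - 1) * sum_rem b (\<beta> * real (Suc k))) \<le> sum_rem_const b * real (Suc k) powr (a - 1 - Re b)"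
proof -
  have b: "Re b > 0" "b \<noteq> 1" using assms a by (auto simp: D_def)
  have "norm (sum_rem b (\<beta> * real (Suc k))) \<le>
      (norm b * Gamma (Re b) + Gamma (Re b + 1)) * (2 * pi * (\<beta> * real (Suc k))) powr (- Re b)"
    by (rule norm_sum_rem_le) (use b \<beta> in auto)
  also have "(2 * pi * (\<beta> * real (Suc k))) powr (- Re b) = (2 * pi * \<beta>) powr (- Re b) * real (Suc k) powr (- Re b)"
    using \<beta> powr_mult[of "2 * pi * \<beta>" "real (Suc k)" "- Re b"] by (simp add: mult.assoc)
  finally have "norm (sum_rem b (\<beta> * real (Suc k))) \<le> sum_rem_const b * real (Suc k) powr (- Re b)"
    by (simp add: sum_rem_const_def mult.assoc)
  hence "real (Suc k) powr (a - 1) * norm (sum_rem b (\<beta> * real (Suc k))) \<le> real (Suc k) powr (a - 1) * (sum_rem_const b * real (Suc k) powr (- Re b))"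
    by (intro mult_left_mono) auto
  also have "\<dots> = sum_rem_const b * (real (Suc k) powr (a - 1) * real (Suc k) powr (- Re b))" by simp
  also have "real (Suc k) powr (a - 1) * real (Suc k) powr (- Re b) = real (Suc k) powr (a - 1 - Re b)"
    by (simp add: powr_add[symmetric] del: of_nat_Suc)
  finally show ?thesis by (simp add: norm_mult norm_powr_nat del: of_nat_Suc)
qed

lemma continuous_sum_rem_const: "continuous_on {b. Re b > 0} sum_rem_const"
proof -
  have G: "continuous_on {0<..} (Gamma :: real \<Rightarrow> real)"
    by (intro continuous_on_Gamma) (auto elim!: nonpos_Ints_cases)
  have "continuous_on {b. Re b > 0} (\<lambda>b. Gamma (Re b))"
    by (rule continuous_on_compose2[OF G]) (auto intro!: continuous_intros)
  moreover have "continuous_on {b. Re b > 0} (\<lambda>b. Gamma (Re b + 1))"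
    by (rule continuous_on_compose2[OF G]) (auto intro!: continuous_intros)
  ultimately show ?thesis unfolding sum_rem_const_def[abs_def] using \<beta> by (intro continuous_intros) auto
qed

text \<open>The exponent a - 1 - Re b is below -1 exactly for Re b > a; this fixes the half plane in
  \<open>D\<close>. The constant depends on b through Gamma values and is bounded on a closed ball
  by continuity.\<close>

lemma sum_rem_local_bound:
  assumes "z \<in> D"
  shows "\<exists>d>0. \<exists>M. summable M \<and> (\<forall>\<^sub>F k in sequentially. \<forall>b\<in>ball z d \<inter> D.
             norm (of_nat (Suc k) powr (A - 1) * sum_rem b (\<beta> * real (Suc k))) \<le> M k)"
proof -
  have z: "Re z > a" using assms by (auto simp: D_def)
  define \<delta> where "\<delta> = (Re z - a) / 2"
  have \<delta>: "\<delta> > 0" using z by (simp add: \<delta>_def)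
  have Re_ge: "Re b \<ge> a + \<delta>" if "b \<in> cball z \<delta>" for b
  proof -
    have "\<bar>Re b - Re z\<bar> \<le> norm (b - z)" using abs_Re_le_cmod[of "b - z"] by simp
    also have "\<dots> \<le> \<delta>" using that by (simp add: dist_norm norm_minus_commute)
    finally have "\<bar>Re b - Re z\<bar> \<le> (Re z - a) / 2" by (simp add: \<delta>_def)
    moreover have "Re z - Re b \<le> \<bar>Re b - Re z\<bar>" by simp
    ultimately have "Re z - Re b \<le> (Re z - a) / 2" by linarith
    thus ?thesis by (simp add: \<delta>_def field_simps)
  qed
  have "compact (sum_rem_const ` cball z \<delta>)"
    by (intro compact_continuous_image continuous_on_subset[OF continuous_sum_rem_const])
       (use Re_ge \<delta> a in force)+
  hence "bounded (sum_rem_const ` cball z \<delta>)" by (rule compact_imp_bounded)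
  then obtain C where "\<forall>x\<in>sum_rem_const ` cball z \<delta>. norm x \<le> C" unfolding bounded_iff by blast
  hence C: "\<And>b. b \<in> cball z \<delta> \<Longrightarrow> \<bar>sum_rem_const b\<bar> \<le> C" by auto
  show ?thesis
  proof (intro exI conjI always_eventually allI ballI)
    show "\<delta> > 0" by fact
    show "summable (\<lambda>k. C * real (Suc k) powr (- 1 - \<delta>))"
      by (intro summable_mult summable_nat_powr_real) (use \<delta> in auto)
    fix k b assume b: "b \<in> ball z \<delta> \<inter> D"
    hence bc: "b \<in> cball z \<delta>" by auto
    have "norm (of_nat (Suc k) powr (A - 1) * sum_rem b (\<beta> * real (Suc k))) \<le> sum_rem_const b * real (Suc k) powr (a - 1 - Re b)"
      using b by (intro sum_rem_summand_le) auto
    also have "\<dots> \<le> C * real (Suc k) powr (- 1 - \<delta>)"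
      using C[OF bc] Re_ge[OF bc] by (intro mult_mono powr_mono) auto
    finally show "norm (of_nat (Suc k) powr (A - 1) * sum_rem b (\<beta> * real (Suc k))) \<le> C * real (Suc k) powr (- 1 - \<delta>)" .
  qed
qed

lemma sum_rem_summand_holomorphic: "(\<lambda>b. of_nat (Suc k) powr (A - 1) * sum_rem b (\<beta> * real (Suc k))) holomorphic_on D"
proof -
  have "(\<lambda>b. sum_rem b (\<beta> * real (Suc k))) holomorphic_on D"
    by (rule holomorphic_on_subset[OF holomorphic_sum_rem]) (use a \<beta> in \<open>auto simp: D_def\<close>)
  thus ?thesis by (intro holomorphic_intros)
qed

lemma holomorphic_\<Psi>: "\<Psi> holomorphic_on D"
proof -
  have "(\<lambda>b. \<Sum>k. of_nat (Suc k) powr (A - 1) * sum_rem b (\<beta> * real (Suc k))) holomorphic_on D"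
    by (rule holomorphic_on_suminf[OF open_D sum_rem_summand_holomorphic sum_rem_local_bound])
  thus ?thesis
    unfolding \<Psi>_def[abs_def] using \<beta>
    by (intro holomorphic_intros Gamma_holomorphic_D zeta_right_shift_holomorphic) auto
qed

text \<open>For real b = x > 2 all summands \<open>T d k\<close> are nonnegative and every zeta
  value is given by its series, as x - a > 1. The exchange of sums is then Tonelli's
  theorem.\<close>

lemma \<Phi>_eq_\<Psi>_real:
  assumes x: "2 < x" "x < 3"
  shows "\<Phi> (of_real x) = \<Psi> (of_real x)"
proof -
  let ?x = "complex_of_real x"
  define T where "T = (\<lambda>d k. real (Suc d) powr (- x) * (real (Suc k) powr (a - 1) * exp (- 2 * pi * \<beta> * real (Suc k) / real (Suc d))))"
  have T0: "T d k \<ge> 0" for d k by (simp add: T_def)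
  have rp: "of_nat (Suc n) powr complex_of_real y = of_real (real (Suc n) powr y)" for n y
    using powr_of_real[of "real (Suc n)" y] by simp
  have rp': "of_nat (Suc n) powr (- ?x) = of_real (real (Suc n) powr (- x))" for n
    using rp[of n "-x"] by simp
  have rpA: "of_nat (Suc n) powr (A - 1) = of_real (real (Suc n) powr (a - 1))" for n
    using rp[of n "a-1"] by simp
  have b: "Re ?x > 0" "?x \<noteq> 1" "Re (?x - A) > 1" "Re ?x > 1" using x a by auto
  have z1: "(\<lambda>n. of_nat (Suc n) powr (- ?x)) sums zeta_right ?x" by (rule zeta_right_sums) (use b in auto)
  have z2: "(\<lambda>n. of_nat (Suc n) powr (- (?x - A))) sums zeta_right (?x - A)" by (rule zeta_right_sums) (use b in auto)
  have row: "(\<lambda>k. complex_of_real (T d k)) sums (of_nat (Suc d) powr (- ?x) * lipschitz_sum A (\<beta> / real (Suc d)))" for d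
  proof -
    have "summable (\<lambda>k. of_nat (Suc k) powr (A - 1) * complex_of_real (exp (- 2 * pi * (\<beta> / real (Suc d)) * real (Suc k))))"
      by (rule summable_norm_cancel, rule summable_lipschitz_sum) (use \<beta> in auto)
    from sums_mult[OF summable_sums[OF this], of "of_nat (Suc d) powr (- ?x)"]
    have "(\<lambda>k. of_nat (Suc d) powr (- ?x) * (of_nat (Suc k) powr (A - 1) * complex_of_real (exp (- 2 * pi * (\<beta> / real (Suc d)) * real (Suc k)))))
       sums (of_nat (Suc d) powr (- ?x) * lipschitz_sum A (\<beta> / real (Suc d)))"
      by (simp only: lipschitz_sum_def)
    moreover have "of_nat (Suc d) powr (- ?x) * (of_nat (Suc k) powr (A - 1) * complex_of_real (exp (- 2 * pi * (\<beta> / real (Suc d)) * real (Suc k))))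
        = of_real (T d k)" for k
      unfolding T_def rp' rpA by (simp del: of_nat_Suc)
    ultimately show ?thesis by (simp only:)
  qed
  have rowsum: "complex_of_real (\<Sum>k. T d k) = of_nat (Suc d) powr (- ?x) * lipschitz_sum A (\<beta> / real (Suc d))"
    and rowsm: "summable (T d)" for d
  proof -
    have "summable (\<lambda>k. complex_of_real (T d k))" using row by (rule sums_summable)
    thus s: "summable (T d)" by (simp only: summable_complex_of_real)
    have "(\<lambda>k. complex_of_real (T d k)) sums of_real (\<Sum>k. T d k)"
      by (intro sums_of_real summable_sums s)
    thus "complex_of_real (\<Sum>k. T d k) = of_nat (Suc d) powr (- ?x) * lipschitz_sum A (\<beta> / real (Suc d))"
      using row by (rule sums_unique2)
  qed
  have split: "of_nat (Suc d) powr (- ?x) * lipschitz_sum A (\<beta> / real (Suc d)) =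
     of_nat (Suc d) powr (- ?x) * lipschitz_rem A (\<beta> / real (Suc d)) + of_nat (Suc d) powr (- ?x) * zeta_right (1 - A)
     + Gamma A * of_real (2 * pi * \<beta>) powr (- A) * of_nat (Suc d) powr (- (?x - A))" for d
  proof -
    have "of_real (2 * pi * (\<beta> / real (Suc d))) powr (- A) =
            complex_of_real (((2 * pi * \<beta>) / real (Suc d)) powr (- a))"
      using \<beta> powr_of_real[of "2 * pi * (\<beta> / real (Suc d))" "-a"] by simp
    also have "((2 * pi * \<beta>) / real (Suc d)) powr (- a) = (2 * pi * \<beta>) powr (- a) * real (Suc d) powr a"
      using \<beta> by (subst powr_divide) (auto simp: powr_minus_divide)
    finally have "of_real (2 * pi * (\<beta> / real (Suc d))) powr (- A) =
        of_real (2 * pi * \<beta>) powr (- A) * of_nat (Suc d) powr A"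
      using \<beta> powr_of_real[of "2 * pi * \<beta>" "-a"] rp[of d a] by simp
    hence "of_nat (Suc d) powr (- ?x) * of_real (2 * pi * (\<beta> / real (Suc d))) powr (- A) =
        of_real (2 * pi * \<beta>) powr (- A) * (of_nat (Suc d) powr (- ?x) * of_nat (Suc d) powr A)"
      by (simp only: mult_ac)
    also have "of_nat (Suc d) powr (- ?x) * of_nat (Suc d) powr A = of_nat (Suc d) powr (- (?x - A))"
      by (subst powr_add[symmetric]) simp
    finally show ?thesis by (simp add: lipschitz_rem_def algebra_simps del: of_nat_Suc)
  qed
  have Fsum: "summable (\<lambda>d. of_nat (Suc d) powr (- ?x) * lipschitz_rem A (\<beta> / real (Suc d)))"
  proof (rule summable_comparison_test')
    show "summable (\<lambda>d. lipschitz_rem_const a * \<beta> * real (Suc d) powr (- x - 1))"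
      by (intro summable_mult summable_nat_powr_real) (use x in auto)
    show "norm (of_nat (Suc d) powr (- ?x) * lipschitz_rem A (\<beta> / real (Suc d))) \<le> lipschitz_rem_const a * \<beta> * real (Suc d) powr (- x - 1)" for d
      using lipschitz_rem_term_le[of d ?x] by simp
  qed
  have "(\<lambda>d. of_nat (Suc d) powr (- ?x) * lipschitz_sum A (\<beta> / real (Suc d))) sums \<Phi> ?x"
    unfolding split \<Phi>_def by (intro sums_add summable_sums Fsum sums_mult2 z1 sums_mult z2)
  hence \<Phi>: "(\<lambda>d. complex_of_real (\<Sum>k. T d k)) sums \<Phi> ?x" unfolding rowsum .
  \<comment> \<open>Summability of the row sums comes for free: they have just been shown to sum to
    \<Phi>.\<close>
  have Tsm: "summable (\<lambda>d. \<Sum>k. T d k)"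
    using sums_summable[OF \<Phi>] by (simp only: summable_complex_of_real)
  have \<Phi>': "\<Phi> ?x = of_real (\<Sum>d. \<Sum>k. T d k)"
    by (rule sums_unique2[OF \<Phi>]) (intro sums_of_real summable_sums Tsm)
  have swap: "(\<lambda>k. \<Sum>d. T d k) sums (\<Sum>d. \<Sum>k. T d k)"
    by (rule suminf_swap_nonneg[OF T0 rowsm Tsm])
  have col: "complex_of_real (\<Sum>d. T d k) = of_nat (Suc k) powr (A - 1) * sum_rem ?x (\<beta> * real (Suc k)) +
      Gamma (?x - 1) * of_real (2 * pi * \<beta>) powr (1 - ?x) * of_nat (Suc k) powr (- (?x - A))" for k
  proof -
    define w where "w = \<beta> * real (Suc k)"
    have w: "w > 0" using \<beta> by (simp add: w_def)
    have "(\<lambda>d. of_nat (Suc d) powr (- ?x) + sum_rem_term ?x w (Suc d)) sums (zeta_right ?x + (\<Sum>d. sum_rem_term ?x w (Suc d)))"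
      by (intro sums_add z1 summable_sums summable_norm_cancel[OF summable_sum_rem_term] w b)
    moreover have "of_nat (Suc d) powr (- ?x) + sum_rem_term ?x w (Suc d) =
        of_real (real (Suc d) powr (- x) * exp (- 2 * pi * \<beta> * real (Suc k) / real (Suc d)))" for d
      unfolding sum_rem_term_def rp' w_def by (simp add: algebra_simps)
    ultimately have "(\<lambda>d. complex_of_real (real (Suc d) powr (- x) * exp (- 2 * pi * \<beta> * real (Suc k) / real (Suc d)))) sums
        (sum_rem ?x w + Gamma (?x - 1) * of_real (2 * pi * w) powr (1 - ?x))"
      by (simp only: sum_rem_def diff_add_cancel)
    from sums_mult[OF this, of "of_nat (Suc k) powr (A - 1)"]
    have s: "(\<lambda>d. complex_of_real (T d k)) sums
        (of_nat (Suc k) powr (A - 1) * (sum_rem ?x w + Gamma (?x - 1) * of_real (2 * pi * w) powr (1 - ?x)))"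
      unfolding T_def rpA by (simp add: mult_ac)
    hence sm: "summable (\<lambda>d. T d k)"
      using sums_summable by (metis (no_types) summable_complex_of_real)
    have "(\<lambda>d. complex_of_real (T d k)) sums of_real (\<Sum>d. T d k)"
      by (intro sums_of_real summable_sums sm)
    hence "complex_of_real (\<Sum>d. T d k) =
        of_nat (Suc k) powr (A - 1) * (sum_rem ?x w + Gamma (?x - 1) * of_real (2 * pi * w) powr (1 - ?x))"
      using s by (rule sums_unique2)
    moreover have "of_nat (Suc k) powr (A - 1) * of_real (2 * pi * w) powr (1 - ?x) =
        of_real (2 * pi * \<beta>) powr (1 - ?x) * of_nat (Suc k) powr (- (?x - A))"
    proof -
      have "complex_of_real (2 * pi * w) = of_real (2 * pi * \<beta>) * of_nat (Suc k)"
        by (simp add: w_def)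
      hence "of_real (2 * pi * w) powr (1 - ?x) = of_real (2 * pi * \<beta>) powr (1 - ?x) * of_nat (Suc k) powr (1 - ?x)"
        using \<beta> by (simp only:) (rule powr_times_real, auto)
      hence "of_nat (Suc k) powr (A - 1) * of_real (2 * pi * w) powr (1 - ?x) =
         of_real (2 * pi * \<beta>) powr (1 - ?x) * (of_nat (Suc k) powr (A - 1) * of_nat (Suc k) powr (1 - ?x))"
        by (simp only: mult_ac)
      also have "of_nat (Suc k) powr (A - 1) * of_nat (Suc k) powr (1 - ?x) = of_nat (Suc k) powr (- (?x - A))"
        by (subst powr_add[symmetric]) simp
      finally show ?thesis .
    qed
    ultimately show ?thesis by (simp add: w_def algebra_simps del: of_nat_Suc)
  qed
  have xD: "?x \<in> D" using x a by (auto simp: D_def complex_eq_iff)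
  have Esm: "summable (\<lambda>k. of_nat (Suc k) powr (A - 1) * sum_rem ?x (\<beta> * real (Suc k)))"
    by (rule summable_of_local_bound[OF open_D sum_rem_summand_holomorphic sum_rem_local_bound xD])
  have "(\<lambda>k. complex_of_real (\<Sum>d. T d k)) sums \<Psi> ?x"
    unfolding col \<Psi>_def by (intro sums_add summable_sums Esm sums_mult z2)
  moreover have "(\<lambda>k. complex_of_real (\<Sum>d. T d k)) sums of_real (\<Sum>d. \<Sum>k. T d k)"
    by (intro sums_of_real swap)
  ultimately show ?thesis unfolding \<Phi>' by (rule sums_unique2[rotated])
qed

lemma \<Phi>_eq_\<Psi>: "b \<in> D \<Longrightarrow> \<Phi> b = \<Psi> b"
proof (rule holomorphic_eq_from_real_interval[where f = \<Phi> and g = \<Psi> and S = D and a = 2 and b = 3])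
  show "of_real x \<in> D" if "2 < x" "x < 3" for x
    using that a by (auto simp: D_def complex_eq_iff)
qed (auto intro: holomorphic_\<Phi> holomorphic_\<Psi> open_D connected_D \<Phi>_eq_\<Psi>_real)

end

section \<open>The identity for real parameters\<close>

text \<open>Regrouping by the product n = d m. Absolute summability over all pairs permits both the
  regrouping and the iterated summation.\<close>

lemma has_sum_divisors:
  fixes f :: "nat \<Rightarrow> nat \<Rightarrow> 'a::banach"
  assumes "(\<lambda>p. norm (f (Suc (fst p)) (Suc (snd p)))) summable_on UNIV \<times> UNIV"
  shows "(\<lambda>n. \<Sum>d | d dvd Suc n. f d (Suc n div d)) sums (\<Sum>d. \<Sum>k. f (Suc d) (Suc k))"
    and "summable (\<lambda>d. \<Sum>k. f (Suc d) (Suc k))"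
proof -
  have "(\<lambda>p. f (Suc (fst p)) (Suc (snd p))) summable_on UNIV \<times> UNIV"
    using assms by (rule abs_summable_summable)
  then obtain S where S: "((\<lambda>p. f (Suc (fst p)) (Suc (snd p))) has_sum S) (UNIV \<times> UNIV)"
    by (auto simp: summable_on_def)
  hence "((\<lambda>(d, k). f (Suc d) (Suc k)) has_sum S) (UNIV \<times> UNIV)"
    by (simp add: case_prod_unfold)
  from has_sum_product_iterated(1)[OF this] have it: "(\<lambda>d. \<Sum>k. f (Suc d) (Suc k)) sums S" .
  thus "summable (\<lambda>d. \<Sum>k. f (Suc d) (Suc k))" by (rule sums_summable)
  have "((\<lambda>(n, d). f d (Suc n div d)) has_sum S) (Sigma UNIV (\<lambda>n. {d. d dvd Suc n})) \<longleftrightarrow>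
        ((\<lambda>p. f (Suc (fst p)) (Suc (snd p))) has_sum S) (UNIV \<times> UNIV)"
  \<comment> \<open>Pairs are stored with both entries lowered by 1, and so is n, while the divisor
    in the pair (n, d) is stored as it is; the witnesses convert between the two
    conventions.\<close>
  proof (rule has_sum_reindex_bij_witness[where
      i = "\<lambda>p. (Suc (fst p) * Suc (snd p) - 1, Suc (fst p))" and j = "\<lambda>q. (snd q - 1, Suc (fst q) div snd q - 1)"])
    fix q assume q: "q \<in> Sigma (UNIV :: nat set) (\<lambda>n. {d. d dvd Suc n})"
    then obtain n d where nd: "q = (n, d)" "d dvd Suc n" by auto
    then obtain m where m: "Suc n = d * m" by (auto elim: dvdE)
    have pos: "d > 0" "m > 0" using m by (auto intro: Nat.gr0I)
    have sd: "Suc (d - 1) = d" "Suc (m - 1) = m" using pos by auto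
    have dv: "Suc n div d = m" using m pos by simp
    show "(Suc (fst (snd q - 1, Suc (fst q) div snd q - 1)) * Suc (snd (snd q - 1, Suc (fst q) div snd q - 1)) - 1,
           Suc (fst (snd q - 1, Suc (fst q) div snd q - 1))) = q"
      unfolding nd fst_conv snd_conv dv sd m[symmetric] by simp
    show "f (Suc (fst (snd q - 1, Suc (fst q) div snd q - 1))) (Suc (snd (snd q - 1, Suc (fst q) div snd q - 1))) =
          (case q of (n, d) \<Rightarrow> f d (Suc n div d))"
      unfolding nd fst_conv snd_conv dv sd prod.case ..
  next
    fix p :: "nat \<times> nat"
    have s: "Suc (Suc (fst p) * Suc (snd p) - 1) = Suc (fst p) * Suc (snd p)" by simp
    show "(snd (Suc (fst p) * Suc (snd p) - 1, Suc (fst p)) - 1,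
           Suc (fst (Suc (fst p) * Suc (snd p) - 1, Suc (fst p))) div snd (Suc (fst p) * Suc (snd p) - 1, Suc (fst p)) - 1) = p"
      unfolding fst_conv snd_conv s nonzero_mult_div_cancel_left[OF nat.distinct(2)] by simp
    show "(Suc (fst p) * Suc (snd p) - 1, Suc (fst p)) \<in> Sigma UNIV (\<lambda>n. {d. d dvd Suc n})"
      by (simp add: s del: mult_Suc mult_Suc_right)
  qed auto
  with S have "((\<lambda>(n, d). f d (Suc n div d)) has_sum S) (Sigma UNIV (\<lambda>n. {d. d dvd Suc n}))" by simp
  hence "((\<lambda>n. \<Sum>d | d dvd Suc n. f d (Suc n div d)) has_sum S) UNIV"
    by (rule has_sum_SigmaD) (simp add: has_sum_finite)
  hence "(\<lambda>n. \<Sum>d | d dvd Suc n. f d (Suc n div d)) sums S" by (rule has_sum_imp_sums)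
  thus "(\<lambda>n. \<Sum>d | d dvd Suc n. f d (Suc n div d)) sums (\<Sum>d. \<Sum>k. f (Suc d) (Suc k))"
    using it by (simp add: sums_iff)
qed

lemma summable_on_product_le:
  fixes f :: "nat \<Rightarrow> nat \<Rightarrow> 'a::banach" and u v :: "nat \<Rightarrow> real"
  assumes u: "summable u" "\<And>d. u d \<ge> 0" and v: "summable v" "\<And>k. v k \<ge> 0"
    and le: "\<And>d k. norm (f d k) \<le> u d * v k"
  shows "(\<lambda>p. norm (f (fst p) (snd p))) summable_on UNIV \<times> UNIV"
proof (rule summable_on_product)
  have uv: "summable (\<lambda>k. u d * v k)" for d by (intro summable_mult v)
  show s: "summable (\<lambda>k. norm (f d k))" for d
    by (rule summable_comparison_test'[OF uv]) (use le in auto)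
  show "summable (\<lambda>d. \<Sum>k. norm (f d k))"
  proof (rule summable_comparison_test')
    show "summable (\<lambda>d. u d * (\<Sum>k. v k))" by (intro summable_mult2 u)
    fix d
    have "(\<Sum>k. norm (f d k)) \<le> (\<Sum>k. u d * v k)" by (intro suminf_le le s uv)
    also have "\<dots> = u d * (\<Sum>k. v k)" by (rule suminf_mult[OF v(1)])
    finally show "norm (\<Sum>k. norm (f d k)) \<le> u d * (\<Sum>k. v k)"
      by (simp add: suminf_nonneg[OF s])
  qed
qed

text \<open>As s - 1/2 = (s + 1/2) - 1, the sine is shifted by pi/2 and becomes minus the cosine of
  the regularization.\<close>

lemma lhs_term_eq_lipschitz_term:
  "lhs_term \<beta> s n = divisor_sigma s n / 2 * lipschitz_term (s + 1/2) \<beta> n"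
proof -
  have half: "of_real pi / 2 * (s - 1/2) = of_real pi / 2 * (s + 1/2) - of_real pi / 2"
    by (simp only: right_diff_distrib distrib_left) simp
  have "sin (x - of_real pi / 2) = - cos x" for x :: complex
    by (simp add: sin_diff)
  hence sin: "sin (of_real pi / 2 * (s - 1/2)) = - cos (of_real pi / 2 * (s + 1/2))"
    unfolding half .
  have div: "2 / of_nat n powr (s + 1/2) = 2 * of_nat n powr (- (s + 1/2))"
    by (simp only: powr_minus divide_inverse)
  have arg: "- s - 1/2 = - (s + 1/2)" by simp
  have rearrange: "D * (y + x + 2 * p * (- c)) = D * (x + y - 2 * c * p)" for D x y p c :: complex
    by (simp add: algebra_simps)
  show ?thesis
    unfolding lhs_term_def lipschitz_term_def sin div arg by (rule rearrange)
qed

text \<open>Homogeneity of degree -a in z and n jointly; a positive factor leaves the principal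
  arguments unchanged.\<close>

lemma lipschitz_term_scale:
  assumes "d > 0"
  shows "lipschitz_term a \<beta> (d * m) = of_nat d powr (- a) * lipschitz_term a (\<beta> / of_nat d) m"
proof -
  have p: "(of_nat d * v) powr (- a) = of_nat d powr (- a) * v powr (- a)" for v
    by (rule powr_times_real_left) auto
  have 1: "\<beta> + \<i> * of_nat (d * m) = of_nat d * (\<beta> / of_nat d + \<i> * of_nat m)"
          "\<beta> - \<i> * of_nat (d * m) = of_nat d * (\<beta> / of_nat d - \<i> * of_nat m)"
    using assms by (simp_all add: field_simps)
  have 2: "of_nat (d * m) powr (- a) = of_nat d powr (- a) * of_nat m powr (- a)"
    using p[of "of_nat m"] by simp
  show ?thesis unfolding lipschitz_term_def 1 2 p by (simp add: algebra_simps)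
qed

text \<open>The factor d^s of the divisor sum meets d^(-s-1/2) from the scaling. This is where the
  exponent b = 1/2 comes from.\<close>

lemma lhs_term_divisor_sum:
  assumes "n > 0"
  shows "lhs_term \<beta> s n = (\<Sum>d | d dvd n. of_nat d powr (-1/2) / 2 * lipschitz_term (s + 1/2) (\<beta> / of_nat d) (n div d))"
proof -
  have "lhs_term \<beta> s n = (\<Sum>d | d dvd n. of_nat d powr s / 2 * lipschitz_term (s + 1/2) \<beta> n)"
    unfolding lhs_term_eq_lipschitz_term divisor_sigma_def by (simp add: sum_distrib_right sum_divide_distrib)
  also have "\<dots> = (\<Sum>d | d dvd n. of_nat d powr (-1/2) / 2 * lipschitz_term (s + 1/2) (\<beta> / of_nat d) (n div d))"
  proof (rule sum.cong)
    fix d assume "d \<in> {d. d dvd n}"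
    hence d: "d dvd n" by simp
    hence d0: "d > 0" using assms by (auto intro: Nat.gr0I)
    have "of_nat d powr s * of_nat d powr (- (s + 1/2)) = (of_nat d powr (-1/2) :: complex)"
      by (subst powr_add[symmetric]) simp
    thus "of_nat d powr s / 2 * lipschitz_term (s + 1/2) \<beta> n = of_nat d powr (-1/2) / 2 * lipschitz_term (s + 1/2) (\<beta> / of_nat d) (n div d)"
      using lipschitz_term_scale[OF d0, of "s + 1/2" \<beta> "n div d"] d by simp
  qed simp
  finally show ?thesis .
qed

text \<open>With n = d y the argument n \<beta> is (\<beta> d) y, and d^(a-1/2) / sqrt n splits into
  d^(a-1) and 1 / sqrt y. The division by sqrt 2 undoes the normalization of
  \<open>fourier_term\<close>.\<close>

lemma rhs_term_real:
  assumes \<beta>: "\<beta> > 0" and n: "n > 0"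
  shows "rhs_term (of_real \<beta>) (of_real (a - 1/2)) n =
           of_real ((\<Sum>d | d dvd n. real d powr (a - 1) * fourier_term (\<beta> * real d) (n div d)) / sqrt 2)"
proof -
  define K where "K = exp (- 2 * pi * sqrt (2 * real n * \<beta>)) * sin (pi / 4 - 2 * pi * sqrt (2 * real n * \<beta>))"
  have c: "csqrt (2 * of_nat n * of_real \<beta>) = of_real (sqrt (2 * real n * \<beta>))"
    using csqrt_of_real_nonneg[of "2 * real n * \<beta>"] \<beta> by simp
  have K: "exp (- 2 * of_real pi * csqrt (2 * of_nat n * of_real \<beta>)) *
      sin (of_real pi / 4 - 2 * of_real pi * csqrt (2 * of_nat n * of_real \<beta>)) = complex_of_real K"
    unfolding c K_def by (simp flip: exp_of_real sin_of_real)
  have summand: "real d powr (a - 1/2) / sqrt (real n) * K = real d powr (a - 1) * fourier_term (\<beta> * real d) (n div d) / sqrt 2"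
    if d: "d dvd n" for d
  proof -
    have d0: "d > 0" using d n by (auto intro: Nat.gr0I)
    have nd: "real d * real (n div d) = real n" using d by (metis dvd_mult_div_cancel of_nat_mult)
    have e: "2 * (\<beta> * real d) * real (n div d) = 2 * real n * \<beta>"
      unfolding nd[symmetric] by simp
    have "real d powr (a - 1/2) = real d powr (a - 1) * sqrt (real d)"
      using powr_add[of "real d" "a - 1" "1/2"] by (simp add: powr_half_sqrt)
    moreover have "sqrt (real n) = sqrt (real d) * sqrt (real (n div d))"
      unfolding nd[symmetric] by (rule real_sqrt_mult)
    ultimately have "real d powr (a - 1/2) / sqrt (real n) = real d powr (a - 1) / sqrt (real (n div d))"
      using d0 by simp
    thus ?thesis unfolding fourier_term_def e K_def by simp
  qed
  have dp: "of_nat d powr complex_of_real (a - 1/2) = of_real (real d powr (a - 1/2))" for d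
    using powr_of_real[of "real d" "a - 1/2"] by simp
  have "rhs_term (of_real \<beta>) (of_real (a - 1/2)) n =
         of_real ((\<Sum>d | d dvd n. real d powr (a - 1/2)) / sqrt (real n) * K)"
    unfolding rhs_term_def mult.assoc[of "_ / _"] K divisor_sigma_def dp by simp
  also have "(\<Sum>d | d dvd n. real d powr (a - 1/2)) / sqrt (real n) * K = (\<Sum>d | d dvd n. real d powr (a - 1/2) / sqrt (real n) * K)"
    by (simp add: sum_distrib_right sum_divide_distrib)
  also have "\<dots> = (\<Sum>d | d dvd n. real d powr (a - 1) * fourier_term (\<beta> * real d) (n div d) / sqrt 2)"
    by (rule sum.cong) (use summand in auto)
  finally show ?thesis by (simp only: sum_divide_distrib)
qed

lemma fourier_term_product_le:
  assumes \<beta>: "\<beta> > 0" and d: "d > 0" and y: "y > 0"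
  shows "\<bar>real d powr (a - 1) * fourier_term (\<beta> * real d) y\<bar> \<le>
    (sqrt 2 * (real d powr (a - 1) * exp (- (pi * sqrt (2 * \<beta>)) * sqrt (real d)))) *
    (real y powr (-1/2) * exp (- (pi * sqrt (2 * \<beta>)) * sqrt (real y)))"
proof -
  define c where "c = pi * sqrt (2 * \<beta>)"
  have c: "c \<ge> 0" using \<beta> by (simp add: c_def)
  \<comment> \<open>Both roots are at least 1, so each is at most their product. This separates the
    variables in the exponential at the price of half the rate.\<close>
  have "sqrt (real d) + sqrt (real y) \<le> 2 * (sqrt (real d) * sqrt (real y))"
  proof -
    have "1 \<le> sqrt (real d)" "1 \<le> sqrt (real y)" using d y by auto
    hence "sqrt (real d) * 1 \<le> sqrt (real d) * sqrt (real y)" "1 * sqrt (real y) \<le> sqrt (real d) * sqrt (real y)"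
      by (intro mult_left_mono mult_right_mono; simp)+
    thus ?thesis by simp
  qed
  hence "c * (sqrt (real d) + sqrt (real y)) \<le> c * (2 * (sqrt (real d) * sqrt (real y)))"
    using c by (rule mult_left_mono)
  hence ex: "exp (- (2 * c * (sqrt (real d) * sqrt (real y)))) \<le> exp (- c * sqrt (real d)) * exp (- c * sqrt (real y))"
    by (simp add: algebra_simps flip: exp_add)
  have e: "2 * pi * sqrt (2 * (\<beta> * real d)) * sqrt (real y) = 2 * c * (sqrt (real d) * sqrt (real y))"
    by (simp add: c_def real_sqrt_mult)
  have "\<bar>fourier_term (\<beta> * real d) y\<bar> \<le> sqrt 2 * (real y powr (-1/2) * exp (- (2 * c * (sqrt (real d) * sqrt (real y)))))"
    using abs_fourier_term_le[of "\<beta> * real d" y] \<beta> d y by (simp add: e flip: minus_mult_left)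
  also have "\<dots> \<le> sqrt 2 * (real y powr (-1/2) * (exp (- c * sqrt (real d)) * exp (- c * sqrt (real y))))"
    by (intro mult_left_mono ex) auto
  finally have "real d powr (a - 1) * \<bar>fourier_term (\<beta> * real d) y\<bar> \<le>
     real d powr (a - 1) * (sqrt 2 * (real y powr (-1/2) * (exp (- c * sqrt (real d)) * exp (- c * sqrt (real y)))))"
    by (rule mult_left_mono) auto
  thus ?thesis by (simp add: abs_mult c_def mult_ac)
qed

text \<open>The equality of \<Phi> and \<Psi> at b = 1/2, multiplied by (2 pi)^a / 2. The three zeta
  arguments lie in the strip 0 < Re w < 1 because 0 < a < 1/2, so \<open>zeta_right\<close>
  represents them.\<close>

lemma corollary7p2_real:
  assumes a: "0 < a" "a < 1/2" and \<beta>: "\<beta> > 0"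
  defines "s \<equiv> complex_of_real (a - 1/2)"
  shows "Gamma (s + 1/2) *
           (riemann_zeta (- s) / (2 * of_real \<beta> powr (s + 1/2)) + (\<Sum>n. lhs_term (of_real \<beta>) s (Suc n)))
         = (2 * of_real pi) powr s *
           (- 2 * of_real pi * csqrt (of_real pi * of_real \<beta>) * riemann_zeta (- s)
            - of_real (sqrt (pi / 2)) * riemann_zeta (1/2) * riemann_zeta (1/2 - s)
            + of_real (sqrt pi) * (\<Sum>n. rhs_term (of_real \<beta>) s (Suc n)))"
proof -
  interpret exponent_continuation a \<beta> by unfold_locales (use assms in auto)
  have sA: "s + 1/2 = A" by (simp add: s_def)
  have Z1: "riemann_zeta (- s) = zeta_right (1/2 - A)"
    by (subst riemann_zeta_eq_zeta_right) (use a in \<open>auto simp: s_def complex_eq_iff\<close>)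
  have Z2: "riemann_zeta (1/2) = zeta_right (1/2)" by (rule riemann_zeta_eq_zeta_right) auto
  have Z3: "riemann_zeta (1/2 - s) = zeta_right (1 - A)"
    by (subst riemann_zeta_eq_zeta_right) (use a in \<open>auto simp: s_def complex_eq_iff\<close>)
  define X where "X = (\<Sum>d. of_nat (Suc d) powr (-1/2) * lipschitz_rem A (\<beta> / real (Suc d)))"
  define Y where "Y = (\<Sum>k. of_nat (Suc k) powr (A - 1) * sum_rem (1/2) (\<beta> * real (Suc k)))"
  \<comment> \<open>Once the series is regrouped by divisors, the regularized formula at z = \<beta>
    / d evaluates the inner sum for each d.\<close>
  have LHS: "Gamma A * (\<Sum>n. lhs_term (of_real \<beta>) s (Suc n)) = of_real (2 * pi) powr A / 2 * X"
  proof -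
    define f where "f = (\<lambda>d m. of_nat d powr (-1/2) / 2 * lipschitz_term A (of_real \<beta> / of_nat d) m)"
    have "(\<lambda>p. norm (f (Suc (fst p)) (Suc (snd p)))) summable_on UNIV \<times> UNIV"
    proof (rule summable_on_product_le)
      show "summable (\<lambda>d. a * \<beta> * real (Suc d) powr (-3/2))" "summable (\<lambda>m. real (Suc m) powr (- a - 1))"
        by (intro summable_mult summable_nat_powr_real; use a in simp)+
      fix d m
      have B: "norm (lipschitz_term A (of_real \<beta> / of_nat (Suc d)) (Suc m)) \<le> 2 * a * real (Suc m) powr (- a - 1) * (\<beta> / real (Suc d))"
        using norm_lipschitz_term_real_le[of "Suc m" "\<beta> / real (Suc d)" A] a \<beta> by (simp del: of_nat_Suc)
      have "norm (f (Suc d) (Suc m)) = real (Suc d) powr (-1/2) / 2 * norm (lipschitz_term A (of_real \<beta> / of_nat (Suc d)) (Suc m))"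
        by (simp add: f_def norm_mult norm_divide norm_powr_nat del: of_nat_Suc)
      also have "\<dots> \<le> real (Suc d) powr (-1/2) / 2 * (2 * a * real (Suc m) powr (- a - 1) * (\<beta> / real (Suc d)))"
        by (rule mult_left_mono[OF B]) simp
      also have "\<dots> = a * \<beta> * (real (Suc d) powr (-1/2) / real (Suc d)) * real (Suc m) powr (- a - 1)" by simp
      also have "real (Suc d) powr (-1/2) / real (Suc d) = real (Suc d) powr (-3/2)"
        using powr_diff[of "real (Suc d)" "-1/2" 1] by simp
      finally show "norm (f (Suc d) (Suc m)) \<le> a * \<beta> * real (Suc d) powr (-3/2) * real (Suc m) powr (- a - 1)" .
    qed (use a \<beta> in auto)
    note S = has_sum_divisors[OF this]
    have "lhs_term (of_real \<beta>) s (Suc n) = (\<Sum>d | d dvd Suc n. f d (Suc n div d))" for n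
      unfolding lhs_term_divisor_sum[OF zero_less_Suc] f_def sA ..
    hence "(\<Sum>n. lhs_term (of_real \<beta>) s (Suc n)) = (\<Sum>d. \<Sum>m. f (Suc d) (Suc m))"
      using S(1) by (simp add: sums_iff)
    hence "Gamma A * (\<Sum>n. lhs_term (of_real \<beta>) s (Suc n)) = (\<Sum>d. Gamma A * (\<Sum>m. f (Suc d) (Suc m)))"
      by (simp only: suminf_mult[OF S(2)])
    also have "(\<lambda>d. Gamma A * (\<Sum>m. f (Suc d) (Suc m))) =
        (\<lambda>d. of_real (2 * pi) powr A / 2 * (of_nat (Suc d) powr (-1/2) * lipschitz_rem A (\<beta> / real (Suc d))))"
    proof
      fix d
      have z: "\<beta> / real (Suc d) > 0" using \<beta> by simp
      have "summable (\<lambda>m. lipschitz_term A (of_real (\<beta> / real (Suc d))) (Suc m))"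
        by (rule summable_norm_cancel, rule summable_lipschitz_term[OF z]) (use a in auto)
      hence "(\<Sum>m. f (Suc d) (Suc m)) = of_nat (Suc d) powr (-1/2) / 2 * (\<Sum>m. lipschitz_term A (of_real (\<beta> / real (Suc d))) (Suc m))"
        unfolding f_def by (subst suminf_mult[symmetric]) (simp_all del: of_nat_Suc)
      hence "Gamma A * (\<Sum>m. f (Suc d) (Suc m)) = of_nat (Suc d) powr (-1/2) / 2 * (Gamma A * (\<Sum>m. lipschitz_term A (of_real (\<beta> / real (Suc d))) (Suc m)))"
        by (simp only: mult_ac)
      also have "Gamma A * (\<Sum>m. lipschitz_term A (of_real (\<beta> / real (Suc d))) (Suc m)) = of_real (2 * pi) powr A * lipschitz_rem A (\<beta> / real (Suc d))"
        by (rule lipschitz_regularized[symmetric]) (use a z in auto)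
      finally show "Gamma A * (\<Sum>m. f (Suc d) (Suc m)) = of_real (2 * pi) powr A / 2 * (of_nat (Suc d) powr (-1/2) * lipschitz_rem A (\<beta> / real (Suc d)))"
        by simp
    qed
    also have "(\<Sum>d. of_real (2 * pi) powr A / 2 * (of_nat (Suc d) powr (-1/2) * lipschitz_rem A (\<beta> / real (Suc d)))) = of_real (2 * pi) powr A / 2 * X"
      unfolding X_def
    proof (rule suminf_mult, rule summable_comparison_test')
      show "summable (\<lambda>d. lipschitz_rem_const a * \<beta> * real (Suc d) powr (- 1/2 - 1))"
        by (intro summable_mult summable_nat_powr_real) auto
      show "norm (of_nat (Suc d) powr (-1/2) * lipschitz_rem A (\<beta> / real (Suc d))) \<le> lipschitz_rem_const a * \<beta> * real (Suc d) powr (- 1/2 - 1)" for d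
        using lipschitz_rem_term_le[of d "1/2"] by simp
    qed
    finally show ?thesis .
  qed
  \<comment> \<open>Here \<open>sum_rem_half\<close> is read backwards: the inner sum over the
    cofactor y becomes \<open>sum_rem (1/2)\<close>, and the divisor d takes the role of k in
    \<Psi>.\<close>
  have RHS: "of_real (sqrt 2) * (\<Sum>n. rhs_term (of_real \<beta>) s (Suc n)) = Y"
  proof -
    define f where "f = (\<lambda>d y. real d powr (a - 1) * fourier_term (\<beta> * real d) y)"
    have "(\<lambda>p. norm (f (Suc (fst p)) (Suc (snd p)))) summable_on UNIV \<times> UNIV"
    proof (rule summable_on_product_le)
      show "summable (\<lambda>d. sqrt 2 * (real (Suc d) powr (a - 1) * exp (- (pi * sqrt (2 * \<beta>)) * sqrt (real (Suc d)))))"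
           "summable (\<lambda>y. real (Suc y) powr (-1/2) * exp (- (pi * sqrt (2 * \<beta>)) * sqrt (real (Suc y))))"
        by (intro summable_mult summable_powr_exp_sqrt; use \<beta> in simp)+
      show "norm (f (Suc d) (Suc y)) \<le> sqrt 2 * (real (Suc d) powr (a - 1) * exp (- (pi * sqrt (2 * \<beta>)) * sqrt (real (Suc d)))) *
         (real (Suc y) powr (-1/2) * exp (- (pi * sqrt (2 * \<beta>)) * sqrt (real (Suc y))))" for d y
        unfolding f_def real_norm_def by (rule fourier_term_product_le) (use \<beta> in auto)
    qed auto
    note S = has_sum_divisors[OF this]
    have eq: "rhs_term (of_real \<beta>) s (Suc n) = of_real ((\<Sum>d | d dvd Suc n. f d (Suc n div d)) / sqrt 2)" for n
      unfolding s_def f_def by (rule rhs_term_real) (use \<beta> in auto)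
    have "(\<lambda>n. rhs_term (of_real \<beta>) s (Suc n)) sums complex_of_real ((\<Sum>d. \<Sum>y. f (Suc d) (Suc y)) / sqrt 2)"
      unfolding eq by (intro sums_of_real sums_divide S)
    hence "of_real (sqrt 2) * (\<Sum>n. rhs_term (of_real \<beta>) s (Suc n)) = complex_of_real (\<Sum>d. \<Sum>y. f (Suc d) (Suc y))"
      by (simp add: sums_iff)
    also have "\<dots> = (\<Sum>d. complex_of_real (\<Sum>y. f (Suc d) (Suc y)))"
      using sums_of_real[OF summable_sums[OF S(2)], where 'a = complex] by (simp add: sums_iff)
    also have "(\<lambda>d. complex_of_real (\<Sum>y. f (Suc d) (Suc y))) = (\<lambda>d. of_nat (Suc d) powr (A - 1) * sum_rem (1/2) (\<beta> * real (Suc d)))"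
    proof
      fix d
      have w: "\<beta> * real (Suc d) > 0" using \<beta> by simp
      have "summable (\<lambda>y. fourier_term (\<beta> * real (Suc d)) (Suc y))"
        by (rule summable_rabs_cancel, rule summable_fourier_term[OF w])
      hence "(\<Sum>y. f (Suc d) (Suc y)) = real (Suc d) powr (a - 1) * (\<Sum>y. fourier_term (\<beta> * real (Suc d)) (Suc y))"
        unfolding f_def by (rule suminf_mult)
      thus "complex_of_real (\<Sum>y. f (Suc d) (Suc y)) = of_nat (Suc d) powr (A - 1) * sum_rem (1/2) (\<beta> * real (Suc d))"
        unfolding sum_rem_half[OF w] using powr_of_real[of "real (Suc d)" "a - 1"] by (simp del: of_nat_Suc)
    qed
    finally show ?thesis unfolding Y_def .
  qed
  have main: "X + zeta_right (1/2) * zeta_right (1 - A) + Gamma A * of_real (2 * pi * \<beta>) powr (- A) * zeta_right (1/2 - A)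
       = Y + Gamma (-1/2) * of_real (2 * pi * \<beta>) powr (1/2) * zeta_right (1/2 - A)"
  proof -
    have "1/2 \<in> D" using a by (auto simp: D_def complex_eq_iff)
    from \<Phi>_eq_\<Psi>[OF this] show ?thesis unfolding \<Phi>_def \<Psi>_def X_def Y_def by simp
  qed
  have G: "Gamma (-1/2 :: complex) = - 2 * of_real (sqrt pi)"
  proof -
    have "-1/2 \<notin> (\<int>\<^sub>\<le>\<^sub>0 :: complex set)"
      using minus_one_notin_nonpos_Ints[of "1/2"] by simp
    hence "Gamma (1/2) = (-1/2) * Gamma (-1/2 :: complex)"
      using Gamma_plus1[of "-1/2 :: complex"] by simp
    thus ?thesis using Gamma_one_half_complex by (simp add: field_simps)
  qed
  define P where "P = complex_of_real (2 * pi) powr A"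
  have P1: "P * of_real (2 * pi * \<beta>) powr (- A) = of_real \<beta> powr (- A)"
  proof -
    have "complex_of_real (2 * pi * \<beta>) powr (- A) = of_real (2 * pi) powr (- A) * of_real \<beta> powr (- A)"
      using \<beta> powr_times_real[of "of_real (2 * pi)" "of_real \<beta>" "- A"] by simp
    moreover have "P * of_real (2 * pi) powr (- A) = 1" unfolding P_def by (subst powr_add[symmetric]) simp
    ultimately show ?thesis by (simp only: mult.assoc[symmetric] mult_1_left)
  qed
  have P2: "P = (2 * of_real pi) powr s * of_real (sqrt (2 * pi))"
  proof -
    have "P = of_real (2 * pi) powr s * of_real (2 * pi) powr (1/2)"
      unfolding P_def sA[symmetric] by (rule powr_add)
    also have "complex_of_real (2 * pi) powr (1/2) = of_real (sqrt (2 * pi))"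
      using powr_of_real[of "2 * pi" "1/2"] by (simp add: powr_half_sqrt)
    finally show ?thesis by simp
  qed
  have Q: "complex_of_real (2 * pi * \<beta>) powr (1/2) = of_real (sqrt (2 * pi * \<beta>))"
    using powr_of_real[of "2 * pi * \<beta>" "1/2"] \<beta> by (simp add: powr_half_sqrt)
  have C: "csqrt (of_real pi * of_real \<beta>) = of_real (sqrt (pi * \<beta>))"
    using csqrt_of_real_nonneg[of "pi * \<beta>"] \<beta> by simp
  have "Gamma A * (zeta_right (1/2 - A) / (2 * of_real \<beta> powr A) + (\<Sum>n. lhs_term (of_real \<beta>) s (Suc n)))
      = P / 2 * (X + Gamma A * of_real (2 * pi * \<beta>) powr (- A) * zeta_right (1/2 - A))"
  proof -
    have "zeta_right (1/2 - A) / (2 * of_real \<beta> powr A) = zeta_right (1/2 - A) / 2 * (P * of_real (2 * pi * \<beta>) powr (- A))"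
      unfolding P1 by (simp add: powr_minus field_simps)
    moreover have "G * (z / 2 * (p * W) + L) = p / 2 * (x + G * W * z)" if "G * L = p / 2 * x"
      for G z p W L x :: complex
      using that by (simp add: algebra_simps)
    ultimately show ?thesis using LHS[folded P_def] by (simp only:)
  qed
  also have "X + Gamma A * of_real (2 * pi * \<beta>) powr (- A) * zeta_right (1/2 - A) =
      Y + Gamma (-1/2) * of_real (2 * pi * \<beta>) powr (1/2) * zeta_right (1/2 - A) - zeta_right (1/2) * zeta_right (1 - A)"
    using main by (simp add: algebra_simps)
  also have "P / 2 * \<dots> = (2 * of_real pi) powr s *
      (- of_real (sqrt (2 * pi) * sqrt pi * sqrt (2 * pi * \<beta>)) * zeta_right (1/2 - A)
       - of_real (sqrt (2 * pi) / 2) * zeta_right (1/2) * zeta_right (1 - A)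
       + of_real (sqrt (2 * pi) / 2) * Y)"
    unfolding P2 Q G by (simp add: algebra_simps)
  \<comment> \<open>The three roots come from (2 pi)^a = (2 pi)^s sqrt(2 pi), from Gamma(-1/2) and
    from (2 pi \<beta>)^(1/2).\<close>
  also have "sqrt (2 * pi) * sqrt pi * sqrt (2 * pi * \<beta>) = 2 * pi * sqrt (pi * \<beta>)"
  proof -
    have "sqrt (2 * pi) * sqrt pi * sqrt (2 * pi * \<beta>) = sqrt ((2 * pi)\<^sup>2 * (pi * \<beta>))"
      by (simp only: real_sqrt_mult[symmetric] power2_eq_square mult_ac)
    also have "\<dots> = sqrt ((2 * pi)\<^sup>2) * sqrt (pi * \<beta>)" by (rule real_sqrt_mult)
    also have "sqrt ((2 * pi)\<^sup>2) = 2 * pi" by (rule real_sqrt_unique) auto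
    finally show ?thesis .
  qed
  also have "sqrt (2 * pi) / 2 = sqrt (pi / 2)"
    by (simp add: real_sqrt_mult real_sqrt_divide field_simps)
  also have "complex_of_real (sqrt (pi / 2)) * Y = of_real (sqrt pi) * (\<Sum>n. rhs_term (of_real \<beta>) s (Suc n))"
    unfolding RHS[symmetric] by (simp add: real_sqrt_divide)
  finally show ?thesis unfolding sA Z1 Z2 Z3 C by simp
qed

section \<open>Continuation in both parameters\<close>

lemma divisors_Suc_subset: "{d. d dvd Suc n} \<subseteq> {1..Suc n}"
proof
  fix d assume "d \<in> {d. d dvd Suc n}"
  hence d: "d dvd Suc n" by simp
  hence "d \<le> Suc n" by (rule dvd_imp_le) simp
  moreover have "d \<noteq> 0" using d by (intro notI) simp
  ultimately show "d \<in> {1..Suc n}" by simp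
qed

lemma norm_divisor_sigma_le: "norm (divisor_sigma s (Suc n)) \<le> (\<Sum>d | d dvd Suc n. real d powr Re s)"
  unfolding divisor_sigma_def
proof (rule order_trans[OF norm_sum sum_mono])
  fix d assume "d \<in> {d. d dvd Suc n}"
  hence "d > 0" using divisors_Suc_subset[of n] by auto
  thus "norm (of_nat d powr s :: complex) \<le> real d powr Re s" by (simp add: norm_powr_nat)
qed

lemma holomorphic_divisor_sigma: "(\<lambda>s. divisor_sigma s (Suc n)) holomorphic_on S"
  unfolding divisor_sigma_def
proof (rule holomorphic_on_sum)
  fix d assume "d \<in> {d. d dvd Suc n}"
  hence "d > 0" using divisors_Suc_subset[of n] by auto
  thus "(\<lambda>s. of_nat d powr s) holomorphic_on S" by (intro holomorphic_intros) auto
qed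

text \<open>The Lipschitz term is O(n^(-Re s - 3/2)); with n = d m its product with the divisor sum
  is dominated by a regrouped product of two convergent series. For complex \<beta> the point
  \<beta> - i n may come close to 0, hence the restriction to n >= 2 Q, where Q bounds the modulus
  of all \<beta> concerned.\<close>

lemma lhs_local_bound:
  assumes \<beta>0: "Re \<beta>0 > 0" and s0: "Re s0 > - 1/2"
  shows "\<exists>\<delta>>0. \<exists>M. summable M \<and> (\<forall>\<^sub>F n in sequentially. \<forall>\<beta>\<in>ball \<beta>0 \<delta>. \<forall>s\<in>ball s0 \<delta>.
           Re \<beta> > 0 \<longrightarrow> norm (lhs_term \<beta> s (Suc n)) \<le> M n)"
proof -
  \<comment> \<open>Half the distance of s0 from the line Re s = -1/2, so that Re (s + 1/2) >=
    \<eta> on the whole ball.\<close>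
  define \<eta> where "\<eta> = (Re s0 + 1/2) / 2"
  define \<delta> where "\<delta> = min 1 \<eta>"
  have \<eta>: "\<eta> > 0" using s0 by (simp add: \<eta>_def)
  define K where "K = norm s0 + 2"
  define Q where "Q = norm \<beta>0 + 1"
  define C where "C = 2 * K * exp (pi * K) * 2 powr (K + 1) * Q"
  have K0: "K \<ge> 0" "Q \<ge> 0" by (simp_all add: K_def Q_def)
  define M where "M = (\<lambda>n. C * (\<Sum>d | d dvd Suc n. real d powr (-3/2) * real (Suc n div d) powr (- \<eta> - 1)))"
  have "(\<lambda>p. norm (real (Suc (fst p)) powr (-3/2) * real (Suc (snd p)) powr (- \<eta> - 1))) summable_on UNIV \<times> UNIV"
    by (rule summable_on_product_le[where u = "\<lambda>d. real (Suc d) powr (-3/2)" and v = "\<lambda>m. real (Suc m) powr (- \<eta> - 1)"])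
       (use \<eta> in \<open>auto intro!: summable_nat_powr_real simp del: of_nat_Suc\<close>)
  from has_sum_divisors(1)[OF this] have M: "summable M"
    unfolding M_def by (intro summable_mult) (rule sums_summable)
  have "\<forall>\<^sub>F n in sequentially. 2 * Q \<le> real (Suc n)"
    by (rule eventually_mono[OF eventually_ge_at_top[of "nat \<lceil>2 * Q\<rceil>"]]) linarith
  hence "\<forall>\<^sub>F n in sequentially. \<forall>\<beta>\<in>ball \<beta>0 \<delta>. \<forall>s\<in>ball s0 \<delta>.
           Re \<beta> > 0 \<longrightarrow> norm (lhs_term \<beta> s (Suc n)) \<le> M n"
  proof (rule eventually_mono, intro ballI impI)
    fix n \<beta> s assume n: "2 * Q \<le> real (Suc n)" and b: "\<beta> \<in> ball \<beta>0 \<delta>" and s: "s \<in> ball s0 \<delta>" and \<beta>: "Re \<beta> > 0"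
    have nb: "norm \<beta> \<le> Q" using ball_complex_bounds(3)[OF b] by (simp add: Q_def \<delta>_def)
    have "\<bar>Re s - Re s0\<bar> \<le> \<eta>" using ball_complex_bounds(1)[OF s] by (simp add: \<delta>_def)
    moreover have "Re s0 - Re s \<le> \<bar>Re s - Re s0\<bar>" by simp
    ultimately have Rs: "Re (s + 1/2) \<ge> \<eta>" by (simp add: \<eta>_def field_simps)
    have ns: "norm s \<le> norm s0 + 1" using ball_complex_bounds(3)[OF s] by (simp add: \<delta>_def)
    have na: "norm (s + 1/2) \<le> K"
      using norm_triangle_ineq[of s "1/2"] ns by (simp add: K_def)
    have Ra: "Re (s + 1/2) \<le> K" "\<bar>Im (s + 1/2)\<bar> \<le> K"
      using abs_Re_le_cmod[of "s + 1/2"] abs_Im_le_cmod[of "s + 1/2"] na by linarith+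
    define N where "N = real (Suc n)"
    have N: "N > 0" by (simp add: N_def)
    \<comment> \<open>Since |u \<beta>| <= Q <= N/2, the segment keeps the distance N/2 from
      0.\<close>
    have low: "N / 2 \<le> norm (of_real u * \<beta> + v)" if u: "u \<in> {0..1}" and v: "norm v = N" for u v
    proof -
      have "norm (of_real u * \<beta>) \<le> 1 * norm \<beta>"
        unfolding norm_mult using u by (intro mult_right_mono) auto
      moreover have "norm v - norm (of_real u * \<beta>) \<le> norm (of_real u * \<beta> + v)"
        using norm_diff_ineq[of v "of_real u * \<beta>"] by (simp add: add.commute)
      ultimately show ?thesis using nb n v by (simp add: N_def)
    qed
    have nin: "norm (\<i> * of_nat (Suc n) :: complex) = N" "norm (- (\<i> * of_nat (Suc n)) :: complex) = N"
      by (simp_all add: norm_mult N_def del: of_nat_Suc)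
    have "norm (lipschitz_term (s + 1/2) \<beta> (Suc n)) \<le>
        2 * norm (s + 1/2) * exp (pi * \<bar>Im (s + 1/2)\<bar>) * (N / 2) powr (- Re (s + 1/2) - 1) * norm \<beta>"
    proof (rule norm_lipschitz_term_le)
      show "N / 2 \<le> norm (of_real u * \<beta> + \<i> * of_nat (Suc n))" if "u \<in> {0..1}" for u
        by (rule low[OF that nin(1)])
      show "N / 2 \<le> norm (of_real u * \<beta> - \<i> * of_nat (Suc n))" if "u \<in> {0..1}" for u
        using low[OF that nin(2)] by simp
    qed (use \<beta> N Rs \<eta> in auto)
    also have "(N / 2) powr (- Re (s + 1/2) - 1) = N powr (- Re (s + 1/2) - 1) * 2 powr (Re (s + 1/2) + 1)"
    proof -
      have "(N / 2) powr p = N powr p * 2 powr (- p)" for p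
        using N by (simp add: powr_divide powr_minus field_simps)
      thus ?thesis by (simp add: algebra_simps)
    qed
    also have "2 * norm (s + 1/2) * exp (pi * \<bar>Im (s + 1/2)\<bar>) * (N powr (- Re (s + 1/2) - 1) * 2 powr (Re (s + 1/2) + 1)) * norm \<beta>
        \<le> 2 * K * exp (pi * K) * (N powr (- Re (s + 1/2) - 1) * 2 powr (K + 1)) * Q"
      using na Ra nb K0 by (intro mult_mono powr_mono order_refl) auto
    finally have bound: "norm (lipschitz_term (s + 1/2) \<beta> (Suc n)) \<le>
        2 * K * exp (pi * K) * (N powr (- Re (s + 1/2) - 1) * 2 powr (K + 1)) * Q" .
    have B: "norm (lipschitz_term (s + 1/2) \<beta> (Suc n)) \<le> C * N powr (- Re s - 3/2)"
    proof -
      have "- Re (s + 1/2) - 1 = - Re s - 3/2" by simp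
      thus ?thesis using bound unfolding C_def by (simp only: mult_ac)
    qed
    have C0: "C \<ge> 0" using K0 by (simp add: C_def)
    have "norm (lhs_term \<beta> s (Suc n)) = norm (divisor_sigma s (Suc n)) / 2 * norm (lipschitz_term (s + 1/2) \<beta> (Suc n))"
      unfolding lhs_term_eq_lipschitz_term by (simp add: norm_mult norm_divide)
    also have "\<dots> \<le> (\<Sum>d | d dvd Suc n. real d powr Re s) * (C * N powr (- Re s - 3/2))"
    proof (intro mult_mono B)
      show "norm (divisor_sigma s (Suc n)) / 2 \<le> (\<Sum>d | d dvd Suc n. real d powr Re s)"
        using norm_divisor_sigma_le[of s n] norm_ge_zero[of "divisor_sigma s (Suc n)"] by linarith
    qed (auto intro: sum_nonneg)
    also have "\<dots> = C * (\<Sum>d | d dvd Suc n. real d powr Re s * N powr (- Re s - 3/2))"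
      by (simp add: sum_distrib_right sum_distrib_left mult_ac)
    also have "\<dots> \<le> M n"
      unfolding M_def
    proof (intro mult_left_mono C0 sum_mono)
      fix d assume "d \<in> {d. d dvd Suc n}"
      hence d: "d dvd Suc n" "d > 0" using divisors_Suc_subset[of n] by auto
      define m where "m = Suc n div d"
      have nd: "Suc n = d * m" using d by (simp add: m_def)
      hence m: "m > 0" by (auto intro: Nat.gr0I)
      \<comment> \<open>The powers of d combine to the exponent -3/2 whatever s is; only m keeps a
        dependence on s.\<close>
      have "N = real d * real m" unfolding N_def nd by simp
      hence "real d powr Re s * N powr (- Re s - 3/2) = (real d powr Re s * real d powr (- Re s - 3/2)) * real m powr (- Re s - 3/2)"
        by (simp add: powr_mult)
      also have "real d powr Re s * real d powr (- Re s - 3/2) = real d powr (-3/2)"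
        by (simp add: powr_add[symmetric])
      also have "real m powr (- Re s - 3/2) \<le> real m powr (- \<eta> - 1)"
        using m Rs by (intro powr_mono) auto
      finally show "real d powr Re s * N powr (- Re s - 3/2) \<le> real d powr (-3/2) * real (Suc n div d) powr (- \<eta> - 1)"
        by (simp add: m_def mult_left_mono)
    qed
    finally show "norm (lhs_term \<beta> s (Suc n)) \<le> M n" .
  qed
  moreover have "\<delta> > 0" using \<eta> by (simp add: \<delta>_def)
  ultimately show ?thesis using M by blast
qed

text \<open>The root halves the argument and so maps the half plane into the sector of opening pi/2
  about the positive axis. The sine on the right-hand side grows like exp(2 pi |Im q|); the strict
  inequality lets exp(-2 pi q) prevail.\<close>

lemma csqrt_sector:
  assumes "Re \<beta> > 0"
  shows "\<bar>Im (csqrt \<beta>)\<bar> < Re (csqrt \<beta>)"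
proof -
  have "Re ((csqrt \<beta>)\<^sup>2) > 0" using assms by simp
  hence "(Im (csqrt \<beta>))\<^sup>2 < (Re (csqrt \<beta>))\<^sup>2" by (simp only: Re_power2)
  moreover have "Re (csqrt \<beta>) \<ge> 0" by (rule Re_csqrt)
  ultimately show ?thesis by (metis abs_le_square_iff abs_of_nonneg not_le)
qed

lemma csqrt_scale:
  assumes "Re \<beta> > 0" "x > 0"
  shows "csqrt (of_real x * \<beta>) = of_real (sqrt x) * csqrt \<beta>"
proof -
  have "(of_real (sqrt x))\<^sup>2 = complex_of_real x"
    unfolding of_real_power[symmetric] using assms by simp
  hence "of_real x * \<beta> = (of_real (sqrt x) * csqrt \<beta>)\<^sup>2"
    by (simp only: power_mult_distrib power2_csqrt)
  moreover have "Re (csqrt \<beta>) > 0" using csqrt_sector[OF assms(1)] by linarith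
  hence "Re (of_real (sqrt x) * csqrt \<beta>) > 0"
    using assms(2) by (simp del: csqrt.sel)
  ultimately show ?thesis using csqrt_square by metis
qed

text \<open>Each term is exponentially small in sqrt N, whereas the divisor sum, with at most N
  divisors and powers at most N^K, grows only polynomially.\<close>

lemma rhs_local_bound:
  assumes \<beta>0: "Re \<beta>0 > 0"
  shows "\<exists>\<delta>>0. \<exists>M. summable M \<and> (\<forall>\<^sub>F n in sequentially. \<forall>\<beta>\<in>ball \<beta>0 \<delta>. \<forall>s\<in>ball s0 \<delta>.
           Re \<beta> > 0 \<longrightarrow> norm (rhs_term \<beta> s (Suc n)) \<le> M n)"
proof -
  \<comment> \<open>The gap in \<open>csqrt_sector\<close>. By continuity it exceeds half its value
    at \<beta>0 on a small ball, which makes the decay rate uniform in \<beta>.\<close>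
  define h where "h = (\<lambda>\<beta>. Re (csqrt \<beta>) - \<bar>Im (csqrt \<beta>)\<bar>)"
  define \<kappa> where "\<kappa> = h \<beta>0 / 2"
  have h0: "h \<beta>0 > \<kappa>" "\<kappa> > 0" using csqrt_sector[OF \<beta>0] by (auto simp: h_def \<kappa>_def)
  have "isCont h \<beta>0"
    unfolding h_def using \<beta>0
    by (intro continuous_diff continuous_rabs continuous_Re continuous_Im continuous_at_csqrt)
       (auto simp: complex_nonpos_Reals_iff)
  then obtain \<delta>1 where \<delta>1: "\<delta>1 > 0" "\<And>\<beta>. dist \<beta> \<beta>0 < \<delta>1 \<Longrightarrow> dist (h \<beta>) (h \<beta>0) < \<kappa>"
    using h0(2) unfolding continuous_at_eps_delta by blast
  define \<delta> where "\<delta> = min 1 \<delta>1"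
  define K where "K = norm s0 + 1"
  define c where "c = 2 * pi * sqrt 2 * \<kappa>"
  define M where "M = (\<lambda>n. real (Suc n) powr (K + 1) * exp (- c * sqrt (real (Suc n))))"
  have M: "summable M" unfolding M_def using h0 by (intro summable_powr_exp_sqrt) (simp add: c_def)
  have "norm (rhs_term \<beta> s (Suc n)) \<le> M n"
    if b: "\<beta> \<in> ball \<beta>0 \<delta>" and s: "s \<in> ball s0 \<delta>" and \<beta>: "Re \<beta> > 0" for n \<beta> s
  proof -
    define N where "N = real (Suc n)"
    have N: "N \<ge> 1" by (simp add: N_def)
    have "dist \<beta> \<beta>0 < \<delta>1" using b by (simp add: \<delta>_def dist_commute)
    from \<delta>1(2)[OF this] have "\<bar>h \<beta> - h \<beta>0\<bar> < \<kappa>" by (simp add: dist_real_def)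
    moreover have "h \<beta>0 - h \<beta> \<le> \<bar>h \<beta> - h \<beta>0\<bar>" by simp
    ultimately have hb: "h \<beta> \<ge> \<kappa>" by (simp add: \<kappa>_def)
    have Rs: "Re s \<le> K"
      using ball_complex_bounds(3)[OF s] complex_Re_le_cmod[of s] by (simp add: K_def \<delta>_def)
    define q where "q = csqrt (2 * of_nat (Suc n) * \<beta>)"
    have q: "q = of_real (sqrt (2 * N)) * csqrt \<beta>"
      using csqrt_scale[OF \<beta>, of "2 * N"] N by (simp add: q_def N_def)
    have "norm (exp (- 2 * of_real pi * q) * sin (of_real pi / 4 - 2 * of_real pi * q)) \<le>
        exp (- 2 * pi * Re q) * exp (2 * pi * \<bar>Im q\<bar>)"
      unfolding norm_mult[of "exp _"]
    proof (rule mult_mono)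
      show "norm (exp (- 2 * of_real pi * q)) \<le> exp (- 2 * pi * Re q)" by simp
      have "norm (sin (of_real pi / 4 - 2 * of_real pi * q)) \<le> exp \<bar>Im (of_real pi / 4 - 2 * of_real pi * q)\<bar>"
        using cmod_sin_le_exp[of 1 "of_real pi / 4 - 2 * of_real pi * q"] by simp
      also have "Im (of_real pi / 4 - 2 * of_real pi * q) = - (2 * pi * Im q)" by simp
      finally show "norm (sin (of_real pi / 4 - 2 * of_real pi * q)) \<le> exp (2 * pi * \<bar>Im q\<bar>)"
        by (simp add: abs_mult)
    qed auto
    also have "\<dots> = exp (- (2 * pi * sqrt (2 * N) * h \<beta>))"
      using N by (simp add: q h_def abs_mult algebra_simps flip: exp_add)
    also have "\<dots> \<le> exp (- c * sqrt N)"
    proof -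
      have "2 * pi * sqrt (2 * N) * \<kappa> \<le> 2 * pi * sqrt (2 * N) * h \<beta>"
        using N hb by (intro mult_left_mono) auto
      thus ?thesis by (simp add: c_def real_sqrt_mult mult_ac)
    qed
    finally have E: "norm (exp (- 2 * of_real pi * q) * sin (of_real pi / 4 - 2 * of_real pi * q)) \<le> exp (- c * sqrt N)" .
    have "norm (divisor_sigma s (Suc n)) \<le> (\<Sum>d | d dvd Suc n. real d powr Re s)"
      by (rule norm_divisor_sigma_le)
    also have "\<dots> \<le> (\<Sum>d | d dvd Suc n. N powr K)"
    proof (rule sum_mono)
      fix d assume "d \<in> {d. d dvd Suc n}"
      hence d: "1 \<le> real d" "real d \<le> N" using divisors_Suc_subset[of n] by (auto simp: N_def)
      have "real d powr Re s \<le> real d powr K" using d Rs by (intro powr_mono) auto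
      also have "\<dots> \<le> N powr K" using d by (intro powr_mono2) (auto simp: K_def)
      finally show "real d powr Re s \<le> N powr K" .
    qed
    also have "\<dots> = real (card {d. d dvd Suc n}) * N powr K" by simp
    also have "\<dots> \<le> N * N powr K"
      using card_mono[OF _ divisors_Suc_subset[of n]] by (intro mult_right_mono) (auto simp: N_def)
    also have "\<dots> = N powr (K + 1)" using N by (simp add: powr_add)
    finally have D: "norm (divisor_sigma s (Suc n)) \<le> N powr (K + 1)" .
    have "norm (divisor_sigma s (Suc n) / of_real (sqrt N)) \<le> N powr (K + 1) / 1"
      unfolding norm_divide using D N by (intro frac_le) auto
    hence "norm (divisor_sigma s (Suc n) / of_real (sqrt N)) * norm (exp (- 2 * of_real pi * q) * sin (of_real pi / 4 - 2 * of_real pi * q))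
       \<le> N powr (K + 1) * exp (- c * sqrt N)"
      using E by (intro mult_mono) auto
    moreover have "rhs_term \<beta> s (Suc n) = divisor_sigma s (Suc n) / of_real (sqrt N) *
        (exp (- 2 * of_real pi * q) * sin (of_real pi / 4 - 2 * of_real pi * q))"
      unfolding rhs_term_def q_def N_def by (simp only: mult.assoc)
    ultimately show ?thesis by (simp only: norm_mult[of "_ / _"] M_def N_def)
  qed
  moreover have "\<delta> > 0" using \<delta>1 by (simp add: \<delta>_def)
  ultimately show ?thesis using M by (intro exI[of _ \<delta>] conjI exI[of _ M] always_eventually) auto
qed

lemma riemann_zeta_compose_holomorphic:
  assumes "f holomorphic_on S" "\<And>s. s \<in> S \<Longrightarrow> f s \<noteq> 1"
  shows "(\<lambda>s. riemann_zeta (f s)) holomorphic_on S"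
proof -
  have "f ` S \<subseteq> - {1}" using assms(2) by auto
  from holomorphic_on_compose_gen[OF assms(1) holomorphic_riemann_zeta this]
  show ?thesis by (simp add: o_def)
qed

lemma plus_minus_i_nat_nonpos:
  assumes "Re \<beta> > 0"
  shows "\<beta> - \<i> * of_nat n \<notin> \<real>\<^sub>\<le>\<^sub>0" "\<beta> + \<i> * of_nat n \<notin> \<real>\<^sub>\<le>\<^sub>0"
  using assms by (auto simp: complex_nonpos_Reals_iff)

text \<open>An infinite sum has a value even when it diverges, so convergence of both series is part
  of the claim. The summation index is shifted: \<open>Suc n\<close> is the n of the series.\<close>

theorem corollary7p2:
  fixes \<beta> s :: complex
  assumes "Re \<beta> > 0" and "Re s > - 1/2"
  shows "summable (\<lambda>n. lhs_term \<beta> s (Suc n)) \<and>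
         summable (\<lambda>n. rhs_term \<beta> s (Suc n)) \<and>
         Gamma (s + 1/2) *
           (riemann_zeta (- s) / (2 * \<beta> powr (s + 1/2)) + (\<Sum>n. lhs_term \<beta> s (Suc n)))
         = (2 * of_real pi) powr s *
           (- 2 * of_real pi * csqrt (of_real pi * \<beta>) * riemann_zeta (- s)
            - of_real (sqrt (pi / 2)) * riemann_zeta (1/2) * riemann_zeta (1/2 - s)
            + of_real (sqrt pi) * (\<Sum>n. rhs_term \<beta> s (Suc n)))"
proof -
  define U where "U = {s :: complex. Re s > - 1/2}"
  define V where "V = {\<beta> :: complex. Re \<beta> > 0}"
  have U: "open U" "connected U" and V: "open V" "connected V"
    unfolding U_def V_def
    by (auto intro: open_halfspace_Re_gt convex_connected convex_halfspace_Re_gt)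
  \<comment> \<open>The bounds hold uniformly in both variables; freezing one of them gives the
    local M-test in the other.\<close>
  have lhs_s: "\<exists>\<delta>>0. \<exists>M. summable M \<and> (\<forall>\<^sub>F n in sequentially. \<forall>s\<in>ball s0 \<delta> \<inter> U. norm (lhs_term \<beta> s (Suc n)) \<le> M n)"
    and lhs_\<beta>: "\<exists>\<delta>>0. \<exists>M. summable M \<and> (\<forall>\<^sub>F n in sequentially. \<forall>\<beta>'\<in>ball \<beta> \<delta> \<inter> V. norm (lhs_term \<beta>' s0 (Suc n)) \<le> M n)"
    if "\<beta> \<in> V" "s0 \<in> U" for \<beta> s0
  proof -
    have *: "Re \<beta> > 0" "Re s0 > - 1/2" using that by (auto simp: U_def V_def)
    from lhs_local_bound[OF *] obtain \<delta> M where \<delta>: "\<delta> > 0" and M: "summable M"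
      and ev: "\<forall>\<^sub>F n in sequentially. \<forall>\<beta>'\<in>ball \<beta> \<delta>. \<forall>s\<in>ball s0 \<delta>. Re \<beta>' > 0 \<longrightarrow> norm (lhs_term \<beta>' s (Suc n)) \<le> M n"
      by blast
    have "\<forall>\<^sub>F n in sequentially. \<forall>s\<in>ball s0 \<delta> \<inter> U. norm (lhs_term \<beta> s (Suc n)) \<le> M n"
      using ev by eventually_elim (use \<delta> * in auto)
    with \<delta> M show "\<exists>\<delta>>0. \<exists>M. summable M \<and> (\<forall>\<^sub>F n in sequentially. \<forall>s\<in>ball s0 \<delta> \<inter> U. norm (lhs_term \<beta> s (Suc n)) \<le> M n)"
      by blast
    have "\<forall>\<^sub>F n in sequentially. \<forall>\<beta>'\<in>ball \<beta> \<delta> \<inter> V. norm (lhs_term \<beta>' s0 (Suc n)) \<le> M n"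
      using ev by eventually_elim (use \<delta> in \<open>auto simp: V_def\<close>)
    with \<delta> M show "\<exists>\<delta>>0. \<exists>M. summable M \<and> (\<forall>\<^sub>F n in sequentially. \<forall>\<beta>'\<in>ball \<beta> \<delta> \<inter> V. norm (lhs_term \<beta>' s0 (Suc n)) \<le> M n)"
      by blast
  qed
  have rhs_s: "\<exists>\<delta>>0. \<exists>M. summable M \<and> (\<forall>\<^sub>F n in sequentially. \<forall>s\<in>ball s0 \<delta> \<inter> U. norm (rhs_term \<beta> s (Suc n)) \<le> M n)"
    and rhs_\<beta>: "\<exists>\<delta>>0. \<exists>M. summable M \<and> (\<forall>\<^sub>F n in sequentially. \<forall>\<beta>'\<in>ball \<beta> \<delta> \<inter> V. norm (rhs_term \<beta>' s0 (Suc n)) \<le> M n)"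
    if "\<beta> \<in> V" for \<beta> s0
  proof -
    have *: "Re \<beta> > 0" using that by (simp add: V_def)
    from rhs_local_bound[OF *, of s0] obtain \<delta> M where \<delta>: "\<delta> > 0" and M: "summable M"
      and ev: "\<forall>\<^sub>F n in sequentially. \<forall>\<beta>'\<in>ball \<beta> \<delta>. \<forall>s\<in>ball s0 \<delta>. Re \<beta>' > 0 \<longrightarrow> norm (rhs_term \<beta>' s (Suc n)) \<le> M n"
      by blast
    have "\<forall>\<^sub>F n in sequentially. \<forall>s\<in>ball s0 \<delta> \<inter> U. norm (rhs_term \<beta> s (Suc n)) \<le> M n"
      using ev by eventually_elim (use \<delta> * in auto)
    with \<delta> M show "\<exists>\<delta>>0. \<exists>M. summable M \<and> (\<forall>\<^sub>F n in sequentially. \<forall>s\<in>ball s0 \<delta> \<inter> U. norm (rhs_term \<beta> s (Suc n)) \<le> M n)"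
      by blast
    have "\<forall>\<^sub>F n in sequentially. \<forall>\<beta>'\<in>ball \<beta> \<delta> \<inter> V. norm (rhs_term \<beta>' s0 (Suc n)) \<le> M n"
      using ev by eventually_elim (use \<delta> in \<open>auto simp: V_def\<close>)
    with \<delta> M show "\<exists>\<delta>>0. \<exists>M. summable M \<and> (\<forall>\<^sub>F n in sequentially. \<forall>\<beta>'\<in>ball \<beta> \<delta> \<inter> V. norm (rhs_term \<beta>' s0 (Suc n)) \<le> M n)"
      by blast
  qed
  have csq: "2 * of_nat (Suc n) * \<beta> \<notin> \<real>\<^sub>\<le>\<^sub>0" "of_real pi * \<beta> \<notin> \<real>\<^sub>\<le>\<^sub>0" if "\<beta> \<in> V" for \<beta> n
    using that pi_gt_zero by (auto simp: V_def complex_nonpos_Reals_iff mult_le_0_iff simp del: of_nat_Suc pi_gt_zero)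
  have hol_lhs_s: "(\<lambda>s. lhs_term \<beta> s (Suc n)) holomorphic_on U" if "\<beta> \<in> V" for \<beta> n
  proof -
    have nz: "\<beta> - \<i> * of_nat (Suc n) \<noteq> 0" "\<beta> + \<i> * of_nat (Suc n) \<noteq> 0"
      using that by (auto simp: V_def complex_eq_iff)
    show ?thesis unfolding lhs_term_def
      by (intro holomorphic_intros holomorphic_divisor_sigma nz) (auto simp del: of_nat_Suc)
  qed
  have hol_lhs_\<beta>: "(\<lambda>\<beta>. lhs_term \<beta> s (Suc n)) holomorphic_on V" for s n
    unfolding lhs_term_def
    by (intro holomorphic_intros) (use plus_minus_i_nat_nonpos in \<open>auto simp: V_def simp del: of_nat_Suc\<close>)
  have hol_rhs_s: "(\<lambda>s. rhs_term \<beta> s (Suc n)) holomorphic_on U" for \<beta> n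
    unfolding rhs_term_def
    by (intro holomorphic_intros holomorphic_divisor_sigma) (auto simp del: of_nat_Suc)
  have hol_rhs_\<beta>: "(\<lambda>\<beta>. rhs_term \<beta> s (Suc n)) holomorphic_on V" for s n
    unfolding rhs_term_def
    by (intro holomorphic_intros) (use csq in \<open>auto simp del: of_nat_Suc\<close>)
  define L where "L = (\<lambda>\<beta> s. Gamma (s + 1/2) *
           (riemann_zeta (- s) / (2 * \<beta> powr (s + 1/2)) + (\<Sum>n. lhs_term \<beta> s (Suc n))))"
  define R where "R = (\<lambda>\<beta> s. (2 * of_real pi) powr s *
           (- 2 * of_real pi * csqrt (of_real pi * \<beta>) * riemann_zeta (- s)
            - of_real (sqrt (pi / 2)) * riemann_zeta (1/2) * riemann_zeta (1/2 - s)
            + of_real (sqrt pi) * (\<Sum>n. rhs_term \<beta> s (Suc n))))"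
  have Gam: "s + 1/2 \<notin> \<int>\<^sub>\<le>\<^sub>0" if "s \<in> U" for s
  proof
    assume "s + 1/2 \<in> \<int>\<^sub>\<le>\<^sub>0"
    then obtain n where "s + 1/2 = of_int n" "n \<le> 0" by (elim nonpos_Ints_cases) auto
    hence "Re s + 1/2 = of_int n" by (simp add: complex_eq_iff)
    moreover have "real_of_int n \<le> 0" using \<open>n \<le> 0\<close> by simp
    ultimately show False using that by (simp add: U_def)
  qed
  have z1: "(\<lambda>s. riemann_zeta (- s)) holomorphic_on U"
    by (intro riemann_zeta_compose_holomorphic holomorphic_intros) (auto simp: U_def complex_eq_iff)
  have z2: "(\<lambda>s. riemann_zeta (1/2 - s)) holomorphic_on U"
    by (intro riemann_zeta_compose_holomorphic holomorphic_intros) (auto simp: U_def complex_eq_iff)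
  have L_s: "L \<beta> holomorphic_on U" and R_s: "R \<beta> holomorphic_on U" if \<beta>: "\<beta> \<in> V" for \<beta>
  proof -
    have nz: "\<beta> \<noteq> 0" using \<beta> by (auto simp: V_def)
    have 1: "(\<lambda>s. \<Sum>n. lhs_term \<beta> s (Suc n)) holomorphic_on U"
      by (rule holomorphic_on_suminf[OF U(1) hol_lhs_s[OF \<beta>] lhs_s[OF \<beta>]])
    have 2: "(\<lambda>s. \<Sum>n. rhs_term \<beta> s (Suc n)) holomorphic_on U"
      by (rule holomorphic_on_suminf[OF U(1) hol_rhs_s rhs_s[OF \<beta>]])
    show "L \<beta> holomorphic_on U"
      unfolding L_def by (intro holomorphic_intros 1 z1 nz Gam) (use nz in auto)
    show "R \<beta> holomorphic_on U"
      unfolding R_def by (intro holomorphic_intros 2 z1 z2)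
  qed
  have L_\<beta>: "(\<lambda>\<beta>. L \<beta> s) holomorphic_on V" and R_\<beta>: "(\<lambda>\<beta>. R \<beta> s) holomorphic_on V" if s: "s \<in> U" for s
  proof -
    have nz: "\<beta> \<notin> \<real>\<^sub>\<le>\<^sub>0" "\<beta> \<noteq> 0" if "\<beta> \<in> V" for \<beta>
      using that by (auto simp: V_def complex_nonpos_Reals_iff)
    have 1: "(\<lambda>\<beta>. \<Sum>n. lhs_term \<beta> s (Suc n)) holomorphic_on V"
      by (rule holomorphic_on_suminf[OF V(1) hol_lhs_\<beta> lhs_\<beta>[OF _ s]])
    have 2: "(\<lambda>\<beta>. \<Sum>n. rhs_term \<beta> s (Suc n)) holomorphic_on V"
      by (rule holomorphic_on_suminf[OF V(1) hol_rhs_\<beta> rhs_\<beta>])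
    show "(\<lambda>\<beta>. L \<beta> s) holomorphic_on V"
      unfolding L_def by (intro holomorphic_intros 1) (use nz in auto)
    show "(\<lambda>\<beta>. R \<beta> s) holomorphic_on V"
      unfolding R_def by (intro holomorphic_intros 2) (use csq in auto)
  qed
  \<comment> \<open>Continuation in s at fixed real \<beta>: the interval -1/2 < s < 0 is the range
    0 < a < 1/2.\<close>
  have real_\<beta>: "L (of_real x) s = R (of_real x) s" if x: "x > 0" and s: "s \<in> U" for x s
  proof -
    have xV: "of_real x \<in> V" using x by (simp add: V_def)
    show ?thesis
    proof (rule holomorphic_eq_from_real_interval[where f = "L (of_real x)" and g = "R (of_real x)"
          and a = "- 1/2" and b = 0, OF L_s[OF xV] R_s[OF xV] U])
      fix t :: real assume t: "- 1/2 < t" "t < 0"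
      show "complex_of_real t \<in> U" using t by (simp add: U_def)
      show "L (of_real x) (of_real t) = R (of_real x) (of_real t)"
        using corollary7p2_real[of "t + 1/2" x] t x by (simp add: L_def R_def)
    qed (use s in auto)
  qed
  have sU: "s \<in> U" and \<beta>V: "\<beta> \<in> V" using assms by (auto simp: U_def V_def)
  \<comment> \<open>Continuation in \<beta> at fixed s, from a segment of the positive axis into the
    half plane.\<close>
  have "L \<beta> s = R \<beta> s"
  proof (rule holomorphic_eq_from_real_interval[where f = "\<lambda>\<beta>. L \<beta> s" and g = "\<lambda>\<beta>. R \<beta> s"
        and a = 0 and b = 1, OF L_\<beta>[OF sU] R_\<beta>[OF sU] V])
    show "complex_of_real x \<in> V" if "0 < x" for x using that by (simp add: V_def)
  qed (use real_\<beta>[OF _ sU] \<beta>V in auto)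
  moreover have "summable (\<lambda>n. lhs_term \<beta> s (Suc n))"
    by (rule summable_of_local_bound[OF U(1) hol_lhs_s[OF \<beta>V] lhs_s[OF \<beta>V] sU])
  moreover have "summable (\<lambda>n. rhs_term \<beta> s (Suc n))"
    by (rule summable_of_local_bound[OF U(1) hol_rhs_s rhs_s[OF \<beta>V] sU])
  ultimately show ?thesis unfolding L_def R_def by blast
qed

end
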